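(* Let $R$ be a (unital, not necessarily commutative) Cu-semiring. Then $\pi_R\colon R\to[\![R,R]\!]$ is a multiplicative order-embedding (where $[\![R,R]\!]$ carries the composition product). Thus, via $\pi_R$, $R$ is a sub-semiring of $[\![R,R]\!]$. If the unit of $R$ is compact, then $R$ is (via $\pi_R$) even a unital sub-semiring of $[\![R,R]\!]$.
   Context: A positively ordered semigroup is a commutative monoid $(S,+,0)$ with a partial order $\le$ compatible with addition such that $0\le a$ for all $a$. For $a,b\in S$, $a\ll b$ (way-below) means: whenever $(c_n)_n$ is an increasing sequence in $S$ whose supremum exists and satisfies $b\le\sup_n c_n$, there is $k$ with $a\le c_k$. An element $a$ is compact if $a\ll a$. A Cu-semigroup is a positively ordered semigroup satisfying: (O1) every increasing sequence has a supremum; (O2) every $a$ is the supremum of a sequence $(a_n)_n$ with $a_n\ll a_{n+1}$ for all $n$; (O3) $a'\ll a$ and $b'\ll b$ imply $a'+b'\ll a+b$; (O4) $\sup_n(a_n+b_n)=\sup_n a_n+\sup_n b_n$ for increasing sequences. A generalized Cu-morphism is a map between Cu-semigroups preserving addition, zero, order and suprema of increasing sequences; a Cu-morphism additionally preserves $\ll$. $\mathrm{Cu}[S,T]$ and $\mathrm{Cu}(S,T)$ denote the sets of generalized Cu-morphisms and of Cu-morphisms $S\to T$, with pointwise order and addition. A map $f$ is an order-embedding if $f(a)\le f(b)$ iff $a\le b$. A Cu-bimorphism $\varphi\colon S\times T\to P$ is a map that is additive, zero- and order-preserving in each variable, satisfies $\sup_k\varphi(a_k,b_k)=\varphi(\sup_k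 a_k,\sup_k b_k)$ for increasing sequences, and satisfies $\varphi(a',b')\ll\varphi(a,b)$ whenever $a'\ll a$ and $b'\ll b$. $S\otimes T$ denotes the Cu-semigroup with universal Cu-bimorphism $S\times T\to S\otimes T$, $(a,b)\mapsto a\otimes b$: every Cu-bimorphism $S\times T\to P$ factors through a unique Cu-morphism $S\otimes T\to P$, and Cu-morphisms $\alpha_1,\alpha_2\colon S\otimes T\to P$ satisfy $\alpha_1\le\alpha_2$ iff $\alpha_1(a\otimes b)\le\alpha_2(a\otimes b)$ for all $a,b$. The tensor product is associative up to natural isomorphism. Let $I_{\mathbb Q}=\mathbb Q\cap(0,1)$. For $\varphi,\psi\in\mathrm{Cu}[S,T]$ write $\varphi\prec\psi$ if $\varphi(a')\ll\psi(a)$ whenever $a'\ll a$ in $S$. A path in $\mathrm{Cu}[S,T]$ is a family $\mathbf f=(f_\lambda)_{\lambda\in I_{\mathbb Q}}$ with $f_{\lambda'}\prec f_\lambda$ whenever $\lambda'<\lambda$. Write $\mathbf f\lesssim\mathbf g$ if for every $\lambda$ there is $\mu$ with $f_\lambda\prec g_\mu$. The internal hom $[\![S,T]\!]$ is the set of classes $[\mathbf f]$ of paths modulo ($\mathbf f\lesssim\mathbf g$ and $\mathbf g\lesssim\mathbf f$), with $[\mathbf f]+[\mathbf g]=[(f_\lambda+g_\lambda)_\lambda]$ and $[\mathbf f]\le[\mathbf g]$ iff $\mathbf f\lesssim\mathbf g$; it is a Cu-semigroup. A Cu-morphism $\varphi\colon S\to T$ satisfies $\varphi\prec\varphi$ and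 is identified with the class of the constant path $(\varphi)_\lambda$ in $[\![S,T]\!]$. The endpoint map $\sigma_{S,T}\colon[\![S,T]\!]\to\mathrm{Cu}[S,T]$ is $\sigma_{S,T}([\mathbf f])(a)=\sup_\lambda f_\lambda(a)$. It is known that for Cu-semigroups $S,T,P$ there is a bijection $\mathrm{Cu}(S,[\![T,P]\!])\cong\mathrm{Cu}(S\otimes T,P)$ sending $\alpha$ to the Cu-morphism $a\otimes b\mapsto\sigma_{T,P}(\alpha(a))(b)$. The evaluation map $\mathrm e_{S,T}\colon[\![S,T]\!]\otimes S\to T$ is the Cu-morphism corresponding to $\mathrm{id}_{[\![S,T]\!]}$. The composition product $\circ\colon[\![T,P]\!]\otimes[\![S,T]\!]\to[\![S,P]\!]$, $y\otimes x\mapsto y\circ x$, is the Cu-morphism corresponding to $\mathrm e_{T,P}\circ(\mathrm{id}_{[\![T,P]\!]}\otimes\mathrm e_{S,T})\colon[\![T,P]\!]\otimes[\![S,T]\!]\otimes S\to P$. It is known that $[\![S,S]\!]$ with this product is a Cu-semiring with unit $\mathrm{id}_S$. A Cu-semiring is a Cu-semigroup $R$ with a Cu-bimorphism $R\times R\to R$, $(r,s)\mapsto rs$, that is associative, and an element $1_R\in R$ with $r1_R=r=1_Rr$ for all $r$. $\mu_R\colon R\otimes R\to R$ is the Cu-morphism induced by multiplication. $\pi_R\colon R\to[\![R,R]\!]$ is the Cu-morphism corresponding to $\mu_R$ under $\mathrm{Cu}(R,[\![R,R]\!])\cong\mathrm{Cu}(R\otimes R,R)$. *)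

theory Defs
  imports Complex_Main "HOL-Library.Multiset" "HOL-Algebra.Group"
begin

section \<open>Cu-semigroups\<close>

text \<open>
  Structures are carrier-based, as in HOL-Algebra: the order, its least upper bounds and order
  embeddings are those of \<^theory>\<open>HOL-Algebra.Order\<close> (the locale \<^locale>\<open>partial_order\<close>
  forces the field \<^const>\<open>eq\<close> to be equality).
\<close>

record 'a po_semigroup = "'a gorder" +
  add :: "'a \<Rightarrow> 'a \<Rightarrow> 'a" (infixl "\<oplus>\<index>" 65)
  zero :: 'a ("\<zero>\<index>")

definition pos_ordered_semigroup :: "('a, 'm) po_semigroup_scheme \<Rightarrow> bool" where
  "pos_ordered_semigroup S \<longleftrightarrow>
     partial_order S \<and>
     comm_monoid \<lparr>carrier = carrier S, mult = add S, one = \<zero>\<^bsub>S\<^esub>\<rparr> \<and>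
     (\<forall>a\<in>carrier S. \<forall>b\<in>carrier S. \<forall>c\<in>carrier S.
        a \<sqsubseteq>\<^bsub>S\<^esub> b \<longrightarrow> a \<oplus>\<^bsub>S\<^esub> c \<sqsubseteq>\<^bsub>S\<^esub> b \<oplus>\<^bsub>S\<^esub> c) \<and>
     (\<forall>a\<in>carrier S. \<zero>\<^bsub>S\<^esub> \<sqsubseteq>\<^bsub>S\<^esub> a)"

definition inc_seq :: "('a, 'm) po_semigroup_scheme \<Rightarrow> (nat \<Rightarrow> 'a) \<Rightarrow> bool" where
  "inc_seq S c \<longleftrightarrow> (\<forall>n. c n \<in> carrier S \<and> c n \<sqsubseteq>\<^bsub>S\<^esub> c (Suc n))"

definition has_sup :: "('a, 'm) po_semigroup_scheme \<Rightarrow> 'a set \<Rightarrow> 'a \<Rightarrow> bool" where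
  "has_sup S A x \<longleftrightarrow> A \<subseteq> carrier S \<and> least S x (Upper S A)"

definition way_below ::
    "('a, 'm) po_semigroup_scheme \<Rightarrow> 'a \<Rightarrow> 'a \<Rightarrow> bool" (infixl "\<lless>\<index>" 50) where
  "a \<lless>\<^bsub>S\<^esub> b \<longleftrightarrow>
     a \<in> carrier S \<and> b \<in> carrier S \<and>
     (\<forall>c x. inc_seq S c \<and> has_sup S (range c) x \<and> b \<sqsubseteq>\<^bsub>S\<^esub> x \<longrightarrow> (\<exists>k. a \<sqsubseteq>\<^bsub>S\<^esub> c k))"

definition compact_elt :: "('a, 'm) po_semigroup_scheme \<Rightarrow> 'a \<Rightarrow> bool" where
  "compact_elt S a \<longleftrightarrow> a \<lless>\<^bsub>S\<^esub> a"

definition cu_semigroup :: "('a, 'm) po_semigroup_scheme \<Rightarrow> bool" where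
  "cu_semigroup S \<longleftrightarrow>
     pos_ordered_semigroup S \<and>
     \<comment> \<open>(O1)\<close>
     (\<forall>c. inc_seq S c \<longrightarrow> (\<exists>x. has_sup S (range c) x)) \<and>
     \<comment> \<open>(O2)\<close>
     (\<forall>a\<in>carrier S. \<exists>c. (\<forall>n. c n \<lless>\<^bsub>S\<^esub> c (Suc n)) \<and> has_sup S (range c) a) \<and>
     \<comment> \<open>(O3)\<close>
     (\<forall>a' a b' b. a' \<lless>\<^bsub>S\<^esub> a \<and> b' \<lless>\<^bsub>S\<^esub> b \<longrightarrow> a' \<oplus>\<^bsub>S\<^esub> b' \<lless>\<^bsub>S\<^esub> a \<oplus>\<^bsub>S\<^esub> b) \<and>
     \<comment> \<open>(O4)\<close>
     (\<forall>c d x y. inc_seq S c \<and> inc_seq S d \<and> has_sup S (range c) x \<and> has_sup S (range d) y \<longrightarrow>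
        has_sup S (range (\<lambda>n. c n \<oplus>\<^bsub>S\<^esub> d n)) (x \<oplus>\<^bsub>S\<^esub> y))"


section \<open>Morphisms and bimorphisms\<close>

definition po_hom ::
    "('a, 'm) po_semigroup_scheme \<Rightarrow> ('b, 'n) po_semigroup_scheme \<Rightarrow> ('a \<Rightarrow> 'b) \<Rightarrow> bool" where
  "po_hom S T f \<longleftrightarrow>
     f \<in> carrier S \<rightarrow> carrier T \<and>
     f \<zero>\<^bsub>S\<^esub> = \<zero>\<^bsub>T\<^esub> \<and>
     (\<forall>a\<in>carrier S. \<forall>b\<in>carrier S. f (a \<oplus>\<^bsub>S\<^esub> b) = f a \<oplus>\<^bsub>T\<^esub> f b) \<and>
     (\<forall>a\<in>carrier S. \<forall>b\<in>carrier S. a \<sqsubseteq>\<^bsub>S\<^esub> b \<longrightarrow> f a \<sqsubseteq>\<^bsub>T\<^esub> f b)"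

text \<open>
  The sets \<open>Cu[S,T]\<close> and \<open>Cu(S,T)\<close>.  Their elements are extensional functions, so that two of
  them are equal as soon as they agree on the carrier.
\<close>

definition gen_Cu ::
    "('a, 'm) po_semigroup_scheme \<Rightarrow> ('b, 'n) po_semigroup_scheme \<Rightarrow> ('a \<Rightarrow> 'b) set" where
  "gen_Cu S T =
     {f \<in> carrier S \<rightarrow>\<^sub>E carrier T.
        po_hom S T f \<and>
        (\<forall>c x. inc_seq S c \<and> has_sup S (range c) x \<longrightarrow> has_sup T (range (\<lambda>n. f (c n))) (f x))}"

definition Cu ::
    "('a, 'm) po_semigroup_scheme \<Rightarrow> ('b, 'n) po_semigroup_scheme \<Rightarrow> ('a \<Rightarrow> 'b) set" where
  "Cu S T = {f \<in> gen_Cu S T. \<forall>a' a. a' \<lless>\<^bsub>S\<^esub> a \<longrightarrow> f a' \<lless>\<^bsub>T\<^esub> f a}"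

definition cu_bimorphism ::
    "('a, 'm) po_semigroup_scheme \<Rightarrow> ('b, 'n) po_semigroup_scheme \<Rightarrow>
     ('c, 'k) po_semigroup_scheme \<Rightarrow> ('a \<Rightarrow> 'b \<Rightarrow> 'c) \<Rightarrow> bool" where
  "cu_bimorphism S T P \<phi> \<longleftrightarrow>
     (\<forall>b\<in>carrier T. po_hom S P (\<lambda>a. \<phi> a b)) \<and>
     (\<forall>a\<in>carrier S. po_hom T P (\<lambda>b. \<phi> a b)) \<and>
     (\<forall>c d x y. inc_seq S c \<and> inc_seq T d \<and> has_sup S (range c) x \<and> has_sup T (range d) y \<longrightarrow>
        has_sup P (range (\<lambda>k. \<phi> (c k) (d k))) (\<phi> x y)) \<and>
     (\<forall>a' a b' b. a' \<lless>\<^bsub>S\<^esub> a \<and> b' \<lless>\<^bsub>T\<^esub> b \<longrightarrow> \<phi> a' b' \<lless>\<^bsub>P\<^esub> \<phi> a b)"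


section \<open>Tensor products\<close>

text \<open>
  The universal property of the tensor product, for targets \<open>P\<close> whose elements have type \<open>'p\<close>.
\<close>

definition is_cu_tensor ::
    "'p itself \<Rightarrow> ('a, 'm) po_semigroup_scheme \<Rightarrow> ('b, 'n) po_semigroup_scheme \<Rightarrow>
     'x po_semigroup \<Rightarrow> ('a \<Rightarrow> 'b \<Rightarrow> 'x) \<Rightarrow> bool" where
  "is_cu_tensor _ S T X t \<longleftrightarrow>
     cu_semigroup X \<and> cu_bimorphism S T X t \<and>
     (\<forall>P :: 'p po_semigroup. cu_semigroup P \<longrightarrow>
        (\<forall>\<phi>. cu_bimorphism S T P \<phi> \<longrightarrow>
           (\<exists>!\<alpha>. \<alpha> \<in> Cu X P \<and> (\<forall>a\<in>carrier S. \<forall>b\<in>carrier T. \<alpha> (t a b) = \<phi> a b))) \<and>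
        (\<forall>\<alpha>\<^sub>1\<in>Cu X P. \<forall>\<alpha>\<^sub>2\<in>Cu X P.
           (\<forall>z\<in>carrier X. \<alpha>\<^sub>1 z \<sqsubseteq>\<^bsub>P\<^esub> \<alpha>\<^sub>2 z) \<longleftrightarrow>
           (\<forall>a\<in>carrier S. \<forall>b\<in>carrier T. \<alpha>\<^sub>1 (t a b) \<sqsubseteq>\<^bsub>P\<^esub> \<alpha>\<^sub>2 (t a b))))"

text \<open>
  HOL cannot quantify over the type of \<open>P\<close> inside a definition, so a tensor product is chosen
  that is universal among targets living on its own type.  Nothing is lost.  The type
  \<open>('a \<times> 'b) multiset set\<close> can hold a tensor product that is universal for targets of every type,
  namely the completion of the algebraic tensor product by countably generated round ideals, each
  of which is a set of finite formal sums of pairs.  Any structure on that type that is universal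
  among targets on that type is isomorphic to it, by a Cu-isomorphism respecting the universal
  bimorphisms, and hence is also universal for targets of every type.
\<close>

definition cu_tensor_pair ::
    "('a, 'm) po_semigroup_scheme \<Rightarrow> ('b, 'n) po_semigroup_scheme \<Rightarrow>
     ('a \<times> 'b) multiset set po_semigroup \<times> ('a \<Rightarrow> 'b \<Rightarrow> ('a \<times> 'b) multiset set)" where
  "cu_tensor_pair S T =
     (SOME (X, t). is_cu_tensor TYPE(('a \<times> 'b) multiset set) S T X t)"

definition cu_tensor ::
    "('a, 'm) po_semigroup_scheme \<Rightarrow> ('b, 'n) po_semigroup_scheme \<Rightarrow>
     ('a \<times> 'b) multiset set po_semigroup" where
  "cu_tensor S T = fst (cu_tensor_pair S T)"

definition pure_tensor ::
    "('a, 'm) po_semigroup_scheme \<Rightarrow> ('b, 'n) po_semigroup_scheme \<Rightarrow>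
     'a \<Rightarrow> 'b \<Rightarrow> ('a \<times> 'b) multiset set" where
  "pure_tensor S T = snd (cu_tensor_pair S T)"

definition tensor_lift ::
    "('a, 'm) po_semigroup_scheme \<Rightarrow> ('b, 'n) po_semigroup_scheme \<Rightarrow>
     ('c, 'k) po_semigroup_scheme \<Rightarrow> ('a \<Rightarrow> 'b \<Rightarrow> 'c) \<Rightarrow>
     ('a \<times> 'b) multiset set \<Rightarrow> 'c" where
  "tensor_lift S T P \<phi> =
     (THE \<alpha>. \<alpha> \<in> Cu (cu_tensor S T) P \<and>
             (\<forall>a\<in>carrier S. \<forall>b\<in>carrier T. \<alpha> (pure_tensor S T a b) = \<phi> a b))"

definition tensor_map ::
    "('a, 'm) po_semigroup_scheme \<Rightarrow> ('b, 'n) po_semigroup_scheme \<Rightarrow>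
     ('c, 'k) po_semigroup_scheme \<Rightarrow> ('d, 'l) po_semigroup_scheme \<Rightarrow>
     ('a \<Rightarrow> 'c) \<Rightarrow> ('b \<Rightarrow> 'd) \<Rightarrow> ('a \<times> 'b) multiset set \<Rightarrow> ('c \<times> 'd) multiset set" where
  "tensor_map S T S' T' \<alpha> \<beta> =
     tensor_lift S T (cu_tensor S' T') (\<lambda>a b. pure_tensor S' T' (\<alpha> a) (\<beta> b))"

text \<open>The associator from \<open>(S \<otimes> T) \<otimes> P\<close> to \<open>S \<otimes> (T \<otimes> P)\<close>.\<close>

definition tensor_assoc ::
    "('a, 'm) po_semigroup_scheme \<Rightarrow> ('b, 'n) po_semigroup_scheme \<Rightarrow>
     ('c, 'k) po_semigroup_scheme \<Rightarrow>
     (('a \<times> 'b) multiset set \<times> 'c) multiset set \<Rightarrow>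
     ('a \<times> ('b \<times> 'c) multiset set) multiset set" where
  "tensor_assoc S T P =
     (THE \<gamma>. \<gamma> \<in> Cu (cu_tensor (cu_tensor S T) P) (cu_tensor S (cu_tensor T P)) \<and>
        (\<forall>a\<in>carrier S. \<forall>b\<in>carrier T. \<forall>c\<in>carrier P.
           \<gamma> (pure_tensor (cu_tensor S T) P (pure_tensor S T a b) c) =
           pure_tensor S (cu_tensor T P) a (pure_tensor T P b c)))"


section \<open>The internal hom\<close>

abbreviation I_Q :: "rat set" where
  "I_Q \<equiv> {0<..<1}"

definition hom_prec ::
    "('a, 'm) po_semigroup_scheme \<Rightarrow> ('b, 'n) po_semigroup_scheme \<Rightarrow>
     ('a \<Rightarrow> 'b) \<Rightarrow> ('a \<Rightarrow> 'b) \<Rightarrow> bool" where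
  "hom_prec S T \<phi> \<psi> \<longleftrightarrow> (\<forall>a' a. a' \<lless>\<^bsub>S\<^esub> a \<longrightarrow> \<phi> a' \<lless>\<^bsub>T\<^esub> \<psi> a)"

definition paths ::
    "('a, 'm) po_semigroup_scheme \<Rightarrow> ('b, 'n) po_semigroup_scheme \<Rightarrow>
     (rat \<Rightarrow> 'a \<Rightarrow> 'b) set" where
  "paths S T =
     {f \<in> I_Q \<rightarrow>\<^sub>E gen_Cu S T.
        \<forall>\<kappa>\<in>I_Q. \<forall>\<nu>\<in>I_Q. \<kappa> < \<nu> \<longrightarrow> hom_prec S T (f \<kappa>) (f \<nu>)}"

definition path_le ::
    "('a, 'm) po_semigroup_scheme \<Rightarrow> ('b, 'n) po_semigroup_scheme \<Rightarrow>
     (rat \<Rightarrow> 'a \<Rightarrow> 'b) \<Rightarrow> (rat \<Rightarrow> 'a \<Rightarrow> 'b) \<Rightarrow> bool" where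
  "path_le S T f g \<longleftrightarrow> (\<forall>\<nu>\<in>I_Q. \<exists>\<mu>\<in>I_Q. hom_prec S T (f \<nu>) (g \<mu>))"

definition path_equiv ::
    "('a, 'm) po_semigroup_scheme \<Rightarrow> ('b, 'n) po_semigroup_scheme \<Rightarrow>
     ((rat \<Rightarrow> 'a \<Rightarrow> 'b) \<times> (rat \<Rightarrow> 'a \<Rightarrow> 'b)) set" where
  "path_equiv S T =
     {(f, g). f \<in> paths S T \<and> g \<in> paths S T \<and> path_le S T f g \<and> path_le S T g f}"

definition path_class ::
    "('a, 'm) po_semigroup_scheme \<Rightarrow> ('b, 'n) po_semigroup_scheme \<Rightarrow>
     (rat \<Rightarrow> 'a \<Rightarrow> 'b) \<Rightarrow> (rat \<Rightarrow> 'a \<Rightarrow> 'b) set" where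
  "path_class S T f = path_equiv S T `` {f}"

definition path_add ::
    "('a, 'm) po_semigroup_scheme \<Rightarrow> ('b, 'n) po_semigroup_scheme \<Rightarrow>
     (rat \<Rightarrow> 'a \<Rightarrow> 'b) \<Rightarrow> (rat \<Rightarrow> 'a \<Rightarrow> 'b) \<Rightarrow> rat \<Rightarrow> 'a \<Rightarrow> 'b" where
  "path_add S T f g = (\<lambda>\<nu>\<in>I_Q. \<lambda>a\<in>carrier S. f \<nu> a \<oplus>\<^bsub>T\<^esub> g \<nu> a)"

definition const_class ::
    "('a, 'm) po_semigroup_scheme \<Rightarrow> ('b, 'n) po_semigroup_scheme \<Rightarrow>
     ('a \<Rightarrow> 'b) \<Rightarrow> (rat \<Rightarrow> 'a \<Rightarrow> 'b) set" where
  "const_class S T \<phi> = path_class S T (\<lambda>\<nu>\<in>I_Q. \<phi>)"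

text \<open>
  The operations on classes are defined through all representatives, so the unions below are
  unions of one and the same class.
\<close>

definition ihom ::
    "('a, 'm) po_semigroup_scheme \<Rightarrow> ('b, 'n) po_semigroup_scheme \<Rightarrow>
     (rat \<Rightarrow> 'a \<Rightarrow> 'b) set po_semigroup" where
  "ihom S T =
     \<lparr>carrier = paths S T // path_equiv S T,
      eq = (=),
      le = (\<lambda>x y. \<exists>f\<in>x. \<exists>g\<in>y. path_le S T f g),
      add = (\<lambda>x y. \<Union>f\<in>x. \<Union>g\<in>y. path_class S T (path_add S T f g)),
      zero = const_class S T (\<lambda>a\<in>carrier S. \<zero>\<^bsub>T\<^esub>)\<rparr>"

text \<open>The supremum below is the same for every representative \<open>f\<close> of \<open>x\<close>.\<close>

definition endpoint ::
    "('a, 'm) po_semigroup_scheme \<Rightarrow> ('b, 'n) po_semigroup_scheme \<Rightarrow>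
     (rat \<Rightarrow> 'a \<Rightarrow> 'b) set \<Rightarrow> 'a \<Rightarrow> 'b" where
  "endpoint S T x =
     (\<lambda>a\<in>carrier S. THE s. \<exists>f\<in>x. has_sup T ((\<lambda>\<nu>. f \<nu> a) ` I_Q) s)"

text \<open>
  The bijection from \<open>Cu(S, \<lbrakk>T,P\<rbrakk>)\<close> to \<open>Cu(S \<otimes> T, P)\<close>, and its inverse.
\<close>

definition ihom_uncurry ::
    "('a, 'm) po_semigroup_scheme \<Rightarrow> ('b, 'n) po_semigroup_scheme \<Rightarrow>
     ('c, 'k) po_semigroup_scheme \<Rightarrow> ('a \<Rightarrow> (rat \<Rightarrow> 'b \<Rightarrow> 'c) set) \<Rightarrow>
     ('a \<times> 'b) multiset set \<Rightarrow> 'c" where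
  "ihom_uncurry S T P \<alpha> = tensor_lift S T P (\<lambda>a b. endpoint T P (\<alpha> a) b)"

definition ihom_curry ::
    "('a, 'm) po_semigroup_scheme \<Rightarrow> ('b, 'n) po_semigroup_scheme \<Rightarrow>
     ('c, 'k) po_semigroup_scheme \<Rightarrow> (('a \<times> 'b) multiset set \<Rightarrow> 'c) \<Rightarrow>
     'a \<Rightarrow> (rat \<Rightarrow> 'b \<Rightarrow> 'c) set" where
  "ihom_curry S T P = the_inv_into (Cu S (ihom T P)) (ihom_uncurry S T P)"

definition evaluation ::
    "('a, 'm) po_semigroup_scheme \<Rightarrow> ('b, 'n) po_semigroup_scheme \<Rightarrow>
     ((rat \<Rightarrow> 'a \<Rightarrow> 'b) set \<times> 'a) multiset set \<Rightarrow> 'b" where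
  "evaluation S T = ihom_uncurry (ihom S T) S T (\<lambda>x\<in>carrier (ihom S T). x)"

definition composition ::
    "('a, 'm) po_semigroup_scheme \<Rightarrow> ('b, 'n) po_semigroup_scheme \<Rightarrow>
     ('c, 'k) po_semigroup_scheme \<Rightarrow>
     ((rat \<Rightarrow> 'b \<Rightarrow> 'c) set \<times> (rat \<Rightarrow> 'a \<Rightarrow> 'b) set) multiset set \<Rightarrow>
     (rat \<Rightarrow> 'a \<Rightarrow> 'c) set" where
  "composition S T P =
     ihom_curry (cu_tensor (ihom T P) (ihom S T)) S P
       (\<lambda>z\<in>carrier (cu_tensor (cu_tensor (ihom T P) (ihom S T)) S).
          evaluation T P
            (tensor_map (ihom T P) (cu_tensor (ihom S T) S) (ihom T P) T
               (\<lambda>y\<in>carrier (ihom T P). y) (evaluation S T)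
               (tensor_assoc (ihom T P) (ihom S T) S z)))"


section \<open>Cu-semirings\<close>

record 'a po_semiring = "'a po_semigroup" +
  rmult :: "'a \<Rightarrow> 'a \<Rightarrow> 'a"
  runit :: 'a

definition cu_semiring :: "('a, 'm) po_semiring_scheme \<Rightarrow> bool" where
  "cu_semiring R \<longleftrightarrow>
     cu_semigroup R \<and>
     cu_bimorphism R R R (rmult R) \<and>
     monoid \<lparr>carrier = carrier R, mult = rmult R, one = runit R\<rparr>"

definition subsemiring :: "'a set \<Rightarrow> ('a, 'm) po_semiring_scheme \<Rightarrow> bool" where
  "subsemiring A Q \<longleftrightarrow>
     A \<subseteq> carrier Q \<and>
     \<zero>\<^bsub>Q\<^esub> \<in> A \<and>
     (\<forall>x\<in>A. \<forall>y\<in>A. x \<oplus>\<^bsub>Q\<^esub> y \<in> A) \<and>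
     (\<forall>x\<in>A. \<forall>y\<in>A. rmult Q x y \<in> A)"

definition unital_subsemiring :: "'a set \<Rightarrow> ('a, 'm) po_semiring_scheme \<Rightarrow> bool" where
  "unital_subsemiring A Q \<longleftrightarrow> subsemiring A Q \<and> runit Q \<in> A"

definition ihom_semiring ::
    "('a, 'm) po_semigroup_scheme \<Rightarrow> (rat \<Rightarrow> 'a \<Rightarrow> 'a) set po_semiring" where
  "ihom_semiring S =
     po_semigroup.extend (ihom S S)
       (po_semiring.fields
          (\<lambda>y x. composition S S S (pure_tensor (ihom S S) (ihom S S) y x))
          (const_class S S (\<lambda>a\<in>carrier S. a)))"

definition mult_map :: "('a, 'm) po_semiring_scheme \<Rightarrow> ('a \<times> 'a) multiset set \<Rightarrow> 'a" where
  "mult_map R = tensor_lift R R R (rmult R)"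

definition pi_map :: "('a, 'm) po_semiring_scheme \<Rightarrow> 'a \<Rightarrow> (rat \<Rightarrow> 'a \<Rightarrow> 'a) set" where
  "pi_map R = ihom_curry R R R (mult_map R)"

end

theory Submission
  imports Defs "HOL-Library.Countable" "HOL-Library.Nat_Bijection"
begin

text \<open>
  Currying turns a Cu-bimorphism \<open>A \<times> S \<rightarrow> T\<close> into a Cu-morphism \<open>A \<rightarrow> \<lbrakk>S,T\<rbrakk>\<close>, and although the
  endpoint map is not injective, a Cu-(bi)morphism into \<open>\<lbrakk>S,T\<rbrakk>\<close> is determined by the endpoints of its
  values: every value is the supremum of a \<open>\<lless>\<close>-increasing sequence of values, and \<open>x \<lless> y\<close> forces the
  endpoint of \<open>x\<close> below the paths representing \<open>y\<close>.  The endpoint of \<open>\<pi>(r)\<close> is left multiplication by \<open>r\<close>, and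
  the endpoint of a composition product is the composite of the endpoints.  Hence \<open>\<pi>(rs)\<close> and \<open>\<pi>(r) \<circ> \<pi>(s)\<close>
  are Cu-bimorphisms with equal endpoints \<open>t \<mapsto> rst\<close>, evaluating at the unit shows that \<open>\<pi>\<close> reflects the
  order, and if the unit is compact then \<open>\<pi>(1)\<close> and the identity are compact elements with the same endpoint.

  Both the tensor product and the internal hom are completions of a monoid with a dense, transitive,
  additive relation by its countably generated round ideals: for the tensor product the monoid consists of
  formal sums of pairs, for the internal hom it is \<open>Cu[S,T]\<close> with the relation induced by paths.
\<close>

section \<open>Basic properties of Cu-semigroups\<close>

text \<open>The chosen tensor product, the associator and the currying map are given by choice, by
  description and as an inverse, so nothing is known about them until an explicit object or map
  realises them; the standard facts on tensor products and internal homs are therefore established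
  by construction. Three obstacles shape this. The choice in \<open>cu_tensor\<close> guarantees
  universality only for targets on its own type, while evaluation and composition have targets on
  other types; the explicit model is universal for targets of every type, and a comparison with it
  transports this. The relation \<open>hom_prec\<close> need not interpolate, whereas the members of
  a path interpolate each other because the rationals are dense; restricting to interpolating pairs
  thus loses no path. Finally, ideals are generated by sequences while paths are indexed by
  rationals, so a sequence has to be refined to a rational chain, which uses interpolation once for
  each rational inserted.\<close>

lemma has_sup_iff:
  "has_sup S A x \<longleftrightarrow> A \<subseteq> carrier S \<and> x \<in> carrier S \<and> (\<forall>a\<in>A. a \<sqsubseteq>\<^bsub>S\<^esub> x) \<and>
     (\<forall>y\<in>carrier S. (\<forall>a\<in>A. a \<sqsubseteq>\<^bsub>S\<^esub> y) \<longrightarrow> x \<sqsubseteq>\<^bsub>S\<^esub> y)"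
  unfolding has_sup_def least_def Upper_def subset_iff by blast

lemma has_supI:
  assumes "\<And>a. a \<in> A \<Longrightarrow> a \<in> carrier S" "x \<in> carrier S" "\<And>a. a \<in> A \<Longrightarrow> a \<sqsubseteq>\<^bsub>S\<^esub> x"
    and "\<And>y. y \<in> carrier S \<Longrightarrow> (\<And>a. a \<in> A \<Longrightarrow> a \<sqsubseteq>\<^bsub>S\<^esub> y) \<Longrightarrow> x \<sqsubseteq>\<^bsub>S\<^esub> y"
  shows "has_sup S A x"
  using assms unfolding has_sup_iff by blast

lemma has_sup_closed: "has_sup S A x \<Longrightarrow> x \<in> carrier S"
  and has_sup_upper: "has_sup S A x \<Longrightarrow> a \<in> A \<Longrightarrow> a \<sqsubseteq>\<^bsub>S\<^esub> x"
  and has_sup_least: "has_sup S A x \<Longrightarrow> y \<in> carrier S \<Longrightarrow> (\<And>a. a \<in> A \<Longrightarrow> a \<sqsubseteq>\<^bsub>S\<^esub> y) \<Longrightarrow> x \<sqsubseteq>\<^bsub>S\<^esub> y"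
  unfolding has_sup_iff by blast+

lemma inc_seq_closed: "inc_seq S c \<Longrightarrow> c n \<in> carrier S"
  unfolding inc_seq_def by blast

lemma way_below_closed:
  "a \<lless>\<^bsub>S\<^esub> b \<Longrightarrow> a \<in> carrier S" "a \<lless>\<^bsub>S\<^esub> b \<Longrightarrow> b \<in> carrier S"
  unfolding way_below_def by auto

lemma way_belowD:
  "b \<lless>\<^bsub>S\<^esub> x \<Longrightarrow> inc_seq S c \<Longrightarrow> has_sup S (range c) y \<Longrightarrow> x \<sqsubseteq>\<^bsub>S\<^esub> y \<Longrightarrow> \<exists>k. b \<sqsubseteq>\<^bsub>S\<^esub> c k"
  unfolding way_below_def by blast

locale cu_sg =
  fixes S :: "('a, 'm) po_semigroup_scheme" (structure)
  assumes cu: "cu_semigroup S"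
begin

lemma pos: "pos_ordered_semigroup S"
  using cu unfolding cu_semigroup_def by blast

sublocale partial_order S
  using pos unfolding pos_ordered_semigroup_def by blast

lemma weak_po: "weak_partial_order S"
  by unfold_locales

lemma add_comm_monoid: "comm_monoid \<lparr>carrier = carrier S, mult = add S, one = \<zero>\<rparr>"
  using pos unfolding pos_ordered_semigroup_def by blast

lemma add_closed [simp, intro]: "a \<in> carrier S \<Longrightarrow> b \<in> carrier S \<Longrightarrow> a \<oplus> b \<in> carrier S"
  using monoid.m_closed[OF comm_monoid.axioms(1)[OF add_comm_monoid]] by simp

lemma zero_closed [simp, intro]: "\<zero> \<in> carrier S"
  using monoid.one_closed[OF comm_monoid.axioms(1)[OF add_comm_monoid]] by simp

lemma add_assoc:
  "a \<in> carrier S \<Longrightarrow> b \<in> carrier S \<Longrightarrow> c \<in> carrier S \<Longrightarrow> (a \<oplus> b) \<oplus> c = a \<oplus> (b \<oplus> c)"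
  using monoid.m_assoc[OF comm_monoid.axioms(1)[OF add_comm_monoid]] by simp

lemma add_comm: "a \<in> carrier S \<Longrightarrow> b \<in> carrier S \<Longrightarrow> a \<oplus> b = b \<oplus> a"
  using comm_monoid.m_comm[OF add_comm_monoid] by simp

lemma add_lcomm:
  "a \<in> carrier S \<Longrightarrow> b \<in> carrier S \<Longrightarrow> c \<in> carrier S \<Longrightarrow> a \<oplus> (b \<oplus> c) = b \<oplus> (a \<oplus> c)"
  by (metis add_assoc add_comm)

lemma zero_add [simp]: "a \<in> carrier S \<Longrightarrow> \<zero> \<oplus> a = a"
  using monoid.l_one[OF comm_monoid.axioms(1)[OF add_comm_monoid]] by simp

lemma add_zero [simp]: "a \<in> carrier S \<Longrightarrow> a \<oplus> \<zero> = a"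
  using monoid.r_one[OF comm_monoid.axioms(1)[OF add_comm_monoid]] by simp

lemma zero_le [simp, intro]: "a \<in> carrier S \<Longrightarrow> \<zero> \<sqsubseteq> a"
  using pos unfolding pos_ordered_semigroup_def by blast

lemma add_mono_left:
  "a \<sqsubseteq> b \<Longrightarrow> a \<in> carrier S \<Longrightarrow> b \<in> carrier S \<Longrightarrow> c \<in> carrier S \<Longrightarrow> a \<oplus> c \<sqsubseteq> b \<oplus> c"
  using pos unfolding pos_ordered_semigroup_def by blast

lemma add_mono:
  assumes "a \<sqsubseteq> b" "c \<sqsubseteq> d"
    and [simp]: "a \<in> carrier S" "b \<in> carrier S" "c \<in> carrier S" "d \<in> carrier S"
  shows "a \<oplus> c \<sqsubseteq> b \<oplus> d"
proof -
  have "a \<oplus> c \<sqsubseteq> b \<oplus> c" "b \<oplus> c \<sqsubseteq> b \<oplus> d"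
    using add_mono_left[of a b c] add_mono_left[of c d b] assms by (auto simp: add_comm)
  then show ?thesis
    by (rule le_trans) auto
qed

lemma le_zero: "a \<in> carrier S \<Longrightarrow> a \<sqsubseteq> \<zero> \<Longrightarrow> a = \<zero>"
  by (simp add: le_antisym)

lemma has_sup_unique: "has_sup S A x \<Longrightarrow> has_sup S A y \<Longrightarrow> x = y"
  unfolding has_sup_iff by (blast intro: le_antisym)

lemma inc_seqD: "inc_seq S c \<Longrightarrow> m \<le> n \<Longrightarrow> c m \<sqsubseteq> c n"
proof (induction n)
  case 0
  then show ?case by (auto simp: inc_seq_def)
next
  case (Suc n)
  show ?case
  proof (cases "m = Suc n")
    case True
    then show ?thesis using Suc.prems by (auto simp: inc_seq_def)
  next
    case False
    then have "c m \<sqsubseteq> c n" using Suc by simp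
    then show ?thesis
      using Suc.prems(1) le_trans[of "c m" "c n" "c (Suc n)"] unfolding inc_seq_def by blast
  qed
qed

lemma inc_seq_const: "a \<in> carrier S \<Longrightarrow> inc_seq S (\<lambda>_. a)"
  by (simp add: inc_seq_def)

lemma has_sup_const: "a \<in> carrier S \<Longrightarrow> has_sup S (range (\<lambda>_::nat. a)) a"
  by (rule has_supI) auto

lemma sup_exists: "inc_seq S c \<Longrightarrow> \<exists>x. has_sup S (range c) x"
  using cu unfolding cu_semigroup_def by blast

lemma approx_seq:
  assumes "a \<in> carrier S"
  obtains c where "\<forall>n. c n \<lless> c (Suc n)" "has_sup S (range c) a"
  using cu assms unfolding cu_semigroup_def by blast

lemma way_below_add: "a' \<lless> a \<Longrightarrow> b' \<lless> b \<Longrightarrow> a' \<oplus> b' \<lless> a \<oplus> b"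
  using cu unfolding cu_semigroup_def by blast

lemma has_sup_add:
  "inc_seq S c \<Longrightarrow> inc_seq S d \<Longrightarrow> has_sup S (range c) x \<Longrightarrow> has_sup S (range d) y \<Longrightarrow>
    has_sup S (range (\<lambda>n. c n \<oplus> d n)) (x \<oplus> y)"
  using cu unfolding cu_semigroup_def by blast

lemma way_below_imp_le:
  assumes "a \<lless> b" shows "a \<sqsubseteq> b"
  using way_belowD[OF assms inc_seq_const has_sup_const] way_below_closed[OF assms] by simp

lemma way_below_trans_le:
  assumes "a \<sqsubseteq> b" "b \<lless> c" "a \<in> carrier S" shows "a \<lless> c"
  using assms unfolding way_below_def by (meson inc_seq_closed le_trans)

lemma le_trans_way_below:
  assumes "a \<lless> b" "b \<sqsubseteq> c" "c \<in> carrier S" shows "a \<lless> c"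
  using assms unfolding way_below_def by (meson has_sup_closed le_trans)

lemma way_below_trans: "a \<lless> b \<Longrightarrow> b \<lless> c \<Longrightarrow> a \<lless> c"
  by (rule way_below_trans_le[OF way_below_imp_le _ way_below_closed(1)])

lemma way_below_seq_inc:
  assumes "\<forall>n. c n \<lless> c (Suc n)" shows "inc_seq S c"
  unfolding inc_seq_def
  using way_below_imp_le[OF assms[rule_format]] way_below_closed(1)[OF assms[rule_format]] by simp

lemma zero_way_below [intro]: "a \<in> carrier S \<Longrightarrow> \<zero> \<lless> a"
  unfolding way_below_def using inc_seq_closed[of S] by blast

lemma way_below_approx:
  assumes "a' \<lless> a" "\<forall>n. c n \<lless> c (Suc n)" "has_sup S (range c) a"
  shows "\<exists>k. a' \<lless> c k"
proof -
  obtain k where "a' \<sqsubseteq> c k"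
    using way_belowD[OF assms(1) way_below_seq_inc[OF assms(2)] assms(3)] way_below_closed[OF assms(1)]
    by auto
  \<comment> \<open>One further term of the sequence upgrades \<open>\<sqsubseteq>\<close> to
    \<open>\<lless>\<close>.\<close>
  then have "a' \<lless> c (Suc k)"
    by (rule way_below_trans_le[OF _ assms(2)[rule_format] way_below_closed(1)[OF assms(1)]])
  then show ?thesis ..
qed

lemma approx_way_below:
  assumes "\<forall>n. c n \<lless> c (Suc n)" "has_sup S (range c) a"
  shows "c n \<lless> a"
  by (rule le_trans_way_below[OF assms(1)[rule_format] has_sup_upper[OF assms(2)] has_sup_closed[OF assms(2)]]) simp

lemma way_below_interp:
  assumes "a \<lless> b" obtains c where "a \<lless> c" "c \<lless> b"
proof -
  obtain c where c: "\<forall>n. c n \<lless> c (Suc n)" "has_sup S (range c) b"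
    using approx_seq[OF way_below_closed(2)[OF assms]] by blast
  then show thesis
    using that[OF _ approx_way_below[OF c]] way_below_approx[OF assms c] by blast
qed

text \<open>Both elements lie way below terms of one approximating sequence, hence below a common
  term. This later brings two pure tensors to a common factor so that they can be added.\<close>

lemma way_below_directed:
  assumes "a \<lless> x" "b \<lless> x" obtains c where "a \<lless> c" "b \<lless> c" "c \<lless> x"
proof -
  obtain c where c: "\<forall>n. c n \<lless> c (Suc n)" "has_sup S (range c) x"
    using approx_seq[OF way_below_closed(2)[OF assms(1)]] by blast
  obtain i j where "a \<lless> c i" "b \<lless> c j"
    using way_below_approx[OF _ c] assms by blast
  then have "a \<lless> c (max i j)" "b \<lless> c (max i j)"
    by (auto elim!: le_trans_way_below intro!: inc_seqD[OF way_below_seq_inc[OF c(1)]]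
        way_below_closed(1)[OF c(1)[rule_format]])
  then show thesis using that[OF _ _ approx_way_below[OF c]] by blast
qed

text \<open>Here \<open>c\<close> is only increasing, so its terms provide no gap; the gap comes
  from interpolating between \<open>b\<close> and \<open>x\<close> before the definition is
  applied.\<close>

lemma way_below_sup_strong:
  assumes "b \<lless> x" "inc_seq S c" "has_sup S (range c) x"
  shows "\<exists>k. b \<lless> c k"
proof -
  obtain d where "b \<lless> d" "d \<lless> x" using way_below_interp[OF assms(1)] .
  then obtain k where "d \<sqsubseteq> c k"
    using way_belowD[OF _ assms(2,3)] has_sup_closed[OF assms(3)] by blast
  then show ?thesis
    using le_trans_way_below[OF \<open>b \<lless> d\<close> _ inc_seq_closed[OF assms(2)]] by blast
qed

text \<open>By (O4) the termwise sums of approximating sequences of \<open>b\<close> and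
  \<open>c\<close> converge to \<open>b \<oplus> c\<close>, so \<open>a\<close> falls way below one
  of these sums. All additivity statements for ideals in a curried or tensored variable rest on
  this.\<close>

lemma way_below_add_split:
  assumes "a \<lless> b \<oplus> c" "b \<in> carrier S" "c \<in> carrier S"
  obtains b' c' where "b' \<lless> b" "c' \<lless> c" "a \<lless> b' \<oplus> c'"
proof -
  obtain e where e: "\<forall>n. e n \<lless> e (Suc n)" "has_sup S (range e) b"
    using approx_seq[OF assms(2)] by blast
  obtain f where f: "\<forall>n. f n \<lless> f (Suc n)" "has_sup S (range f) c"
    using approx_seq[OF assms(3)] by blast
  have "has_sup S (range (\<lambda>n. e n \<oplus> f n)) (b \<oplus> c)"
    by (intro has_sup_add way_below_seq_inc e f)
  moreover have "inc_seq S (\<lambda>n. e n \<oplus> f n)"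
    by (intro way_below_seq_inc allI way_below_add e(1)[rule_format] f(1)[rule_format])
  ultimately show thesis
    using that[OF approx_way_below[OF e] approx_way_below[OF f]] way_below_sup_strong[OF assms(1)] by blast
qed

end

subsection \<open>Transfer along isomorphisms\<close>

text \<open>Transport of structure: \<open>A\<close> is a record whose order and operations match
  those of a Cu-semigroup \<open>B\<close> along a bijection. It serves for path classes against
  ideals, since (O1) to (O4) are visible only on the side of the ideals.\<close>

locale cu_iso =
  fixes A :: "('a, 'm) po_semigroup_scheme" and B :: "('b, 'n) po_semigroup_scheme" and h :: "'a \<Rightarrow> 'b"
  assumes cuB: "cu_semigroup B"
    and bij: "bij_betw h (carrier A) (carrier B)"
    and le_iff: "x \<in> carrier A \<Longrightarrow> y \<in> carrier A \<Longrightarrow> x \<sqsubseteq>\<^bsub>A\<^esub> y \<longleftrightarrow> h x \<sqsubseteq>\<^bsub>B\<^esub> h y"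
    and A_add_closed: "x \<in> carrier A \<Longrightarrow> y \<in> carrier A \<Longrightarrow> x \<oplus>\<^bsub>A\<^esub> y \<in> carrier A"
    and h_add: "x \<in> carrier A \<Longrightarrow> y \<in> carrier A \<Longrightarrow> h (x \<oplus>\<^bsub>A\<^esub> y) = h x \<oplus>\<^bsub>B\<^esub> h y"
    and A_zero_closed: "\<zero>\<^bsub>A\<^esub> \<in> carrier A"
    and h_zero: "h \<zero>\<^bsub>A\<^esub> = \<zero>\<^bsub>B\<^esub>"
    and eqA: "eq A = (=)"
begin

sublocale B: cu_sg B using cuB by unfold_locales

lemma h_closed: "x \<in> carrier A \<Longrightarrow> h x \<in> carrier B"
  using bij by (auto simp: bij_betw_def)

lemma h_surj: "y \<in> carrier B \<Longrightarrow> \<exists>x\<in>carrier A. h x = y"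
  by (metis bij bij_betw_imp_surj_on imageE)

lemma h_inj: "h x = h y \<Longrightarrow> x \<in> carrier A \<Longrightarrow> y \<in> carrier A \<Longrightarrow> x = y"
  using bij by (auto simp: bij_betw_def inj_on_def)

lemma has_sup_h:
  assumes "X \<subseteq> carrier A" "x \<in> carrier A"
  shows "has_sup A X x \<longleftrightarrow> has_sup B (h ` X) (h x)"
proof
  assume l: "has_sup A X x"
  show "has_sup B (h ` X) (h x)"
  proof (rule has_supI)
    fix y assume y: "y \<in> carrier B" "\<And>b. b \<in> h ` X \<Longrightarrow> b \<sqsubseteq>\<^bsub>B\<^esub> y"
    obtain y0 where y0: "y0 \<in> carrier A" "h y0 = y" using h_surj y(1) by blast
    have "x \<sqsubseteq>\<^bsub>A\<^esub> y0"
      using has_sup_least[OF l y0(1)] y(2) y0 le_iff assms by blast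
    then show "h x \<sqsubseteq>\<^bsub>B\<^esub> y" using le_iff assms y0 by blast
  qed (use assms h_closed has_sup_upper[OF l] le_iff in blast)+
next
  assume r: "has_sup B (h ` X) (h x)"
  show "has_sup A X x"
  proof (rule has_supI)
    fix y assume y: "y \<in> carrier A" "\<And>b. b \<in> X \<Longrightarrow> b \<sqsubseteq>\<^bsub>A\<^esub> y"
    have "h x \<sqsubseteq>\<^bsub>B\<^esub> h y"
      by (rule has_sup_least[OF r]) (use y h_closed le_iff assms in blast)+
    then show "x \<sqsubseteq>\<^bsub>A\<^esub> y" using le_iff assms y by blast
  qed (use assms h_closed has_sup_upper[OF r] le_iff in blast)+
qed

lemma inc_seq_h: "(\<And>n. c n \<in> carrier A) \<Longrightarrow> inc_seq A c \<longleftrightarrow> inc_seq B (\<lambda>n. h (c n))"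
  unfolding inc_seq_def using le_iff h_closed by blast

lemma inc_seq_lift:
  assumes "inc_seq B d" obtains c where "inc_seq A c" "\<And>n. h (c n) = d n"
proof -
  have "\<forall>n. \<exists>x. x \<in> carrier A \<and> h x = d n"
    using h_surj inc_seq_closed[OF assms] by blast
  then obtain c where c: "\<And>n. c n \<in> carrier A" "\<And>n. h (c n) = d n" by metis
  then have "inc_seq A c" using inc_seq_h assms by simp
  then show thesis using c that by blast
qed

lemma range_h: "h ` range c = range (\<lambda>n. h (c n))" by auto

lemma has_sup_seq_h:
  assumes "\<And>n. c n \<in> carrier A" "x \<in> carrier A"
  shows "has_sup A (range c) x \<longleftrightarrow> has_sup B (range (\<lambda>n. h (c n))) (h x)"
  using has_sup_h[of "range c" x] assms by (auto simp: range_h)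

lemma way_below_h:
  assumes xy: "x \<in> carrier A" "y \<in> carrier A"
  shows "x \<lless>\<^bsub>A\<^esub> y \<longleftrightarrow> h x \<lless>\<^bsub>B\<^esub> h y"
proof
  assume l: "x \<lless>\<^bsub>A\<^esub> y"
  show "h x \<lless>\<^bsub>B\<^esub> h y"
    unfolding way_below_def
  proof (intro conjI allI impI)
    fix d z assume d: "inc_seq B d \<and> has_sup B (range d) z \<and> h y \<sqsubseteq>\<^bsub>B\<^esub> z"
    obtain c where c: "inc_seq A c" "\<And>n. h (c n) = d n"
      using inc_seq_lift[OF conjunct1[OF d]] by metis
    have "z \<in> carrier B" using has_sup_closed[OF d[THEN conjunct2, THEN conjunct1]] .
    then obtain w where w: "w \<in> carrier A" "h w = z" using h_surj by blast
    have "has_sup A (range c) w"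
      using has_sup_seq_h[where c = c, OF inc_seq_closed[OF c(1)] w(1)] c w d by simp
    moreover have "y \<sqsubseteq>\<^bsub>A\<^esub> w" using le_iff xy w d by simp
    ultimately obtain k where "x \<sqsubseteq>\<^bsub>A\<^esub> c k" using way_belowD[OF l c(1)] by blast
    then have "h x \<sqsubseteq>\<^bsub>B\<^esub> d k" using le_iff xy inc_seq_closed[OF c(1)] c(2) by metis
    then show "\<exists>k. h x \<sqsubseteq>\<^bsub>B\<^esub> d k" ..
  qed (use xy h_closed in auto)
next
  assume r: "h x \<lless>\<^bsub>B\<^esub> h y"
  show "x \<lless>\<^bsub>A\<^esub> y"
    unfolding way_below_def
  proof (intro conjI allI impI xy)
    fix c z assume c: "inc_seq A c \<and> has_sup A (range c) z \<and> y \<sqsubseteq>\<^bsub>A\<^esub> z"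
    have cc: "\<And>n. c n \<in> carrier A" and z: "z \<in> carrier A"
      using c by (auto intro: inc_seq_closed has_sup_closed)
    have "inc_seq B (\<lambda>n. h (c n))" "has_sup B (range (\<lambda>n. h (c n))) (h z)" "h y \<sqsubseteq>\<^bsub>B\<^esub> h z"
      using c inc_seq_h[where c = c, OF cc] has_sup_seq_h[where c = c, OF cc z] le_iff xy z by simp_all
    then obtain k where "h x \<sqsubseteq>\<^bsub>B\<^esub> h (c k)" using way_belowD[OF r] by blast
    then show "\<exists>k. x \<sqsubseteq>\<^bsub>A\<^esub> c k" using le_iff xy cc by blast
  qed
qed

lemma cu_semigroup_A: "cu_semigroup A"
  unfolding cu_semigroup_def
proof (intro conjI allI impI ballI)
  show "pos_ordered_semigroup A"
    unfolding pos_ordered_semigroup_def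
  proof (intro conjI allI impI ballI)
    show "partial_order A"
    proof
      show "eq A = (=)" by (rule eqA)
      show "x \<sqsubseteq>\<^bsub>A\<^esub> x" if "x \<in> carrier A" for x
        using that le_iff h_closed by simp
      show "x .=\<^bsub>A\<^esub> y" if "x \<sqsubseteq>\<^bsub>A\<^esub> y" "y \<sqsubseteq>\<^bsub>A\<^esub> x" "x \<in> carrier A" "y \<in> carrier A" for x y
        using that le_iff h_closed h_inj B.le_antisym eqA by simp
      show "x \<sqsubseteq>\<^bsub>A\<^esub> z" if "x \<sqsubseteq>\<^bsub>A\<^esub> y" "y \<sqsubseteq>\<^bsub>A\<^esub> z" "x \<in> carrier A" "y \<in> carrier A" "z \<in> carrier A" for x y z
        using that le_iff h_closed B.le_trans by meson
    qed (auto simp: eqA)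
    show "comm_monoid \<lparr>carrier = carrier A, mult = add A, one = \<zero>\<^bsub>A\<^esub>\<rparr>"
      by (rule comm_monoidI;
          simp add: A_add_closed A_zero_closed)
         (rule h_inj; simp add: A_add_closed A_zero_closed h_add h_zero h_closed B.add_assoc B.add_comm B.add_lcomm)+
  next
    fix a b c assume "a \<in> carrier A" "b \<in> carrier A" "c \<in> carrier A" "a \<sqsubseteq>\<^bsub>A\<^esub> b"
    then show "a \<oplus>\<^bsub>A\<^esub> c \<sqsubseteq>\<^bsub>A\<^esub> b \<oplus>\<^bsub>A\<^esub> c"
      using le_iff A_add_closed h_add h_closed B.add_mono_left by simp
  next
    fix a assume "a \<in> carrier A"
    then show "\<zero>\<^bsub>A\<^esub> \<sqsubseteq>\<^bsub>A\<^esub> a"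
      using le_iff A_zero_closed h_zero h_closed by simp
  qed
next
  fix c assume c: "inc_seq A c"
  have cc: "\<And>n. c n \<in> carrier A" using c inc_seq_closed by blast
  obtain y where y: "has_sup B (range (\<lambda>n. h (c n))) y"
    using B.sup_exists c by (auto simp: inc_seq_h[where c = c, OF cc])
  obtain x where "x \<in> carrier A" "h x = y"
    using h_surj[OF has_sup_closed[OF y]] by blast
  then have "has_sup A (range c) x"
    using has_sup_seq_h[where c = c, OF cc] y by simp
  then show "\<exists>x. has_sup A (range c) x" ..
next
  fix a assume a: "a \<in> carrier A"
  obtain d where d: "\<forall>n. d n \<lless>\<^bsub>B\<^esub> d (Suc n)" "has_sup B (range d) (h a)"
    using B.approx_seq[OF h_closed[OF a]] by blast
  obtain c where c: "inc_seq A c" "\<And>n. h (c n) = d n"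
    using inc_seq_lift[OF B.way_below_seq_inc[OF d(1)]] by blast
  have "\<forall>n. c n \<lless>\<^bsub>A\<^esub> c (Suc n)" "has_sup A (range c) a"
    using way_below_h[OF inc_seq_closed[OF c(1)] inc_seq_closed[OF c(1)]]
      has_sup_seq_h[where c = c, OF inc_seq_closed[OF c(1)] a] d c(2) by simp_all
  then show "\<exists>c. (\<forall>n. c n \<lless>\<^bsub>A\<^esub> c (Suc n)) \<and> has_sup A (range c) a" by blast
next
  fix a' a b' b assume "a' \<lless>\<^bsub>A\<^esub> a \<and> b' \<lless>\<^bsub>A\<^esub> b"
  then have wb: "a' \<lless>\<^bsub>A\<^esub> a" "b' \<lless>\<^bsub>A\<^esub> b" by auto
  note cl = wb[THEN way_below_closed(1)] wb[THEN way_below_closed(2)]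
  show "a' \<oplus>\<^bsub>A\<^esub> b' \<lless>\<^bsub>A\<^esub> a \<oplus>\<^bsub>A\<^esub> b"
    using wb B.way_below_add by (simp add: way_below_h cl A_add_closed h_add)
next
  fix c d x y
  assume "inc_seq A c \<and> inc_seq A d \<and> has_sup A (range c) x \<and> has_sup A (range d) y"
  then have *: "inc_seq A c" "inc_seq A d" "has_sup A (range c) x" "has_sup A (range d) y" by auto
  note cl = inc_seq_closed[OF *(1)] inc_seq_closed[OF *(2)] has_sup_closed[OF *(3)] has_sup_closed[OF *(4)]
  have "has_sup B (range (\<lambda>n. h (c n) \<oplus>\<^bsub>B\<^esub> h (d n))) (h x \<oplus>\<^bsub>B\<^esub> h y)"
    using * by (intro B.has_sup_add) (simp_all add: inc_seq_h has_sup_seq_h cl)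
  then show "has_sup A (range (\<lambda>n. c n \<oplus>\<^bsub>A\<^esub> d n)) (x \<oplus>\<^bsub>A\<^esub> y)"
    by (simp add: has_sup_seq_h A_add_closed h_add cl)
qed

end

section \<open>Completion of a monoid with a dense additive relation\<close>

text \<open>An abstract basis in the sense of domain theory, equipped with an addition.
  \<open>R\<close> models way-below between generators. Interpolation is asked only between two
  related points, so \<open>{m. R m a}\<close> is not assumed to be directed.\<close>

locale round_monoid =
  fixes M :: "'m set" and ad :: "'m \<Rightarrow> 'm \<Rightarrow> 'm" and ze :: 'm and R :: "'m \<Rightarrow> 'm \<Rightarrow> bool"
  assumes R_closed: "R a b \<Longrightarrow> a \<in> M \<and> b \<in> M"
    and ad_closed [simp]: "a \<in> M \<Longrightarrow> b \<in> M \<Longrightarrow> ad a b \<in> M"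
    and ze_closed [simp]: "ze \<in> M"
    and ad_assoc: "a \<in> M \<Longrightarrow> b \<in> M \<Longrightarrow> c \<in> M \<Longrightarrow> ad (ad a b) c = ad a (ad b c)"
    and ad_comm: "a \<in> M \<Longrightarrow> b \<in> M \<Longrightarrow> ad a b = ad b a"
    and ad_ze: "a \<in> M \<Longrightarrow> ad a ze = a"
    and R_trans: "R a b \<Longrightarrow> R b c \<Longrightarrow> R a c"
    and R_dense: "R a c \<Longrightarrow> \<exists>b. R a b \<and> R b c"
    and R_ad: "R a' a \<Longrightarrow> R b' b \<Longrightarrow> R (ad a' b') (ad a b)"
    and R_ze: "a \<in> M \<Longrightarrow> R ze a"
begin

section \<open>Round ideals of an abstract basis\<close>

definition genseq :: "(nat \<Rightarrow> 'm) \<Rightarrow> 'm set" where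
  "genseq c = {m. \<exists>k. R m (c k)}"

text \<open>Generation by a sequence encodes at once that the ideal is downward closed, directed,
  round and countably generated; the last matches the fact that Cu-semigroups only have suprema of
  sequences.\<close>

definition round_ideal :: "'m set \<Rightarrow> bool" where
  "round_ideal I \<longleftrightarrow> (\<exists>c. (\<forall>k. R (c k) (c (Suc k))) \<and> I = genseq c)"

definition ideal_add :: "'m set \<Rightarrow> 'm set \<Rightarrow> 'm set" where
  "ideal_add I J = {m. \<exists>i\<in>I. \<exists>j\<in>J. R m (ad i j)}"

text \<open>The zero is the ideal generated by the constant sequence \<open>ze\<close>, which is a
  legal generating sequence because \<open>R ze ze\<close>.\<close>

definition completion :: "'m set po_semigroup" where
  "completion = \<lparr>carrier = Collect round_ideal, eq = (=), le = (\<subseteq>),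
     add = ideal_add, zero = {m. R m ze}\<rparr>"

lemma completion_simps [simp]:
  "carrier completion = Collect round_ideal" "eq completion = (=)" "le completion = (\<subseteq>)"
  "add completion = ideal_add" "\<zero>\<^bsub>completion\<^esub> = {m. R m ze}"
  by (simp_all add: completion_def)

lemma R_M1: "R a b \<Longrightarrow> a \<in> M" and R_M2: "R a b \<Longrightarrow> b \<in> M"
  using R_closed by blast+

lemma R_chain: "\<forall>k. R (c k) (c (Suc k)) \<Longrightarrow> i < j \<Longrightarrow> R (c i) (c j)"
  by (induction j) (auto simp: less_Suc_eq intro: R_trans)

lemma round_ideal_genseq: "\<forall>k. R (c k) (c (Suc k)) \<Longrightarrow> round_ideal (genseq c)"
  unfolding round_ideal_def by blast

lemma genseq_mem: "\<forall>k. R (c k) (c (Suc k)) \<Longrightarrow> c k \<in> genseq c"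
  unfolding genseq_def by blast

lemma round_idealE:
  assumes "round_ideal I"
  obtains c where "\<forall>k. R (c k) (c (Suc k))" "I = genseq c"
  using assms unfolding round_ideal_def by blast

lemma round_ideal_down: "round_ideal I \<Longrightarrow> b \<in> I \<Longrightarrow> R a b \<Longrightarrow> a \<in> I"
  unfolding round_ideal_def genseq_def by (auto intro: R_trans)

lemma round_ideal_M: "round_ideal I \<Longrightarrow> a \<in> I \<Longrightarrow> a \<in> M"
  unfolding round_ideal_def genseq_def by (auto dest: R_M1)

lemma round_ideal_directed:
  assumes "round_ideal I" "a \<in> I" "b \<in> I"
  shows "\<exists>d\<in>I. R a d \<and> R b d"
proof -
  obtain c where c: "\<forall>k. R (c k) (c (Suc k))" "I = genseq c" using assms(1) by (rule round_idealE)
  obtain i j where "R a (c i)" "R b (c j)" using assms c unfolding genseq_def by blast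
  then have "R a (c (Suc (max i j)))" "R b (c (Suc (max i j)))"
    using R_chain[OF c(1), of i "Suc (max i j)"] R_chain[OF c(1), of j "Suc (max i j)"]
    by (auto intro: R_trans)
  then show ?thesis using genseq_mem[OF c(1)] c(2) by blast
qed

lemma round_ideal_round: "round_ideal I \<Longrightarrow> a \<in> I \<Longrightarrow> \<exists>d\<in>I. R a d"
  using round_ideal_directed by blast

lemma round_ideal_ze: "round_ideal I \<Longrightarrow> ze \<in> I"
  using round_idealE genseq_mem round_ideal_down R_ze round_ideal_M by metis

text \<open>A generating sequence is built by dependent choice: each new term lies in
  \<open>I\<close> above both the previous term and \<open>e n\<close>. The cofinal family
  \<open>e\<close> itself may be in any order.\<close>

lemma round_idealI:
  assumes dir: "\<And>a b. a \<in> I \<Longrightarrow> b \<in> I \<Longrightarrow> \<exists>d\<in>I. R a d \<and> R b d"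
    and down: "\<And>a b. b \<in> I \<Longrightarrow> R a b \<Longrightarrow> a \<in> I"
    and cof: "\<And>k. e k \<in> I" "\<And>m. m \<in> I \<Longrightarrow> \<exists>k::nat. R m (e k)"
  shows "round_ideal I"
proof -
  have "\<exists>c. \<forall>n. (c n \<in> I) \<and> (R (c n) (c (Suc n)) \<and> R (e n) (c (Suc n)))"
    by (rule dependent_nat_choice[where P = "\<lambda>_ x. x \<in> I" and Q = "\<lambda>n x y. R x y \<and> R (e n) y"])
      (use dir cof(1) in blast)+
  then obtain c where c: "\<And>n. c n \<in> I" "\<And>n. R (c n) (c (Suc n))" "\<And>n. R (e n) (c (Suc n))" by blast
  have "I = genseq c"
    unfolding genseq_def using c(3) down[OF c(1)] cof(2) R_trans by blast
  then show ?thesis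
    unfolding round_ideal_def using c by blast
qed

text \<open>The generators of all the ideals are enumerated through the pairing of naturals. The
  enumeration is not increasing, which is why \<open>round_idealI\<close> accepts an arbitrary
  countable cofinal family.\<close>

lemma round_ideal_Union:
  assumes I: "\<And>n::nat. round_ideal (I n)" and inc: "\<And>n. I n \<subseteq> I (Suc n)"
  shows "round_ideal (\<Union>n. I n)"
proof -
  have mono: "I i \<subseteq> I j" if "i \<le> j" for i j using lift_Suc_mono_le[of I, OF inc that] .
  have "\<forall>n. \<exists>c. (\<forall>k. R (c k) (c (Suc k))) \<and> I n = genseq c"
    using I unfolding round_ideal_def by blast
  then obtain c where c: "\<And>n. \<forall>k. R (c n k) (c n (Suc k))" "\<And>n. I n = genseq (c n)" by metis
  show ?thesis
  proof (rule round_idealI[where e = "\<lambda>p. c (fst (prod_decode p)) (snd (prod_decode p))"])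
    fix a b assume "a \<in> (\<Union>n. I n)" "b \<in> (\<Union>n. I n)"
    then obtain i j where "a \<in> I i" "b \<in> I j" by blast
    then have "a \<in> I (max i j)" "b \<in> I (max i j)" using mono[of i "max i j"] mono[of j "max i j"] by auto
    then show "\<exists>d\<in>\<Union>n. I n. R a d \<and> R b d" using round_ideal_directed[OF I] by blast
  next
    fix a b assume "b \<in> (\<Union>n. I n)" "R a b"
    then show "a \<in> (\<Union>n. I n)" using round_ideal_down[OF I] by blast
  next
    show "c (fst (prod_decode p)) (snd (prod_decode p)) \<in> (\<Union>n. I n)" for p
      using genseq_mem[OF c(1)] c(2) by blast
  next
    fix m assume "m \<in> (\<Union>n. I n)"
    then obtain n k where "R m (c n k)" using c(2) unfolding genseq_def by blast
    then show "\<exists>p. R m (c (fst (prod_decode p)) (snd (prod_decode p)))"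
      by (intro exI[of _ "prod_encode (n, k)"]) simp
  qed
qed

section \<open>Suprema and way-below in the completion\<close>

lemma has_sup_completion_iff:
  assumes I: "\<And>n::nat. round_ideal (I n)" and inc: "\<And>n. I n \<subseteq> I (Suc n)"
  shows "has_sup completion (range I) J \<longleftrightarrow> J = (\<Union>n. I n)"
proof -
  have *: "has_sup completion (range I) (\<Union>n. I n)"
    by (simp add: has_sup_iff round_ideal_Union[of I, OF I inc]) (use I in blast)
  show ?thesis
  proof
    assume "has_sup completion (range I) J"
    then have "J \<subseteq> (\<Union>n. I n)" "(\<Union>n. I n) \<subseteq> J"
      using * unfolding has_sup_iff by auto
    then show "J = (\<Union>n. I n)" by blast
  qed (use * in simp)
qed

lemma inc_seq_completion: "inc_seq completion I \<longleftrightarrow> (\<forall>n. round_ideal (I n) \<and> I n \<subseteq> I (Suc n))"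
  by (simp add: inc_seq_def)

text \<open>Repeated interpolation towards \<open>b\<close>, starting at \<open>a\<close>, gives an
  increasing chain that stays below \<open>b\<close>; the ideal it generates is the one sought. It
  stands in for \<open>{m. R m b}\<close>, which need not be a round ideal.\<close>

lemma round_ideal_between:
  assumes "R a b" shows "\<exists>I. round_ideal I \<and> a \<in> I \<and> (\<forall>m\<in>I. R m b)"
proof -
  have "\<exists>d. \<forall>n. (R a (d n) \<and> R (d n) b) \<and> R (d n) (d (Suc n))"
    using R_dense[OF assms] R_dense R_trans
    by (intro dependent_nat_choice[where P = "\<lambda>_ x. R a x \<and> R x b" and Q = "\<lambda>_. R"]) blast+
  then obtain d where d: "\<And>n. R a (d n)" "\<And>n. R (d n) b" "\<forall>n. R (d n) (d (Suc n))" by blast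
  have "a \<in> genseq d" "\<forall>m\<in>genseq d. R m b"
    using d R_trans unfolding genseq_def by blast+
  then show ?thesis using round_ideal_genseq[OF d(3)] by blast
qed

text \<open>An ideal is inserted between any two consecutive generators of \<open>J\<close>. The
  generators that separate these ideals witness that the sequence is way-below increasing, which
  gives (O2).\<close>

lemma round_ideal_approx:
  assumes "round_ideal J"
  obtains I c where "\<And>n. round_ideal (I n)" "\<And>n. c n \<in> I n" "\<And>n m. m \<in> I n \<Longrightarrow> R m (c (Suc n))"
    "\<And>n. I n \<subseteq> I (Suc n)" "J = (\<Union>n. I n)"
proof -
  obtain c where c: "\<forall>k. R (c k) (c (Suc k))" "J = genseq c" using assms by (rule round_idealE)
  have "\<forall>n. \<exists>I. round_ideal I \<and> c n \<in> I \<and> (\<forall>m\<in>I. R m (c (Suc n)))"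
    using round_ideal_between c(1) by simp
  then obtain I where I: "\<And>n. round_ideal (I n)" "\<And>n. c n \<in> I n"
    "\<And>n m. m \<in> I n \<Longrightarrow> R m (c (Suc n))" by metis
  have "I n \<subseteq> I (Suc n)" for n
    using I(3) round_ideal_down[OF I(1) I(2)] by blast
  moreover have "J = (\<Union>n. I n)"
    unfolding c(2) genseq_def using I(3) round_ideal_down[OF I(1) I(2)] by blast
  ultimately show thesis using that I by blast
qed

text \<open>Left to right, \<open>I\<close> falls into a member of the sequence of
  \<open>round_ideal_approx\<close>, and the next separating generator is the bound. Right to left,
  suprema are unions, so the bound \<open>c\<close> already lies in one \<open>K k\<close>, and then
  so does everything \<open>R\<close>-below it.\<close>

lemma way_below_completion:
  "I \<lless>\<^bsub>completion\<^esub> J \<longleftrightarrow> round_ideal I \<and> round_ideal J \<and> (\<exists>c\<in>J. \<forall>m\<in>I. R m c)"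
proof
  assume l: "I \<lless>\<^bsub>completion\<^esub> J"
  have IJ: "round_ideal I" "round_ideal J" using way_below_closed[OF l] by auto
  obtain K c where K: "\<And>n. round_ideal (K n)" "\<And>n. c n \<in> K n" "\<And>n m. m \<in> K n \<Longrightarrow> R m (c (Suc n))"
    "\<And>n. K n \<subseteq> K (Suc n)" "J = (\<Union>n. K n)"
    using round_ideal_approx[OF IJ(2)] by metis
  have "inc_seq completion K" "has_sup completion (range K) J"
    using K by (simp_all add: inc_seq_completion has_sup_completion_iff)
  then obtain k where "I \<subseteq> K k" using way_belowD[OF l, of K J] by auto
  then have "\<forall>m\<in>I. R m (c (Suc k))" "c (Suc k) \<in> J" using K by blast+
  then show "round_ideal I \<and> round_ideal J \<and> (\<exists>c\<in>J. \<forall>m\<in>I. R m c)" using IJ by blast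
next
  assume r: "round_ideal I \<and> round_ideal J \<and> (\<exists>c\<in>J. \<forall>m\<in>I. R m c)"
  then obtain c where c: "c \<in> J" "\<And>m. m \<in> I \<Longrightarrow> R m c" by blast
  show "I \<lless>\<^bsub>completion\<^esub> J"
    unfolding way_below_def
  proof (intro conjI allI impI)
    fix K L assume K: "inc_seq completion K \<and> has_sup completion (range K) L \<and> J \<sqsubseteq>\<^bsub>completion\<^esub> L"
    then have *: "\<And>n. round_ideal (K n)" "\<And>n. K n \<subseteq> K (Suc n)" by (auto simp: inc_seq_completion)
    then have "J \<subseteq> (\<Union>n. K n)" using K has_sup_completion_iff[of K, OF *] by auto
    then obtain k where "c \<in> K k" using c by blast
    then have "I \<subseteq> K k" using c(2) round_ideal_down[OF *(1)] by blast
    then show "\<exists>k. I \<sqsubseteq>\<^bsub>completion\<^esub> K k" by auto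
  qed (use r in auto)
qed

text \<open>Reduces sums of ideals to termwise sums of generators, so that the monoid laws for
  ideals, closure under addition and (O4) arguments can be read off in \<open>M\<close>.\<close>

lemma round_ideal_add_seq:
  assumes c: "\<forall>k. R (c k) (c (Suc k))" and d: "\<forall>k. R (d k) (d (Suc k))"
  shows "ideal_add (genseq c) (genseq d) = genseq (\<lambda>k. ad (c k) (d k))"
proof (intro Set.set_eqI iffI)
  fix m assume "m \<in> ideal_add (genseq c) (genseq d)"
  then obtain i j k l where *: "R i (c k)" "R j (d l)" "R m (ad i j)"
    unfolding ideal_add_def genseq_def by blast
  \<comment> \<open>\<open>R\<close> need not be reflexive and \<open>R_chain\<close> compares only
    distinct indices, hence the successor.\<close>
  have "R i (c (Suc (max k l)))" "R j (d (Suc (max k l)))"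
    using R_chain[OF c, of k "Suc (max k l)"] R_chain[OF d, of l "Suc (max k l)"] *
    by (auto intro: R_trans)
  then have "R m (ad (c (Suc (max k l))) (d (Suc (max k l))))"
    using R_ad R_trans *(3) by blast
  then show "m \<in> genseq (\<lambda>k. ad (c k) (d k))" unfolding genseq_def by blast
qed (use genseq_mem[OF c] genseq_mem[OF d] in \<open>auto simp: ideal_add_def genseq_def[of "\<lambda>k. ad (c k) (d k)"]\<close>)

lemma round_ideal_add:
  assumes "round_ideal I" "round_ideal J" shows "round_ideal (ideal_add I J)"
proof -
  obtain c where c: "\<forall>k. R (c k) (c (Suc k))" "I = genseq c" using assms(1) by (rule round_idealE)
  obtain d where d: "\<forall>k. R (d k) (d (Suc k))" "J = genseq d" using assms(2) by (rule round_idealE)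
  show ?thesis
    unfolding c(2) d(2) round_ideal_add_seq[OF c(1) d(1)] using c d
    by (intro round_ideal_genseq) (simp add: R_ad)
qed

lemma ad_mem_ideal_add:
  assumes "round_ideal I" "round_ideal J" "i \<in> I" "j \<in> J" shows "ad i j \<in> ideal_add I J"
  using round_ideal_round[OF assms(1,3)] round_ideal_round[OF assms(2,4)] R_ad
  unfolding ideal_add_def by blast

lemma ideal_add_comm: "round_ideal I \<Longrightarrow> round_ideal J \<Longrightarrow> ideal_add I J = ideal_add J I"
  unfolding ideal_add_def using ad_comm round_ideal_M by (metis (no_types, opaque_lifting))

lemma ideal_add_assoc:
  assumes "round_ideal I" "round_ideal J" "round_ideal K"
  shows "ideal_add (ideal_add I J) K = ideal_add I (ideal_add J K)"
proof -
  obtain c where c: "\<forall>k. R (c k) (c (Suc k))" "I = genseq c" using assms(1) by (rule round_idealE)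
  obtain d where d: "\<forall>k. R (d k) (d (Suc k))" "J = genseq d" using assms(2) by (rule round_idealE)
  obtain e where e: "\<forall>k. R (e k) (e (Suc k))" "K = genseq e" using assms(3) by (rule round_idealE)
  have "\<forall>k. R (ad (c k) (d k)) (ad (c (Suc k)) (d (Suc k)))"
       "\<forall>k. R (ad (d k) (e k)) (ad (d (Suc k)) (e (Suc k)))"
    using c d e by (auto intro: R_ad)
  then show ?thesis
    using c d e by (simp add: round_ideal_add_seq ad_assoc R_M1[OF c(1)[rule_format]]
        R_M1[OF d(1)[rule_format]] R_M1[OF e(1)[rule_format]])
qed

lemma zero_ideal: "{m. R m ze} = genseq (\<lambda>_. ze)"
  by (simp add: genseq_def)

lemma ideal_add_zero: "round_ideal I \<Longrightarrow> ideal_add I {m. R m ze} = I"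
proof -
  assume "round_ideal I"
  then obtain c where c: "\<forall>k. R (c k) (c (Suc k))" "I = genseq c" by (rule round_idealE)
  show ?thesis
    using round_ideal_add_seq[OF c(1), of "\<lambda>_. ze"] R_M1[OF c(1)[rule_format]]
    by (simp add: zero_ideal c(2) R_ze ad_ze)
qed

lemma ideal_add_mono: "I \<subseteq> I' \<Longrightarrow> J \<subseteq> J' \<Longrightarrow> ideal_add I J \<subseteq> ideal_add I' J'"
  unfolding ideal_add_def by blast

lemma cu_semigroup_completion: "cu_semigroup completion"
  unfolding cu_semigroup_def
proof (intro conjI allI impI ballI)
  show "pos_ordered_semigroup completion"
    unfolding pos_ordered_semigroup_def
  proof (intro conjI allI impI ballI)
    show "partial_order completion"
      by unfold_locales auto
    have z: "round_ideal {m. R m ze}"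
      unfolding zero_ideal by (rule round_ideal_genseq) (simp add: R_ze)
    show "comm_monoid \<lparr>carrier = carrier completion, mult = add completion, one = \<zero>\<^bsub>completion\<^esub>\<rparr>"
      by (rule comm_monoidI)
        (simp_all add: z round_ideal_add ideal_add_assoc ideal_add_comm[OF z] ideal_add_zero,
          simp add: ideal_add_comm)
  qed (auto simp: ideal_add_mono intro: round_ideal_ze round_ideal_down)
next
  fix I assume "inc_seq completion I"
  then have "\<And>n. round_ideal (I n)" "\<And>n. I n \<subseteq> I (Suc n)" by (auto simp: inc_seq_completion)
  then show "\<exists>J. has_sup completion (range I) J"
    by (simp add: has_sup_completion_iff)
next
  fix J assume "J \<in> carrier completion"
  then have J: "round_ideal J" by simp
  obtain I c where I: "\<And>n. round_ideal (I n)" "\<And>n. c n \<in> I n" "\<And>n m. m \<in> I n \<Longrightarrow> R m (c (Suc n))"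
    "\<And>n. I n \<subseteq> I (Suc n)" "J = (\<Union>n. I n)"
    using round_ideal_approx[OF J] by metis
  have "\<forall>n. I n \<lless>\<^bsub>completion\<^esub> I (Suc n)"
    unfolding way_below_completion using I(1,2,3) by blast
  moreover have "has_sup completion (range I) J"
    using I by (simp add: has_sup_completion_iff)
  ultimately show "\<exists>I. (\<forall>n. I n \<lless>\<^bsub>completion\<^esub> I (Suc n)) \<and> has_sup completion (range I) J" by blast
next
  fix I' I J' J assume "I' \<lless>\<^bsub>completion\<^esub> I \<and> J' \<lless>\<^bsub>completion\<^esub> J"
  then obtain c d where *: "round_ideal I'" "round_ideal I" "round_ideal J'" "round_ideal J"
    "c \<in> I" "d \<in> J" "\<And>m. m \<in> I' \<Longrightarrow> R m c" "\<And>m. m \<in> J' \<Longrightarrow> R m d"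
    unfolding way_below_completion by blast
  have "ad c d \<in> ideal_add I J" using ad_mem_ideal_add * by blast
  moreover have "R m (ad c d)" if "m \<in> ideal_add I' J'" for m
    using that * R_ad R_trans unfolding ideal_add_def by blast
  ultimately show "I' \<oplus>\<^bsub>completion\<^esub> J' \<lless>\<^bsub>completion\<^esub> I \<oplus>\<^bsub>completion\<^esub> J"
    unfolding way_below_completion using round_ideal_add * by auto
next
  fix I J K L
  assume "inc_seq completion I \<and> inc_seq completion J \<and> has_sup completion (range I) K \<and>
    has_sup completion (range J) L"
  then have I: "\<And>n. round_ideal (I n)" "\<And>n. I n \<subseteq> I (Suc n)"
    and J: "\<And>n. round_ideal (J n)" "\<And>n. J n \<subseteq> J (Suc n)"
    and K: "has_sup completion (range I) K" and L: "has_sup completion (range J) L"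
    by (auto simp: inc_seq_completion)
  have KL: "K = (\<Union>n. I n)" "L = (\<Union>n. J n)"
    using has_sup_completion_iff[of I, OF I] has_sup_completion_iff[of J, OF J] K L by auto
  have mono: "I i \<subseteq> I j" "J i \<subseteq> J j" if "i \<le> j" for i j
    using that by (auto dest: lift_Suc_mono_le[of I, OF I(2)] lift_Suc_mono_le[of J, OF J(2)])
  have "ideal_add K L = (\<Union>n. ideal_add (I n) (J n))"
  proof (intro Set.set_eqI iffI)
    fix m assume "m \<in> ideal_add K L"
    then obtain a b i j where "a \<in> I i" "b \<in> J j" "R m (ad a b)"
      unfolding ideal_add_def KL by blast
    moreover have "I i \<subseteq> I (max i j)" "J j \<subseteq> J (max i j)" by (auto intro!: mono)
    ultimately have "m \<in> ideal_add (I (max i j)) (J (max i j))"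
      unfolding ideal_add_def by blast
    then show "m \<in> (\<Union>n. ideal_add (I n) (J n))" by blast
  qed (auto simp: ideal_add_def KL)
  then show "has_sup completion (range (\<lambda>n. I n \<oplus>\<^bsub>completion\<^esub> J n)) (K \<oplus>\<^bsub>completion\<^esub> L)"
    using has_sup_completion_iff[of "\<lambda>n. ideal_add (I n) (J n)" "ideal_add K L"] I J
    by (simp add: round_ideal_add ideal_add_mono)
qed

end

section \<open>Morphisms and bimorphisms\<close>

lemma gen_CuD:
  assumes "f \<in> gen_Cu S T"
  shows "a \<in> carrier S \<Longrightarrow> f a \<in> carrier T"
    and "f \<zero>\<^bsub>S\<^esub> = \<zero>\<^bsub>T\<^esub>"
    and "a \<in> carrier S \<Longrightarrow> b \<in> carrier S \<Longrightarrow> f (a \<oplus>\<^bsub>S\<^esub> b) = f a \<oplus>\<^bsub>T\<^esub> f b"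
    and "a \<in> carrier S \<Longrightarrow> b \<in> carrier S \<Longrightarrow> a \<sqsubseteq>\<^bsub>S\<^esub> b \<Longrightarrow> f a \<sqsubseteq>\<^bsub>T\<^esub> f b"
    and "inc_seq S c \<Longrightarrow> has_sup S (range c) x \<Longrightarrow> has_sup T (range (\<lambda>n. f (c n))) (f x)"
    and "a \<notin> carrier S \<Longrightarrow> f a = undefined"
  using assms unfolding gen_Cu_def po_hom_def by (auto simp: Pi_iff)

lemma Cu_gen: "f \<in> Cu S T \<Longrightarrow> f \<in> gen_Cu S T"
  and Cu_way_below: "f \<in> Cu S T \<Longrightarrow> a \<lless>\<^bsub>S\<^esub> b \<Longrightarrow> f a \<lless>\<^bsub>T\<^esub> f b"
  unfolding Cu_def by blast+

lemma CuI: "f \<in> gen_Cu S T \<Longrightarrow> (\<And>a b. a \<lless>\<^bsub>S\<^esub> b \<Longrightarrow> f a \<lless>\<^bsub>T\<^esub> f b) \<Longrightarrow> f \<in> Cu S T"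
  unfolding Cu_def by blast

lemma gen_Cu_inc_seq:
  assumes "f \<in> gen_Cu S T" "inc_seq S c" shows "inc_seq T (\<lambda>n. f (c n))"
  using assms(2) gen_CuD(1,4)[OF assms(1)] unfolding inc_seq_def by blast

lemma gen_Cu_ext:
  assumes "f \<in> gen_Cu S T" "g \<in> gen_Cu S T" "\<And>a. a \<in> carrier S \<Longrightarrow> f a = g a" shows "f = g"
proof
  show "f a = g a" for a
    by (cases "a \<in> carrier S") (simp_all add: assms(3) gen_CuD(6)[OF assms(1)] gen_CuD(6)[OF assms(2)])
qed

lemma gen_Cu_restrictI:
  assumes "\<And>a. a \<in> carrier S \<Longrightarrow> f a \<in> carrier T"
    and "f \<zero>\<^bsub>S\<^esub> = \<zero>\<^bsub>T\<^esub>"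
    and "\<And>a b. a \<in> carrier S \<Longrightarrow> b \<in> carrier S \<Longrightarrow> f (a \<oplus>\<^bsub>S\<^esub> b) = f a \<oplus>\<^bsub>T\<^esub> f b"
    and "\<And>a b. a \<in> carrier S \<Longrightarrow> b \<in> carrier S \<Longrightarrow> a \<sqsubseteq>\<^bsub>S\<^esub> b \<Longrightarrow> f a \<sqsubseteq>\<^bsub>T\<^esub> f b"
    and "\<And>c x. inc_seq S c \<Longrightarrow> has_sup S (range c) x \<Longrightarrow> has_sup T (range (\<lambda>n. f (c n))) (f x)"
    and "cu_semigroup S"
  shows "(\<lambda>a\<in>carrier S. f a) \<in> gen_Cu S T"
proof -
  interpret S: cu_sg S using assms(6) by unfold_locales
  have "has_sup T (range (\<lambda>n. (\<lambda>a\<in>carrier S. f a) (c n))) ((\<lambda>a\<in>carrier S. f a) x)"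
    if c: "inc_seq S c" "has_sup S (range c) x" for c x
    using assms(5)[OF c] inc_seq_closed[OF c(1)] has_sup_closed[OF c(2)] by simp
  then show ?thesis
    unfolding gen_Cu_def po_hom_def using assms(1-4) by auto
qed

lemma gen_Cu_comp:
  assumes f: "f \<in> gen_Cu S T" and g: "g \<in> gen_Cu T P" and S: "cu_semigroup S"
  shows "(\<lambda>a\<in>carrier S. g (f a)) \<in> gen_Cu S P"
proof (rule gen_Cu_restrictI[OF _ _ _ _ _ S])
  fix c x assume c: "inc_seq S c" "has_sup S (range c) x"
  show "has_sup P (range (\<lambda>n. g (f (c n)))) (g (f x))"
    by (rule gen_CuD(5)[OF g gen_Cu_inc_seq[OF f c(1)] gen_CuD(5)[OF f c]])
qed (simp_all add: gen_CuD[OF f] gen_CuD[OF g])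

lemma Cu_comp:
  assumes f: "f \<in> Cu S T" and g: "g \<in> Cu T P" and S: "cu_semigroup S"
  shows "(\<lambda>a\<in>carrier S. g (f a)) \<in> Cu S P"
proof (rule CuI[OF gen_Cu_comp[OF Cu_gen[OF f] Cu_gen[OF g] S]])
  fix a b assume "a \<lless>\<^bsub>S\<^esub> b"
  then show "(\<lambda>a\<in>carrier S. g (f a)) a \<lless>\<^bsub>P\<^esub> (\<lambda>a\<in>carrier S. g (f a)) b"
    using Cu_way_below[OF g Cu_way_below[OF f]] way_below_closed[of S a b] by simp
qed

lemma Cu_id:
  assumes "cu_semigroup S" shows "(\<lambda>a\<in>carrier S. a) \<in> Cu S S"
proof (rule CuI[OF gen_Cu_restrictI[OF _ _ _ _ _ assms]])
  fix a b assume "a \<lless>\<^bsub>S\<^esub> b"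
  then show "(\<lambda>a\<in>carrier S. a) a \<lless>\<^bsub>S\<^esub> (\<lambda>a\<in>carrier S. a) b"
    using way_below_closed[of S a b] by simp
qed auto

lemma cu_bimorphismD:
  assumes "cu_bimorphism S T P \<phi>"
  shows "a \<in> carrier S \<Longrightarrow> b \<in> carrier T \<Longrightarrow> \<phi> a b \<in> carrier P"
    and "b \<in> carrier T \<Longrightarrow> \<phi> \<zero>\<^bsub>S\<^esub> b = \<zero>\<^bsub>P\<^esub>"
    and "a \<in> carrier S \<Longrightarrow> \<phi> a \<zero>\<^bsub>T\<^esub> = \<zero>\<^bsub>P\<^esub>"
    and "a \<in> carrier S \<Longrightarrow> a' \<in> carrier S \<Longrightarrow> b \<in> carrier T \<Longrightarrow> \<phi> (a \<oplus>\<^bsub>S\<^esub> a') b = \<phi> a b \<oplus>\<^bsub>P\<^esub> \<phi> a' b"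
    and "a \<in> carrier S \<Longrightarrow> b \<in> carrier T \<Longrightarrow> b' \<in> carrier T \<Longrightarrow> \<phi> a (b \<oplus>\<^bsub>T\<^esub> b') = \<phi> a b \<oplus>\<^bsub>P\<^esub> \<phi> a b'"
    and "a \<in> carrier S \<Longrightarrow> a' \<in> carrier S \<Longrightarrow> b \<in> carrier T \<Longrightarrow> a \<sqsubseteq>\<^bsub>S\<^esub> a' \<Longrightarrow> \<phi> a b \<sqsubseteq>\<^bsub>P\<^esub> \<phi> a' b"
    and "a \<in> carrier S \<Longrightarrow> b \<in> carrier T \<Longrightarrow> b' \<in> carrier T \<Longrightarrow> b \<sqsubseteq>\<^bsub>T\<^esub> b' \<Longrightarrow> \<phi> a b \<sqsubseteq>\<^bsub>P\<^esub> \<phi> a b'"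
    and "inc_seq S c \<Longrightarrow> inc_seq T d \<Longrightarrow> has_sup S (range c) x \<Longrightarrow> has_sup T (range d) y \<Longrightarrow>
        has_sup P (range (\<lambda>k. \<phi> (c k) (d k))) (\<phi> x y)"
    and "a' \<lless>\<^bsub>S\<^esub> a \<Longrightarrow> b' \<lless>\<^bsub>T\<^esub> b \<Longrightarrow> \<phi> a' b' \<lless>\<^bsub>P\<^esub> \<phi> a b"
  using assms unfolding cu_bimorphism_def po_hom_def by (auto simp: Pi_iff)

lemma cu_bimorphismI:
  assumes "\<And>a b. a \<in> carrier S \<Longrightarrow> b \<in> carrier T \<Longrightarrow> \<phi> a b \<in> carrier P"
    and "\<And>b. b \<in> carrier T \<Longrightarrow> \<phi> \<zero>\<^bsub>S\<^esub> b = \<zero>\<^bsub>P\<^esub>"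
    and "\<And>a. a \<in> carrier S \<Longrightarrow> \<phi> a \<zero>\<^bsub>T\<^esub> = \<zero>\<^bsub>P\<^esub>"
    and "\<And>a a' b. a \<in> carrier S \<Longrightarrow> a' \<in> carrier S \<Longrightarrow> b \<in> carrier T \<Longrightarrow> \<phi> (a \<oplus>\<^bsub>S\<^esub> a') b = \<phi> a b \<oplus>\<^bsub>P\<^esub> \<phi> a' b"
    and "\<And>a b b'. a \<in> carrier S \<Longrightarrow> b \<in> carrier T \<Longrightarrow> b' \<in> carrier T \<Longrightarrow> \<phi> a (b \<oplus>\<^bsub>T\<^esub> b') = \<phi> a b \<oplus>\<^bsub>P\<^esub> \<phi> a b'"
    and "\<And>a a' b. a \<in> carrier S \<Longrightarrow> a' \<in> carrier S \<Longrightarrow> b \<in> carrier T \<Longrightarrow> a \<sqsubseteq>\<^bsub>S\<^esub> a' \<Longrightarrow> \<phi> a b \<sqsubseteq>\<^bsub>P\<^esub> \<phi> a' b"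
    and "\<And>a b b'. a \<in> carrier S \<Longrightarrow> b \<in> carrier T \<Longrightarrow> b' \<in> carrier T \<Longrightarrow> b \<sqsubseteq>\<^bsub>T\<^esub> b' \<Longrightarrow> \<phi> a b \<sqsubseteq>\<^bsub>P\<^esub> \<phi> a b'"
    and "\<And>c d x y. inc_seq S c \<Longrightarrow> inc_seq T d \<Longrightarrow> has_sup S (range c) x \<Longrightarrow> has_sup T (range d) y \<Longrightarrow>
        has_sup P (range (\<lambda>k. \<phi> (c k) (d k))) (\<phi> x y)"
    and "\<And>a' a b' b. a' \<lless>\<^bsub>S\<^esub> a \<Longrightarrow> b' \<lless>\<^bsub>T\<^esub> b \<Longrightarrow> \<phi> a' b' \<lless>\<^bsub>P\<^esub> \<phi> a b"
  shows "cu_bimorphism S T P \<phi>"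
  using assms unfolding cu_bimorphism_def po_hom_def by (auto simp: Pi_iff)

lemma cu_bimorphism_inc_seq:
  assumes "cu_bimorphism S T P \<phi>" "cu_semigroup P" "inc_seq S c" "inc_seq T d"
  shows "inc_seq P (\<lambda>k. \<phi> (c k) (d k))"
  unfolding inc_seq_def
proof (intro allI conjI)
  interpret P: cu_sg P using assms(2) by unfold_locales
  note p = cu_bimorphismD[OF assms(1)]
  fix n
  have *: "c n \<in> carrier S" "c (Suc n) \<in> carrier S" "d n \<in> carrier T" "d (Suc n) \<in> carrier T"
    "c n \<sqsubseteq>\<^bsub>S\<^esub> c (Suc n)" "d n \<sqsubseteq>\<^bsub>T\<^esub> d (Suc n)"
    using assms(3,4) unfolding inc_seq_def by blast+
  show "\<phi> (c n) (d n) \<in> carrier P" using p(1) * by blast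
  show "\<phi> (c n) (d n) \<sqsubseteq>\<^bsub>P\<^esub> \<phi> (c (Suc n)) (d (Suc n))"
    by (rule P.le_trans[of _ "\<phi> (c (Suc n)) (d n)"]) (simp_all add: p(1,6,7) *)
qed

lemma cu_bimorphism_comp:
  assumes P: "cu_semigroup P" and \<phi>: "cu_bimorphism S T P \<phi>" and \<alpha>: "\<alpha> \<in> Cu S' S" and \<beta>: "\<beta> \<in> Cu T' T" and \<gamma>: "\<gamma> \<in> Cu P P'"
  shows "cu_bimorphism S' T' P' (\<lambda>a b. \<gamma> (\<phi> (\<alpha> a) (\<beta> b)))"
proof -
  note a = gen_CuD[OF Cu_gen[OF \<alpha>]] and b = gen_CuD[OF Cu_gen[OF \<beta>]] and g = gen_CuD[OF Cu_gen[OF \<gamma>]]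
  note p = cu_bimorphismD[OF \<phi>]
  show ?thesis
  proof (rule cu_bimorphismI)
    fix c d x y
    assume *: "inc_seq S' c" "inc_seq T' d" "has_sup S' (range c) x" "has_sup T' (range d) y"
    note ic = gen_Cu_inc_seq[OF Cu_gen[OF \<alpha>] *(1)] gen_Cu_inc_seq[OF Cu_gen[OF \<beta>] *(2)]
    have "inc_seq P (\<lambda>k. \<phi> (\<alpha> (c k)) (\<beta> (d k)))"
      by (rule cu_bimorphism_inc_seq[OF \<phi> P ic])
    then show "has_sup P' (range (\<lambda>k. \<gamma> (\<phi> (\<alpha> (c k)) (\<beta> (d k))))) (\<gamma> (\<phi> (\<alpha> x) (\<beta> y)))"
      by (rule g(5)) (rule p(8)[OF ic a(5)[OF *(1,3)] b(5)[OF *(2,4)]])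
  next
    show "a' \<lless>\<^bsub>S'\<^esub> a \<Longrightarrow> b' \<lless>\<^bsub>T'\<^esub> b \<Longrightarrow> \<gamma> (\<phi> (\<alpha> a') (\<beta> b')) \<lless>\<^bsub>P'\<^esub> \<gamma> (\<phi> (\<alpha> a) (\<beta> b))" for a' a b' b
      by (intro Cu_way_below[OF \<gamma>] p(9) Cu_way_below[OF \<alpha>] Cu_way_below[OF \<beta>])
  qed (simp_all add: a(1-4) b(1-4) g(1-4) p(1-7))
qed

section \<open>Extending additive maps to the completion\<close>

text \<open>Data for a generalized Cu-morphism out of the completion. The two instances are
  evaluation of formal sums at a bimorphism, which gives lifts from the tensor product, and
  evaluation of maps at a point, which gives the endpoint map.\<close>

locale round_monoid_map = round_monoid M ad ze R + P: cu_sg P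
  for M :: "'m set" and ad ze R and P :: "('c, 'k) po_semigroup_scheme" +
  fixes g :: "'m \<Rightarrow> 'c"
  assumes g_closed [simp]: "a \<in> M \<Longrightarrow> g a \<in> carrier P"
    and g_mono: "R a b \<Longrightarrow> g a \<sqsubseteq>\<^bsub>P\<^esub> g b"
    and g_ad: "a \<in> M \<Longrightarrow> b \<in> M \<Longrightarrow> g (ad a b) = g a \<oplus>\<^bsub>P\<^esub> g b"
    and g_ze: "g ze = \<zero>\<^bsub>P\<^esub>"
begin

definition ext :: "'m set \<Rightarrow> 'c" where
  "ext I = (THE x. has_sup P (g ` I) x)"

text \<open>The values along the generators are cofinal among the values on the ideal. Suprema over
  ideals thus become suprema of sequences, to which (O1) and (O4) apply.\<close>

lemma has_sup_genseq:
  assumes c: "\<forall>k. R (c k) (c (Suc k))"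
  shows "has_sup P (g ` genseq c) x \<longleftrightarrow> has_sup P (range (\<lambda>k. g (c k))) x"
proof -
  note cM = R_M1[OF c[rule_format]]
  have sub: "range (\<lambda>k. g (c k)) \<subseteq> g ` genseq c" using genseq_mem[OF c] by blast
  have clos: "g ` genseq c \<subseteq> carrier P" using R_M1 g_closed unfolding genseq_def by blast
  have dom: "\<exists>k. z \<sqsubseteq>\<^bsub>P\<^esub> g (c k)" if "z \<in> g ` genseq c" for z
    using that g_mono unfolding genseq_def by blast
  have "(\<forall>z\<in>g ` genseq c. z \<sqsubseteq>\<^bsub>P\<^esub> y) \<longleftrightarrow> (\<forall>z\<in>range (\<lambda>k. g (c k)). z \<sqsubseteq>\<^bsub>P\<^esub> y)"
    if "y \<in> carrier P" for y
  proof
    assume r: "\<forall>z\<in>range (\<lambda>k. g (c k)). z \<sqsubseteq>\<^bsub>P\<^esub> y"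
    show "\<forall>z\<in>g ` genseq c. z \<sqsubseteq>\<^bsub>P\<^esub> y"
    proof
      fix z assume z: "z \<in> g ` genseq c"
      then obtain k where "z \<sqsubseteq>\<^bsub>P\<^esub> g (c k)" using dom by blast
      then show "z \<sqsubseteq>\<^bsub>P\<^esub> y"
        using P.le_trans[of z "g (c k)" y] r that z clos cM by auto
    qed
  qed (use sub in blast)
  then show ?thesis
    unfolding has_sup_iff using sub clos by (meson subset_trans)
qed

lemma inc_seq_g:
  assumes "\<forall>k. R (c k) (c (Suc k))" shows "inc_seq P (\<lambda>k. g (c k))"
  unfolding inc_seq_def using assms g_mono g_closed[OF R_M1] by blast

lemma has_sup_ext: "round_ideal I \<Longrightarrow> has_sup P (g ` I) (ext I)"
proof -
  assume "round_ideal I"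
  then obtain c where c: "\<forall>k. R (c k) (c (Suc k))" "I = genseq c" by (rule round_idealE)
  obtain x where "has_sup P (range (\<lambda>k. g (c k))) x"
    using P.sup_exists[OF inc_seq_g[OF c(1)]] by blast
  then have x: "has_sup P (g ` I) x" using has_sup_genseq[OF c(1)] c(2) by simp
  then show ?thesis
    unfolding ext_def by (rule theI2) (use x P.has_sup_unique in blast)+
qed

lemma ext_closed [simp]: "round_ideal I \<Longrightarrow> ext I \<in> carrier P"
  using has_sup_closed[OF has_sup_ext] .

lemma ext_upper: "round_ideal I \<Longrightarrow> m \<in> I \<Longrightarrow> g m \<sqsubseteq>\<^bsub>P\<^esub> ext I"
  using has_sup_upper[OF has_sup_ext] by blast

lemma ext_least: "round_ideal I \<Longrightarrow> y \<in> carrier P \<Longrightarrow> (\<And>m. m \<in> I \<Longrightarrow> g m \<sqsubseteq>\<^bsub>P\<^esub> y) \<Longrightarrow> ext I \<sqsubseteq>\<^bsub>P\<^esub> y"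
  using has_sup_least[OF has_sup_ext] by blast

lemma ext_add:
  assumes "round_ideal I" "round_ideal J"
  shows "ext (ideal_add I J) = ext I \<oplus>\<^bsub>P\<^esub> ext J"
proof -
  obtain c where c: "\<forall>k. R (c k) (c (Suc k))" "I = genseq c" using assms(1) by (rule round_idealE)
  obtain d where d: "\<forall>k. R (d k) (d (Suc k))" "J = genseq d" using assms(2) by (rule round_idealE)
  have cd: "\<forall>k. R (ad (c k) (d k)) (ad (c (Suc k)) (d (Suc k)))" using c d by (simp add: R_ad)
  have "has_sup P (range (\<lambda>k. g (c k) \<oplus>\<^bsub>P\<^esub> g (d k))) (ext I \<oplus>\<^bsub>P\<^esub> ext J)"
    using has_sup_ext[OF assms(1)] has_sup_ext[OF assms(2)]
    by (intro P.has_sup_add inc_seq_g c(1) d(1)) (simp_all add: c d has_sup_genseq)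
  moreover have "has_sup P (range (\<lambda>k. g (c k) \<oplus>\<^bsub>P\<^esub> g (d k))) (ext (ideal_add I J))"
    using has_sup_ext[OF round_ideal_add[OF assms]]
    by (simp add: c(2) d(2) round_ideal_add_seq[OF c(1) d(1)] has_sup_genseq[OF cd]
        g_ad R_M1[OF c(1)[rule_format]] R_M1[OF d(1)[rule_format]])
  ultimately show ?thesis by (rule P.has_sup_unique[symmetric])
qed

lemma ext_zero: "ext {m. R m ze} = \<zero>\<^bsub>P\<^esub>"
proof (rule P.le_zero)
  have r: "round_ideal {m. R m ze}"
    unfolding zero_ideal by (rule round_ideal_genseq) (simp add: R_ze)
  then show "ext {m. R m ze} \<in> carrier P" by simp
  show "ext {m. R m ze} \<sqsubseteq>\<^bsub>P\<^esub> \<zero>\<^bsub>P\<^esub>"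
    by (rule ext_least[OF r]) (use g_mono[of _ ze] g_ze in auto)
qed

lemma ext_mono: "round_ideal I \<Longrightarrow> round_ideal J \<Longrightarrow> I \<subseteq> J \<Longrightarrow> ext I \<sqsubseteq>\<^bsub>P\<^esub> ext J"
  by (rule ext_least) (auto intro: ext_upper)

lemma ext_gen_Cu: "(\<lambda>I\<in>carrier completion. ext I) \<in> gen_Cu completion P"
proof (rule gen_Cu_restrictI[OF _ _ _ _ _ cu_semigroup_completion])
  fix I J assume "inc_seq completion I" and J: "has_sup completion (range I) J"
  then have I: "\<And>n. round_ideal (I n)" "\<And>n. I n \<subseteq> I (Suc n)" by (auto simp: inc_seq_completion)
  then have J: "J = (\<Union>n. I n)" using J has_sup_completion_iff[of I, OF I] by simp
  have rJ: "round_ideal J" unfolding J by (rule round_ideal_Union[of I, OF I])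
  show "has_sup P (range (\<lambda>n. ext (I n))) (ext J)"
  proof (rule has_supI)
    fix y assume y: "y \<in> carrier P" "\<And>a. a \<in> range (\<lambda>n. ext (I n)) \<Longrightarrow> a \<sqsubseteq>\<^bsub>P\<^esub> y"
    show "ext J \<sqsubseteq>\<^bsub>P\<^esub> y"
    proof (rule ext_least[OF rJ y(1)])
      fix m assume "m \<in> J"
      then obtain n where n: "m \<in> I n" using J by blast
      then show "g m \<sqsubseteq>\<^bsub>P\<^esub> y"
        using P.le_trans[OF ext_upper[OF I(1) n] y(2)] y(1) round_ideal_M[OF I(1) n] I(1) by simp
    qed
  next
    fix a assume "a \<in> range (\<lambda>n. ext (I n))"
    then show "a \<in> carrier P" "a \<sqsubseteq>\<^bsub>P\<^esub> ext J" using I(1) rJ J by (auto intro!: ext_mono)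
  qed (simp add: rJ)
qed (simp_all add: ext_zero ext_add ext_mono)

text \<open>If \<open>I\<close> is bounded by \<open>c \<in> J\<close> and \<open>d \<in> J\<close>
  lies above \<open>c\<close>, then the value at \<open>I\<close> is below \<open>g c\<close>, which
  is way below \<open>g d\<close>, which is below the value at \<open>J\<close>.\<close>

lemma ext_Cu:
  assumes "\<And>a b. R a b \<Longrightarrow> g a \<lless>\<^bsub>P\<^esub> g b"
  shows "(\<lambda>I\<in>carrier completion. ext I) \<in> Cu completion P"
proof (rule CuI[OF ext_gen_Cu])
  fix I J assume "I \<lless>\<^bsub>completion\<^esub> J"
  then obtain c where c: "round_ideal I" "round_ideal J" "c \<in> J" "\<And>m. m \<in> I \<Longrightarrow> R m c"
    unfolding way_below_completion by blast
  obtain d where d: "d \<in> J" "R c d" using round_ideal_round[OF c(2,3)] by blast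
  have "ext I \<sqsubseteq>\<^bsub>P\<^esub> g c"
    by (rule ext_least[OF c(1)]) (use c(4) g_mono R_M1[OF d(2)] in auto)
  then have "ext I \<lless>\<^bsub>P\<^esub> g d"
    by (rule P.way_below_trans_le[OF _ assms[OF d(2)]]) (simp add: c(1))
  then have "ext I \<lless>\<^bsub>P\<^esub> ext J"
    by (rule P.le_trans_way_below[OF _ ext_upper[OF c(2) d(1)]]) (simp add: c(2))
  then show "(\<lambda>I\<in>carrier completion. ext I) I \<lless>\<^bsub>P\<^esub> (\<lambda>I\<in>carrier completion. ext I) J"
    using c by simp
qed

end

section \<open>The algebraic tensor product\<close>

lemma rel_mset_inducts [consumes 1, case_names empty add]:
  assumes "rel_mset Q m n" "P {#} {#}"
    and "\<And>p q m n. Q p q \<Longrightarrow> rel_mset Q m n \<Longrightarrow> P m n \<Longrightarrow> P (add_mset p m) (add_mset q n)"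
  shows "P m n"
  using assms by (induction rule: rel_mset_induct) auto

locale cu_pair = S: cu_sg S + T: cu_sg T
  for S :: "('a, 'm) po_semigroup_scheme" and T :: "('b, 'n) po_semigroup_scheme"
begin

definition formal_sums :: "('a \<times> 'b) multiset set" where
  "formal_sums = {m. set_mset m \<subseteq> carrier S \<times> carrier T}"

text \<open>The generating moves of the algebraic tensor product. Additivity and zero laws occur in
  both directions so that they become equalities once the preorder is symmetrised; monotonicity goes
  one way only.\<close>

inductive tstep :: "('a \<times> 'b) multiset \<Rightarrow> ('a \<times> 'b) multiset \<Rightarrow> bool" where
  mono: "a \<in> carrier S \<Longrightarrow> a' \<in> carrier S \<Longrightarrow> b \<in> carrier T \<Longrightarrow> b' \<in> carrier T \<Longrightarrow>
    a \<sqsubseteq>\<^bsub>S\<^esub> a' \<Longrightarrow> b \<sqsubseteq>\<^bsub>T\<^esub> b' \<Longrightarrow> tstep {#(a, b)#} {#(a', b')#}"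
| add_left1: "a \<in> carrier S \<Longrightarrow> a' \<in> carrier S \<Longrightarrow> b \<in> carrier T \<Longrightarrow>
    tstep {#(a \<oplus>\<^bsub>S\<^esub> a', b)#} {#(a, b), (a', b)#}"
| add_left2: "a \<in> carrier S \<Longrightarrow> a' \<in> carrier S \<Longrightarrow> b \<in> carrier T \<Longrightarrow>
    tstep {#(a, b), (a', b)#} {#(a \<oplus>\<^bsub>S\<^esub> a', b)#}"
| add_right1: "a \<in> carrier S \<Longrightarrow> b \<in> carrier T \<Longrightarrow> b' \<in> carrier T \<Longrightarrow>
    tstep {#(a, b \<oplus>\<^bsub>T\<^esub> b')#} {#(a, b), (a, b')#}"
| add_right2: "a \<in> carrier S \<Longrightarrow> b \<in> carrier T \<Longrightarrow> b' \<in> carrier T \<Longrightarrow>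
    tstep {#(a, b), (a, b')#} {#(a, b \<oplus>\<^bsub>T\<^esub> b')#}"
| zero_left1: "b \<in> carrier T \<Longrightarrow> tstep {#(\<zero>\<^bsub>S\<^esub>, b)#} {#}"
| zero_left2: "b \<in> carrier T \<Longrightarrow> tstep {#} {#(\<zero>\<^bsub>S\<^esub>, b)#}"
| zero_right1: "a \<in> carrier S \<Longrightarrow> tstep {#(a, \<zero>\<^bsub>T\<^esub>)#} {#}"
| zero_right2: "a \<in> carrier S \<Longrightarrow> tstep {#} {#(a, \<zero>\<^bsub>T\<^esub>)#}"

text \<open>Moves act inside an arbitrary context \<open>k\<close>, which makes the preorder
  compatible with addition.\<close>

inductive tle :: "('a \<times> 'b) multiset \<Rightarrow> ('a \<times> 'b) multiset \<Rightarrow> bool" where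
  refl: "m \<in> formal_sums \<Longrightarrow> tle m m"
| step: "tle m (x + k) \<Longrightarrow> tstep x y \<Longrightarrow> tle m (y + k)"

definition pair_below :: "'a \<times> 'b \<Rightarrow> 'a \<times> 'b \<Rightarrow> bool" where
  "pair_below p q \<longleftrightarrow> fst p \<lless>\<^bsub>S\<^esub> fst q \<and> snd p \<lless>\<^bsub>T\<^esub> snd q"

text \<open>A normal form: a derivation followed by one termwise way-below step. Composing in the
  opposite order gives nothing new, by \<open>tle_pullback\<close>.\<close>

definition tprec :: "('a \<times> 'b) multiset \<Rightarrow> ('a \<times> 'b) multiset \<Rightarrow> bool" where
  "tprec m n \<longleftrightarrow> (\<exists>m'. tle m m' \<and> rel_mset pair_below m' n)"

lemma pair_below_simp [simp]: "pair_below (a', b') (a, b) \<longleftrightarrow> a' \<lless>\<^bsub>S\<^esub> a \<and> b' \<lless>\<^bsub>T\<^esub> b"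
  by (simp add: pair_below_def)

lemma formal_sums_empty [simp]: "{#} \<in> formal_sums"
  and formal_sums_add_mset [simp]:
    "add_mset p m \<in> formal_sums \<longleftrightarrow> fst p \<in> carrier S \<and> snd p \<in> carrier T \<and> m \<in> formal_sums"
  and formal_sums_union [simp]: "m + n \<in> formal_sums \<longleftrightarrow> m \<in> formal_sums \<and> n \<in> formal_sums"
  by (auto simp: formal_sums_def mem_Times_iff)

lemma tstep_closed: "tstep x y \<Longrightarrow> x \<in> formal_sums \<and> y \<in> formal_sums"
  by (induction rule: tstep.induct) auto

lemma tle_closed: "tle m n \<Longrightarrow> m \<in> formal_sums \<and> n \<in> formal_sums"
  by (induction rule: tle.induct) (auto dest: tstep_closed)

lemma tle_trans: "tle n k \<Longrightarrow> tle m n \<Longrightarrow> tle m k"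
  by (induction rule: tle.induct) (auto intro: tle.step)

lemma tle_tstep: "tstep x y \<Longrightarrow> tle x y"
  using tle.step[of x x "{#}" y] tle.refl[of x] tstep_closed[of x y] by simp

lemma tle_union_right: "tle m n \<Longrightarrow> k \<in> formal_sums \<Longrightarrow> tle (m + k) (n + k)"
proof (induction rule: tle.induct)
  case (step m x l y)
  then have "tle (m + k) (x + (l + k))" by (simp add: add.assoc)
  then have "tle (m + k) (y + (l + k))" using step.hyps(2) by (rule tle.step)
  then show ?case by (simp add: add.assoc)
qed (simp add: tle.refl)

lemma tle_union:
  assumes "tle m n" "tle m' n'" shows "tle (m + m') (n + n')"
  using tle_trans[OF tle_union_right[OF assms(2), of n] tle_union_right[OF assms(1), of m', unfolded add.commute[of n]]]
    tle_closed[OF assms(1)] tle_closed[OF assms(2)] by (simp add: add.commute)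

lemma rel_mset_closed: "rel_mset pair_below m n \<Longrightarrow> m \<in> formal_sums \<and> n \<in> formal_sums"
  by (induction rule: rel_mset_inducts) (auto simp: pair_below_def dest: way_below_closed)

lemma rel_mset_single_right: "rel_mset Q m {#q#} \<longleftrightarrow> (\<exists>p. m = {#p#} \<and> Q p q)"
  by (auto dest!: msed_rel_invR intro: rel_mset_Plus rel_mset_Zero)

lemma rel_mset_single: "Q p q \<Longrightarrow> rel_mset Q {#p#} {#q#}"
  by (simp add: rel_mset_single_right)

lemma rel_mset_union_right:
  "rel_mset Q m (x + k) \<Longrightarrow> \<exists>m1 m2. m = m1 + m2 \<and> rel_mset Q m1 x \<and> rel_mset Q m2 k"
proof (induction x arbitrary: m)
  case empty
  then show ?case by (intro exI[of _ "{#}"] exI[of _ m]) (simp add: rel_mset_Zero)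
next
  case (add q x)
  then have "rel_mset Q m (add_mset q (x + k))" by simp
  then obtain m' p where m': "m = add_mset p m'" "Q p q" "rel_mset Q m' (x + k)"
    by (auto dest!: msed_rel_invR)
  then obtain m1 m2 where "m' = m1 + m2" "rel_mset Q m1 x" "rel_mset Q m2 k" using add.IH by blast
  then show ?case
    using m' by (intro exI[of _ "add_mset p m1"] exI[of _ m2]) (simp add: rel_mset_Plus)
qed

lemma rel_mset_union:
  "rel_mset Q m1 n1 \<Longrightarrow> rel_mset Q m2 n2 \<Longrightarrow> rel_mset Q (m1 + m2) (n1 + n2)"
  by (induction rule: rel_mset_inducts) (auto intro: rel_mset_Plus)

lemma rel_mset_dense: "rel_mset pair_below m n \<Longrightarrow> \<exists>k. rel_mset pair_below m k \<and> rel_mset pair_below k n"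
proof (induction rule: rel_mset_inducts)
  case empty
  then show ?case using rel_mset_Zero by blast
next
  case (add p q m n)
  obtain a where "fst p \<lless>\<^bsub>S\<^esub> a" "a \<lless>\<^bsub>S\<^esub> fst q" using S.way_below_interp add(1) by (auto simp: pair_below_def)
  moreover obtain b where "snd p \<lless>\<^bsub>T\<^esub> b" "b \<lless>\<^bsub>T\<^esub> snd q" using T.way_below_interp add(1) by (auto simp: pair_below_def)
  ultimately have ab: "pair_below p (a, b)" "pair_below (a, b) q" by (simp_all add: pair_below_def)
  obtain k where k: "rel_mset pair_below m k" "rel_mset pair_below k n" using add.IH by blast
  show ?case using rel_mset_Plus[OF ab(1) k(1)] rel_mset_Plus[OF ab(2) k(2)] by blast
qed

lemma rel_mset_transp:
  "rel_mset pair_below m n \<Longrightarrow> rel_mset pair_below n k \<Longrightarrow> rel_mset pair_below m k"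
proof (induction arbitrary: k rule: rel_mset_inducts)
  case empty
  then show ?case by simp
next
  case (add p q m n)
  obtain k' r where k: "k = add_mset r k'" "pair_below q r" "rel_mset pair_below n k'"
    using msed_rel_invL[OF add.prems] by blast
  have "pair_below p r"
    using add.hyps(1) k(2) S.way_below_trans T.way_below_trans unfolding pair_below_def by blast
  then show ?case using rel_mset_Plus[OF _ add.IH[OF k(3)]] k(1) by blast
qed

text \<open>Every move can already be carried out on approximants of its source. Splitting moves use
  \<open>way_below_add_split\<close>, merging moves first raise the approximants of the shared
  factor to a common one, and removal of a zero tensor works since only zero is way below
  zero.\<close>

lemma tstep_pullback:
  assumes "tstep x y" "rel_mset pair_below m x"
  shows "\<exists>m'. tle m m' \<and> rel_mset pair_below m' y"
  using assms
proof (induction rule: tstep.induct)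
  case (mono a a' b b')
  then obtain c d where m: "m = {#(c, d)#}" "c \<lless>\<^bsub>S\<^esub> a" "d \<lless>\<^bsub>T\<^esub> b"
    by (auto simp: rel_mset_single_right)
  then have "rel_mset pair_below m {#(a', b')#}"
    using S.le_trans_way_below[OF m(2) mono(5,2)] T.le_trans_way_below[OF m(3) mono(6,4)]
    by (simp add: rel_mset_single)
  then show ?case using tle.refl rel_mset_closed by blast
next
  case (add_left1 a a' b)
  then obtain c d where m: "m = {#(c, d)#}" "c \<lless>\<^bsub>S\<^esub> a \<oplus>\<^bsub>S\<^esub> a'" "d \<lless>\<^bsub>T\<^esub> b"
    by (auto simp: rel_mset_single_right)
  \<comment> \<open>The approximant of a sum is dominated by a sum of approximants, and that sum is
    then split by the same move.\<close>
  obtain e e' where e: "e \<lless>\<^bsub>S\<^esub> a" "e' \<lless>\<^bsub>S\<^esub> a'" "c \<lless>\<^bsub>S\<^esub> e \<oplus>\<^bsub>S\<^esub> e'"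
    by (rule S.way_below_add_split[OF m(2) add_left1(1,2)])
  note [simp] = way_below_closed(1)[OF m(2)] way_below_closed(1)[OF m(3)]
    way_below_closed(1)[OF e(1)] way_below_closed(1)[OF e(2)]
  have "tle m {#(e \<oplus>\<^bsub>S\<^esub> e', d)#}"
    unfolding m by (intro tle_tstep tstep.mono) (simp_all add: S.way_below_imp_le[OF e(3)])
  moreover have "tle {#(e \<oplus>\<^bsub>S\<^esub> e', d)#} {#(e, d), (e', d)#}"
    by (intro tle_tstep tstep.add_left1) simp_all
  moreover have "rel_mset pair_below {#(e, d), (e', d)#} {#(a, b), (a', b)#}"
    using e m by (intro rel_mset_Plus rel_mset_Zero) simp_all
  ultimately show ?case using tle_trans by blast
next
  case (add_right1 a b b')
  then obtain c d where m: "m = {#(c, d)#}" "c \<lless>\<^bsub>S\<^esub> a" "d \<lless>\<^bsub>T\<^esub> b \<oplus>\<^bsub>T\<^esub> b'"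
    by (auto simp: rel_mset_single_right)
  obtain e e' where e: "e \<lless>\<^bsub>T\<^esub> b" "e' \<lless>\<^bsub>T\<^esub> b'" "d \<lless>\<^bsub>T\<^esub> e \<oplus>\<^bsub>T\<^esub> e'"
    by (rule T.way_below_add_split[OF m(3) add_right1(2,3)])
  note [simp] = way_below_closed(1)[OF m(2)] way_below_closed(1)[OF m(3)]
    way_below_closed(1)[OF e(1)] way_below_closed(1)[OF e(2)]
  have "tle m {#(c, e \<oplus>\<^bsub>T\<^esub> e')#}"
    unfolding m by (intro tle_tstep tstep.mono) (simp_all add: T.way_below_imp_le[OF e(3)])
  moreover have "tle {#(c, e \<oplus>\<^bsub>T\<^esub> e')#} {#(c, e), (c, e')#}"
    by (intro tle_tstep tstep.add_right1) simp_all
  moreover have "rel_mset pair_below {#(c, e), (c, e')#} {#(a, b), (a, b')#}"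
    using e m by (intro rel_mset_Plus rel_mset_Zero) simp_all
  ultimately show ?case using tle_trans by blast
next
  case (add_left2 a a' b)
  then obtain c d c' d' where m: "m = {#(c, d), (c', d')#}" "c \<lless>\<^bsub>S\<^esub> a" "d \<lless>\<^bsub>T\<^esub> b" "c' \<lless>\<^bsub>S\<^esub> a'" "d' \<lless>\<^bsub>T\<^esub> b"
    by (auto simp: rel_mset_single_right dest!: msed_rel_invR)
  \<comment> \<open>The two tensors approximate the same \<open>b\<close> by different elements
    \<open>d\<close> and \<open>d'\<close>; they can be merged only after both are raised to
    \<open>e\<close>.\<close>
  obtain e where e: "d \<lless>\<^bsub>T\<^esub> e" "d' \<lless>\<^bsub>T\<^esub> e" "e \<lless>\<^bsub>T\<^esub> b"
    by (rule T.way_below_directed[OF m(3,5)])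
  note [simp] = way_below_closed(1)[OF m(2)] way_below_closed(1)[OF m(3)]
    way_below_closed(1)[OF m(4)] way_below_closed(1)[OF m(5)] way_below_closed(1)[OF e(3)]
  have "tle ({#(c, d)#} + {#(c', d')#}) ({#(c, e)#} + {#(c', e)#})"
    by (intro tle_union tle_tstep tstep.mono) (simp_all add: T.way_below_imp_le[OF e(1)] T.way_below_imp_le[OF e(2)])
  then have "tle m {#(c, e), (c', e)#}" by (simp add: m(1) add_mset_commute)
  moreover have "tle {#(c, e), (c', e)#} {#(c \<oplus>\<^bsub>S\<^esub> c', e)#}"
    by (intro tle_tstep tstep.add_left2) simp_all
  moreover have "rel_mset pair_below {#(c \<oplus>\<^bsub>S\<^esub> c', e)#} {#(a \<oplus>\<^bsub>S\<^esub> a', b)#}"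
    using m(2,4) e(3) by (intro rel_mset_single) (simp add: S.way_below_add)
  ultimately show ?case using tle_trans by blast
next
  case (add_right2 a b b')
  then obtain c d c' d' where m: "m = {#(c, d), (c', d')#}" "c \<lless>\<^bsub>S\<^esub> a" "d \<lless>\<^bsub>T\<^esub> b" "c' \<lless>\<^bsub>S\<^esub> a" "d' \<lless>\<^bsub>T\<^esub> b'"
    by (auto simp: rel_mset_single_right dest!: msed_rel_invR)
  obtain e where e: "c \<lless>\<^bsub>S\<^esub> e" "c' \<lless>\<^bsub>S\<^esub> e" "e \<lless>\<^bsub>S\<^esub> a"
    by (rule S.way_below_directed[OF m(2,4)])
  note [simp] = way_below_closed(1)[OF m(2)] way_below_closed(1)[OF m(3)]
    way_below_closed(1)[OF m(4)] way_below_closed(1)[OF m(5)] way_below_closed(1)[OF e(3)]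
  have "tle ({#(c, d)#} + {#(c', d')#}) ({#(e, d)#} + {#(e, d')#})"
    by (intro tle_union tle_tstep tstep.mono) (simp_all add: S.way_below_imp_le[OF e(1)] S.way_below_imp_le[OF e(2)])
  then have "tle m {#(e, d), (e, d')#}" by (simp add: m(1) add_mset_commute)
  moreover have "tle {#(e, d), (e, d')#} {#(e, d \<oplus>\<^bsub>T\<^esub> d')#}"
    by (intro tle_tstep tstep.add_right2) simp_all
  moreover have "rel_mset pair_below {#(e, d \<oplus>\<^bsub>T\<^esub> d')#} {#(a, b \<oplus>\<^bsub>T\<^esub> b')#}"
    using m(3,5) e(3) by (intro rel_mset_single) (simp add: T.way_below_add)
  ultimately show ?case using tle_trans by blast
next
  case (zero_left1 b)
  then obtain c d where m: "m = {#(c, d)#}" "c \<lless>\<^bsub>S\<^esub> \<zero>\<^bsub>S\<^esub>" "d \<lless>\<^bsub>T\<^esub> b"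
    by (auto simp: rel_mset_single_right)
  then have "m = {#(\<zero>\<^bsub>S\<^esub>, d)#}"
    using S.le_zero[OF way_below_closed(1)[OF m(2)] S.way_below_imp_le[OF m(2)]] by simp
  then have "tle m {#}"
    using tle_tstep[OF tstep.zero_left1] way_below_closed(1)[OF m(3)] by simp
  then show ?case using rel_mset_Zero by blast
next
  case (zero_right1 a)
  then obtain c d where m: "m = {#(c, d)#}" "c \<lless>\<^bsub>S\<^esub> a" "d \<lless>\<^bsub>T\<^esub> \<zero>\<^bsub>T\<^esub>"
    by (auto simp: rel_mset_single_right)
  then have "m = {#(c, \<zero>\<^bsub>T\<^esub>)#}"
    using T.le_zero[OF way_below_closed(1)[OF m(3)] T.way_below_imp_le[OF m(3)]] by simp
  then have "tle m {#}"
    using tle_tstep[OF tstep.zero_right1] way_below_closed(1)[OF m(2)] by simp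
  then show ?case using rel_mset_Zero by blast
next
  case (zero_left2 b)
  then have "m = {#}" by (auto dest: rel_mset_size)
  \<comment> \<open>The approximant of the created tensor is the pair of zeros, since zero is way
    below every element.\<close>
  moreover have "tle {#} {#(\<zero>\<^bsub>S\<^esub>, \<zero>\<^bsub>T\<^esub>)#}"
    by (rule tle_tstep[OF tstep.zero_left2]) simp
  moreover have "rel_mset pair_below {#(\<zero>\<^bsub>S\<^esub>, \<zero>\<^bsub>T\<^esub>)#} {#(\<zero>\<^bsub>S\<^esub>, b)#}"
    using zero_left2 by (intro rel_mset_single) (simp add: S.zero_way_below T.zero_way_below)
  ultimately show ?case by blast
next
  case (zero_right2 a)
  then have "m = {#}" by (auto dest: rel_mset_size)
  moreover have "tle {#} {#(\<zero>\<^bsub>S\<^esub>, \<zero>\<^bsub>T\<^esub>)#}"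
    by (rule tle_tstep[OF tstep.zero_left2]) simp
  moreover have "rel_mset pair_below {#(\<zero>\<^bsub>S\<^esub>, \<zero>\<^bsub>T\<^esub>)#} {#(a, \<zero>\<^bsub>T\<^esub>)#}"
    using zero_right2 by (intro rel_mset_single) (simp add: S.zero_way_below T.zero_way_below)
  ultimately show ?case by blast
qed

text \<open>Induction along the derivation: the part of the approximant that lies under the
  untouched context is carried along, and \<open>tstep_pullback\<close> treats the rest.\<close>

lemma tle_pullback:
  assumes "tle n n'" "rel_mset pair_below m n"
  shows "\<exists>m'. tle m m' \<and> rel_mset pair_below m' n'"
  using assms
proof (induction arbitrary: m rule: tle.induct)
  case (refl n)
  then show ?case using tle.refl rel_mset_closed by blast
next
  case (step n x k y)
  then obtain m' where m': "tle m m'" "rel_mset pair_below m' (x + k)" by blast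
  then obtain m1 m2 where m12: "m' = m1 + m2" "rel_mset pair_below m1 x" "rel_mset pair_below m2 k"
    using rel_mset_union_right by blast
  obtain m1' where m1': "tle m1 m1'" "rel_mset pair_below m1' y"
    using tstep_pullback[OF step.hyps(2) m12(2)] by blast
  have "tle m' (m1' + m2)"
    unfolding m12 using m1'(1) m12(3) tle_union_right rel_mset_closed by blast
  moreover have "rel_mset pair_below (m1' + m2) (y + k)" using rel_mset_union m1' m12 by blast
  ultimately show ?case using m'(1) tle_trans by blast
qed

lemma tprec_closed: "tprec m n \<Longrightarrow> m \<in> formal_sums \<and> n \<in> formal_sums"
  unfolding tprec_def using tle_closed rel_mset_closed by blast

lemma tprec_tle: "tprec m n \<Longrightarrow> tle n k \<Longrightarrow> tprec m k"
  unfolding tprec_def using tle_pullback tle_trans by blast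

lemma tle_tprec: "tle m n \<Longrightarrow> tprec n k \<Longrightarrow> tprec m k"
  unfolding tprec_def using tle_trans by blast

lemma rel_mset_tprec: "rel_mset pair_below m n \<Longrightarrow> tprec m n"
  unfolding tprec_def using tle.refl rel_mset_closed by blast

text \<open>\<open>rel_mset\<close> preserves the number of summands, so the empty sum is first
  padded with one pair of zeros for each summand of \<open>n\<close>.\<close>

lemma tprec_empty: "n \<in> formal_sums \<Longrightarrow> tprec {#} n"
proof -
  assume "n \<in> formal_sums"
  then have "\<exists>m. tle {#} m \<and> rel_mset pair_below m n"
  proof (induction n)
    case empty
    then show ?case using tle.refl rel_mset_Zero by blast
  next
    case (add p n)
    then obtain m where m: "tle {#} m" "rel_mset pair_below m n" by auto
    have "tle ({#} + {#}) ({#(\<zero>\<^bsub>S\<^esub>, \<zero>\<^bsub>T\<^esub>)#} + m)"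
      by (intro tle_union m(1) tle_tstep tstep.zero_left2) simp
    moreover have "rel_mset pair_below (add_mset (\<zero>\<^bsub>S\<^esub>, \<zero>\<^bsub>T\<^esub>) m) (add_mset p n)"
      using add.prems m(2) by (intro rel_mset_Plus) (simp_all add: pair_below_def S.zero_way_below T.zero_way_below)
    ultimately show ?case by auto
  qed
  then show ?thesis unfolding tprec_def .
qed

sublocale round_monoid formal_sums "(+)" "{#}" tprec
proof
  show "tprec a b \<Longrightarrow> tprec b c \<Longrightarrow> tprec a c" for a b c
  proof -
    assume "tprec a b" "tprec b c"
    then obtain b' c' where *: "tle a b'" "rel_mset pair_below b' b" "tle b c'" "rel_mset pair_below c' c"
      unfolding tprec_def by blast
    \<comment> \<open>The chain from \<open>a\<close> to \<open>c\<close> alternates derivations and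
      way-below steps. Exchanging the two middle links brings equal links together, and equal links
      compose.\<close>
    then obtain d where "tle b' d" "rel_mset pair_below d c'" using tle_pullback by blast
    then show "tprec a c" unfolding tprec_def using * tle_trans rel_mset_transp by blast
  qed
  show "tprec a c \<Longrightarrow> \<exists>b. tprec a b \<and> tprec b c" for a c
    using rel_mset_dense rel_mset_tprec unfolding tprec_def by (meson tle_tprec rel_mset_tprec)
  show "tprec a' a \<Longrightarrow> tprec b' b \<Longrightarrow> tprec (a' + b') (a + b)" for a' a b' b
    unfolding tprec_def using tle_union rel_mset_union by blast
qed (auto simp: tprec_closed tprec_empty add.assoc add.commute)

definition principal :: "('a \<times> 'b) multiset \<Rightarrow> ('a \<times> 'b) multiset set" where
  "principal n = {m. tprec m n}"

lemma principal_empty: "principal {#} = \<zero>\<^bsub>completion\<^esub>"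
  by (simp add: principal_def)

lemma principal_union:
  assumes "m \<in> formal_sums" "n \<in> formal_sums"
  shows "principal (m + n) = ideal_add (principal m) (principal n)"
proof (intro Set.set_eqI iffI)
  fix k assume "k \<in> principal (m + n)"
  then obtain k' where k': "tle k k'" "rel_mset pair_below k' (m + n)"
    unfolding principal_def tprec_def by blast
  then obtain k1 k2 where k12: "k' = k1 + k2" "rel_mset pair_below k1 m" "rel_mset pair_below k2 n"
    using rel_mset_union_right by blast
  \<comment> \<open>\<open>k1\<close> and \<open>k2\<close> only bound \<open>k\<close> by a
    derivation; membership in \<open>ideal_add\<close> requires \<open>tprec k\<close>, so one
    way-below step is divided into two.\<close>
  obtain x1 x2 where "rel_mset pair_below k1 x1" "rel_mset pair_below x1 m"
    "rel_mset pair_below k2 x2" "rel_mset pair_below x2 n"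
    using rel_mset_dense[OF k12(2)] rel_mset_dense[OF k12(3)] by blast
  then have "x1 \<in> principal m" "x2 \<in> principal n" "tprec k (x1 + x2)"
    unfolding principal_def using rel_mset_tprec rel_mset_union k'(1) k12(1) tle_tprec by blast+
  then show "k \<in> ideal_add (principal m) (principal n)"
    unfolding ideal_add_def by blast
next
  fix k assume "k \<in> ideal_add (principal m) (principal n)"
  then show "k \<in> principal (m + n)"
    unfolding ideal_add_def principal_def using R_ad R_trans by blast
qed

lemma principal_pair:
  assumes "inc_seq S c" "inc_seq T d" "has_sup S (range c) x" "has_sup T (range d) y"
  shows "principal {#(x, y)#} = (\<Union>k. principal {#(c k, d k)#})"
proof (intro Set.set_eqI iffI)
  fix m assume "m \<in> principal {#(x, y)#}"
  then obtain a b where ab: "tle m {#(a, b)#}" "a \<lless>\<^bsub>S\<^esub> x" "b \<lless>\<^bsub>T\<^esub> y"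
    unfolding principal_def tprec_def by (auto simp: rel_mset_single_right)
  obtain i j where "a \<lless>\<^bsub>S\<^esub> c i" "b \<lless>\<^bsub>T\<^esub> d j"
    using S.way_below_sup_strong[OF ab(2) assms(1,3)] T.way_below_sup_strong[OF ab(3) assms(2,4)] by blast
  then have "a \<lless>\<^bsub>S\<^esub> c (max i j)" "b \<lless>\<^bsub>T\<^esub> d (max i j)"
    by (auto elim!: S.le_trans_way_below T.le_trans_way_below intro!: S.inc_seqD[OF assms(1)] T.inc_seqD[OF assms(2)]
        inc_seq_closed[OF assms(1)] inc_seq_closed[OF assms(2)])
  then have "m \<in> principal {#(c (max i j), d (max i j))#}"
    unfolding principal_def tprec_def using ab(1) rel_mset_single[of pair_below "(a, b)"] by auto
  then show "m \<in> (\<Union>k. principal {#(c k, d k)#})" by blast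
next
  fix m assume "m \<in> (\<Union>k. principal {#(c k, d k)#})"
  then obtain k where k: "tprec m {#(c k, d k)#}" unfolding principal_def by blast
  have "tle {#(c k, d k)#} {#(x, y)#}"
    using assms by (intro tle_tstep tstep.mono) (auto intro: has_sup_closed has_sup_upper inc_seq_closed)
  then show "m \<in> principal {#(x, y)#}"
    unfolding principal_def using k tprec_tle by blast
qed

lemma principal_mono: "tle m n \<Longrightarrow> principal m \<subseteq> principal n"
  unfolding principal_def using tprec_tle by blast

text \<open>For a pure tensor, approximating sequences of the two factors give generators, by
  \<open>principal_pair\<close>; sums follow from \<open>principal_union\<close>.\<close>

lemma round_ideal_principal: "m \<in> formal_sums \<Longrightarrow> round_ideal (principal m)"
proof (induction m)
  case empty
  then show ?case
    unfolding principal_def zero_ideal by (intro round_ideal_genseq) (simp add: R_ze)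
next
  case (add p m)
  obtain a b where p: "p = (a, b)" "a \<in> carrier S" "b \<in> carrier T" using add.prems by (cases p) auto
  obtain c where c: "\<forall>n. c n \<lless>\<^bsub>S\<^esub> c (Suc n)" "has_sup S (range c) a" using S.approx_seq[OF p(2)] by blast
  obtain d where d: "\<forall>n. d n \<lless>\<^bsub>T\<^esub> d (Suc n)" "has_sup T (range d) b" using T.approx_seq[OF p(3)] by blast
  have cd: "\<forall>k. tprec {#(c k, d k)#} {#(c (Suc k), d (Suc k))#}"
    using c(1) d(1) by (auto intro!: rel_mset_tprec rel_mset_single)
  have "principal {#p#} = genseq (\<lambda>k. {#(c k, d k)#})"
    unfolding p(1) principal_pair[OF S.way_below_seq_inc[OF c(1)] T.way_below_seq_inc[OF d(1)] c(2) d(2)]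
    by (auto simp: principal_def genseq_def)
  then have "round_ideal (principal {#p#})" using round_ideal_genseq[OF cd] by simp
  then have "round_ideal (principal ({#p#} + m))"
    using add by (subst principal_union) (auto intro: round_ideal_add)
  then show ?case by simp
qed

end

section \<open>The universal property of the tensor product\<close>

context cu_sg
begin

text \<open>
  The guards make the folded operation commutative on the whole type, as \<^const>\<open>fold_mset\<close> requires.
\<close>

definition msum :: "('p \<Rightarrow> 'a) \<Rightarrow> 'p multiset \<Rightarrow> 'a" where
  "msum f = fold_mset (\<lambda>p z. if z \<in> carrier S then (if f p \<in> carrier S then f p else \<zero>) \<oplus> z else z) \<zero>"

lemma msum_empty [simp]: "msum f {#} = \<zero>"
  by (simp add: msum_def)

lemma msum_add_mset': "msum f (add_mset p m) =
    (if msum f m \<in> carrier S then (if f p \<in> carrier S then f p else \<zero>) \<oplus> msum f m else msum f m)"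
proof -
  interpret comp_fun_commute "\<lambda>p z. if z \<in> carrier S then (if f p \<in> carrier S then f p else \<zero>) \<oplus> z else z"
    by standard (auto simp: add_lcomm)
  show ?thesis by (simp add: msum_def)
qed

lemma msum_closed [simp]: "msum f m \<in> carrier S"
  by (induction m) (auto simp: msum_add_mset')

lemma msum_add_mset: "f p \<in> carrier S \<Longrightarrow> msum f (add_mset p m) = f p \<oplus> msum f m"
  by (simp add: msum_add_mset')

lemma msum_union: "\<forall>p\<in>#m. f p \<in> carrier S \<Longrightarrow> msum f (m + n) = msum f m \<oplus> msum f n"
  by (induction m) (auto simp: msum_add_mset add_assoc)

end

context cu_pair
begin

lemma completion_closed: "m \<in> formal_sums \<Longrightarrow> principal m \<in> carrier completion"
  by (simp add: round_ideal_principal)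

lemma principal_add: "m \<in> formal_sums \<Longrightarrow> n \<in> formal_sums \<Longrightarrow>
    principal (m + n) = principal m \<oplus>\<^bsub>completion\<^esub> principal n"
  by (simp add: principal_union)

lemma principal_eq: "tle m n \<Longrightarrow> tle n m \<Longrightarrow> principal m = principal n"
  using principal_mono by blast

lemma principal_bimorphism: "cu_bimorphism S T completion (\<lambda>a b. principal {#(a, b)#})"
proof (rule cu_bimorphismI)
  fix c d x y
  assume *: "inc_seq S c" "inc_seq T d" "has_sup S (range c) x" "has_sup T (range d) y"
  have "principal {#(c n, d n)#} \<subseteq> principal {#(c (Suc n), d (Suc n))#}" for n
    using *(1,2) by (intro principal_mono tle_tstep tstep.mono) (simp_all add: inc_seq_def)
  then show "has_sup completion (range (\<lambda>k. principal {#(c k, d k)#})) (principal {#(x, y)#})"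
    using inc_seq_closed[OF *(1)] inc_seq_closed[OF *(2)]
    by (subst has_sup_completion_iff) (auto simp: principal_pair[OF *] round_ideal_principal)
next
  fix a' a b' b assume *: "a' \<lless>\<^bsub>S\<^esub> a" "b' \<lless>\<^bsub>T\<^esub> b"
  note cl = *[THEN way_below_closed(1)] *[THEN way_below_closed(2)]
  have "{#(a', b')#} \<in> principal {#(a, b)#}"
    unfolding principal_def using * by (simp add: rel_mset_tprec rel_mset_single)
  then show "principal {#(a', b')#} \<lless>\<^bsub>completion\<^esub> principal {#(a, b)#}"
    unfolding way_below_completion using cl by (auto simp: round_ideal_principal) (auto simp: principal_def)
next
  fix b assume "b \<in> carrier T"
  then show "principal {#(\<zero>\<^bsub>S\<^esub>, b)#} = \<zero>\<^bsub>completion\<^esub>"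
    unfolding principal_empty[symmetric] by (intro principal_eq tle_tstep tstep.zero_left1 tstep.zero_left2)
next
  fix a assume "a \<in> carrier S"
  then show "principal {#(a, \<zero>\<^bsub>T\<^esub>)#} = \<zero>\<^bsub>completion\<^esub>"
    unfolding principal_empty[symmetric] by (intro principal_eq tle_tstep tstep.zero_right1 tstep.zero_right2)
next
  fix a a' b assume *: "a \<in> carrier S" "a' \<in> carrier S" "b \<in> carrier T"
  have "principal {#(a \<oplus>\<^bsub>S\<^esub> a', b)#} = principal {#(a, b), (a', b)#}"
    by (intro principal_eq tle_tstep tstep.add_left1 tstep.add_left2 *)
  also have "\<dots> = principal ({#(a, b)#} + {#(a', b)#})"
    by (simp add: add_mset_commute)
  also have "\<dots> = principal {#(a, b)#} \<oplus>\<^bsub>completion\<^esub> principal {#(a', b)#}"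
    by (rule principal_add) (simp_all add: *)
  finally show "principal {#(a \<oplus>\<^bsub>S\<^esub> a', b)#} = principal {#(a, b)#} \<oplus>\<^bsub>completion\<^esub> principal {#(a', b)#}" .
next
  fix a b b' assume *: "a \<in> carrier S" "b \<in> carrier T" "b' \<in> carrier T"
  have "principal {#(a, b \<oplus>\<^bsub>T\<^esub> b')#} = principal {#(a, b), (a, b')#}"
    by (intro principal_eq tle_tstep tstep.add_right1 tstep.add_right2 *)
  also have "\<dots> = principal ({#(a, b)#} + {#(a, b')#})"
    by (simp add: add_mset_commute)
  also have "\<dots> = principal {#(a, b)#} \<oplus>\<^bsub>completion\<^esub> principal {#(a, b')#}"
    by (rule principal_add) (simp_all add: *)
  finally show "principal {#(a, b \<oplus>\<^bsub>T\<^esub> b')#} = principal {#(a, b)#} \<oplus>\<^bsub>completion\<^esub> principal {#(a, b')#}" .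
next
  fix a a' b assume "a \<in> carrier S" "a' \<in> carrier S" "b \<in> carrier T" "a \<sqsubseteq>\<^bsub>S\<^esub> a'"
  then have "principal {#(a, b)#} \<subseteq> principal {#(a', b)#}"
    by (intro principal_mono tle_tstep tstep.mono) auto
  then show "principal {#(a, b)#} \<sqsubseteq>\<^bsub>completion\<^esub> principal {#(a', b)#}" by simp
next
  fix a b b' assume "a \<in> carrier S" "b \<in> carrier T" "b' \<in> carrier T" "b \<sqsubseteq>\<^bsub>T\<^esub> b'"
  then have "principal {#(a, b)#} \<subseteq> principal {#(a, b')#}"
    by (intro principal_mono tle_tstep tstep.mono) auto
  then show "principal {#(a, b)#} \<sqsubseteq>\<^bsub>completion\<^esub> principal {#(a, b')#}" by simp
qed (simp add: round_ideal_principal)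

end

locale cu_bimap = cu_pair S T + P: cu_sg P
  for S :: "('a, 'm) po_semigroup_scheme" and T :: "('b, 'n) po_semigroup_scheme"
    and P :: "('c, 'k) po_semigroup_scheme" +
  fixes \<phi> :: "'a \<Rightarrow> 'b \<Rightarrow> 'c"
  assumes bim: "cu_bimorphism S T P \<phi>"
begin

abbreviation eval_sum :: "('a \<times> 'b) multiset \<Rightarrow> 'c" where
  "eval_sum \<equiv> P.msum (case_prod \<phi>)"

lemma eval_sum_union:
  assumes "m \<in> formal_sums" shows "eval_sum (m + n) = eval_sum m \<oplus>\<^bsub>P\<^esub> eval_sum n"
  using assms by (intro P.msum_union) (auto simp: formal_sums_def cu_bimorphismD(1)[OF bim])

lemma eval_sum_add_mset:
  "a \<in> carrier S \<Longrightarrow> b \<in> carrier T \<Longrightarrow> eval_sum (add_mset (a, b) m) = \<phi> a b \<oplus>\<^bsub>P\<^esub> eval_sum m"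
  by (simp add: P.msum_add_mset cu_bimorphismD(1)[OF bim])

lemma eval_sum_tstep: "tstep x y \<Longrightarrow> eval_sum x \<sqsubseteq>\<^bsub>P\<^esub> eval_sum y"
proof (induction rule: tstep.induct)
  case (mono a a' b b')
  have "\<phi> a b \<sqsubseteq>\<^bsub>P\<^esub> \<phi> a' b" "\<phi> a' b \<sqsubseteq>\<^bsub>P\<^esub> \<phi> a' b'"
    using mono cu_bimorphismD(6,7)[OF bim] by blast+
  then have "\<phi> a b \<sqsubseteq>\<^bsub>P\<^esub> \<phi> a' b'"
    by (rule P.le_trans) (simp_all add: mono cu_bimorphismD(1)[OF bim])
  then show ?case using mono by (simp add: eval_sum_add_mset cu_bimorphismD(1)[OF bim])
qed (simp_all add: eval_sum_add_mset cu_bimorphismD(1-5)[OF bim] P.add_assoc)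

lemma eval_sum_tle: "tle m n \<Longrightarrow> eval_sum m \<sqsubseteq>\<^bsub>P\<^esub> eval_sum n"
proof (induction rule: tle.induct)
  case (step m x k y)
  have "eval_sum (x + k) \<sqsubseteq>\<^bsub>P\<^esub> eval_sum (y + k)"
    using eval_sum_tstep[OF step.hyps(2)] tstep_closed[OF step.hyps(2)]
    by (simp add: eval_sum_union P.add_mono)
  then show ?case using P.le_trans[OF step.IH] by simp
qed simp

lemma eval_sum_rel: "rel_mset pair_below m n \<Longrightarrow> eval_sum m \<lless>\<^bsub>P\<^esub> eval_sum n"
proof (induction rule: rel_mset_inducts)
  case empty
  then show ?case by (simp add: P.zero_way_below)
next
  case (add p q m n)
  then show ?case
    using way_below_closed[of S "fst p" "fst q"] way_below_closed[of T "snd p" "snd q"]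
    by (cases p; cases q) (auto simp: eval_sum_add_mset intro!: P.way_below_add cu_bimorphismD(9)[OF bim])
qed

lemma eval_sum_tprec: "tprec m n \<Longrightarrow> eval_sum m \<lless>\<^bsub>P\<^esub> eval_sum n"
  unfolding tprec_def using eval_sum_tle eval_sum_rel P.way_below_trans_le P.msum_closed by blast

sublocale E: round_monoid_map formal_sums "(+)" "{#}" tprec P eval_sum
  by unfold_locales (simp_all add: eval_sum_union P.way_below_imp_le eval_sum_tprec)

text \<open>A pure tensor need not belong to its own principal ideal. Its value is recovered as a
  limit along approximations of both factors, by the joint continuity of the bimorphism.\<close>

lemma ext_pure:
  assumes "a \<in> carrier S" "b \<in> carrier T"
  shows "E.ext (principal {#(a, b)#}) = \<phi> a b"
proof -
  obtain c where c: "\<forall>n. c n \<lless>\<^bsub>S\<^esub> c (Suc n)" "has_sup S (range c) a" using S.approx_seq[OF assms(1)] by blast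
  obtain d where d: "\<forall>n. d n \<lless>\<^bsub>T\<^esub> d (Suc n)" "has_sup T (range d) b" using T.approx_seq[OF assms(2)] by blast
  note ic = S.way_below_seq_inc[OF c(1)] T.way_below_seq_inc[OF d(1)]
  have cd: "\<forall>k. tprec {#(c k, d k)#} {#(c (Suc k), d (Suc k))#}"
    using c(1) d(1) by (auto intro!: rel_mset_tprec rel_mset_single)
  have *: "principal {#(a, b)#} = genseq (\<lambda>k. {#(c k, d k)#})"
    unfolding principal_pair[OF ic c(2) d(2)] by (auto simp: principal_def genseq_def)
  have "round_ideal (principal {#(a, b)#})" using assms by (simp add: round_ideal_principal)
  then have "has_sup P (eval_sum ` genseq (\<lambda>k. {#(c k, d k)#})) (E.ext (principal {#(a, b)#}))"
    using E.has_sup_ext * by simp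
  then have "has_sup P (range (\<lambda>k. eval_sum {#(c k, d k)#})) (E.ext (principal {#(a, b)#}))"
    by (simp only: E.has_sup_genseq[OF cd])
  then have "has_sup P (range (\<lambda>k. \<phi> (c k) (d k))) (E.ext (principal {#(a, b)#}))"
    using inc_seq_closed[OF ic(1)] inc_seq_closed[OF ic(2)]
    by (simp add: eval_sum_add_mset cu_bimorphismD(1)[OF bim])
  then show ?thesis
    using P.has_sup_unique cu_bimorphismD(8)[OF bim ic c(2) d(2)] by blast
qed

end

context cu_pair
begin

text \<open>The target \<open>P\<close> may live on any type, in contrast to the property that the
  choice in \<open>cu_tensor_pair\<close> guarantees.\<close>

lemma model_lift:
  assumes "cu_semigroup P" "cu_bimorphism S T P \<phi>"
  shows "\<exists>\<alpha>\<in>Cu completion P. \<forall>a\<in>carrier S. \<forall>b\<in>carrier T. \<alpha> (principal {#(a, b)#}) = \<phi> a b"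
proof -
  interpret cu_bimap S T P \<phi> using assms by unfold_locales
  show ?thesis
    by (rule bexI[OF _ E.ext_Cu[OF eval_sum_tprec]]) (simp_all add: ext_pure round_ideal_principal)
qed

text \<open>The inequality extends from pure tensors to formal sums by additivity, and from these to
  any ideal, which is the supremum of the principal ideals of its generators.\<close>

lemma model_order:
  assumes P: "cu_semigroup P" and \<alpha>: "\<alpha> \<in> Cu completion P" and \<beta>: "\<beta> \<in> Cu completion P"
    and le: "\<And>a b. a \<in> carrier S \<Longrightarrow> b \<in> carrier T \<Longrightarrow> \<alpha> (principal {#(a, b)#}) \<sqsubseteq>\<^bsub>P\<^esub> \<beta> (principal {#(a, b)#})"
    and I: "I \<in> carrier completion"
  shows "\<alpha> I \<sqsubseteq>\<^bsub>P\<^esub> \<beta> I"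
proof -
  interpret P: cu_sg P using P by unfold_locales
  note a = gen_CuD[OF Cu_gen[OF \<alpha>]] and b = gen_CuD[OF Cu_gen[OF \<beta>]]
  have pr: "\<alpha> (principal m) \<sqsubseteq>\<^bsub>P\<^esub> \<beta> (principal m)" if "m \<in> formal_sums" for m
    using that
  proof (induction m)
    case empty
    then show ?case unfolding principal_empty by (simp only: a(2) b(2) P.le_refl P.zero_closed)
  next
    case (add p m)
    then have p: "{#p#} \<in> formal_sums" "m \<in> formal_sums" by simp_all
    have "\<alpha> (principal {#p#}) \<sqsubseteq>\<^bsub>P\<^esub> \<beta> (principal {#p#})"
      using le[of "fst p" "snd p"] p(1) by simp
    then have "\<alpha> (principal {#p#}) \<oplus>\<^bsub>P\<^esub> \<alpha> (principal m) \<sqsubseteq>\<^bsub>P\<^esub> \<beta> (principal {#p#}) \<oplus>\<^bsub>P\<^esub> \<beta> (principal m)"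
      by (rule P.add_mono[OF _ add.IH[OF p(2)]]) (intro a(1) b(1) completion_closed p)+
    then have "\<alpha> (principal ({#p#} + m)) \<sqsubseteq>\<^bsub>P\<^esub> \<beta> (principal ({#p#} + m))"
      by (simp only: principal_add[OF p] a(3)[OF completion_closed[OF p(1)] completion_closed[OF p(2)]]
          b(3)[OF completion_closed[OF p(1)] completion_closed[OF p(2)]])
    then show ?case by simp
  qed
  have rI: "round_ideal I" using I by simp
  then obtain c where c: "\<forall>k. tprec (c k) (c (Suc k))" "I = genseq c" by (rule round_idealE)
  have pc: "\<And>k. round_ideal (principal (c k))" "\<And>k. principal (c k) \<subseteq> principal (c (Suc k))"
    using c(1) round_ideal_principal R_M1 unfolding principal_def by (auto intro: R_trans)
  have inc: "inc_seq completion (\<lambda>k. principal (c k))"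
    using pc by (simp add: inc_seq_completion)
  have sup: "has_sup completion (range (\<lambda>k. principal (c k))) I"
    by (subst has_sup_completion_iff[of "\<lambda>k. principal (c k)", OF pc]) (auto simp: c(2) genseq_def principal_def)
  show ?thesis
  proof (rule has_sup_least[OF a(5)[OF inc sup]])
    show "\<beta> I \<in> carrier P" using b(1) I .
    fix z assume "z \<in> range (\<lambda>k. \<alpha> (principal (c k)))"
    then obtain k where z: "z = \<alpha> (principal (c k))" by blast
    show "z \<sqsubseteq>\<^bsub>P\<^esub> \<beta> I"
      unfolding z
    proof (rule P.le_trans)
      show "\<alpha> (principal (c k)) \<sqsubseteq>\<^bsub>P\<^esub> \<beta> (principal (c k))" using pr R_M1 c(1) by blast
      show "\<beta> (principal (c k)) \<sqsubseteq>\<^bsub>P\<^esub> \<beta> I" using has_sup_upper[OF b(5)[OF inc sup]] by blast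
    qed (use a(1) b(1) I pc in auto)
  qed
qed

end

lemma Cu_le_antisym:
  assumes "cu_semigroup P" "\<alpha> \<in> Cu X P" "\<beta> \<in> Cu X P"
    "\<And>z. z \<in> carrier X \<Longrightarrow> \<alpha> z \<sqsubseteq>\<^bsub>P\<^esub> \<beta> z" "\<And>z. z \<in> carrier X \<Longrightarrow> \<beta> z \<sqsubseteq>\<^bsub>P\<^esub> \<alpha> z"
  shows "\<alpha> = \<beta>"
proof (rule gen_Cu_ext[OF Cu_gen[OF assms(2)] Cu_gen[OF assms(3)]])
  interpret cu_sg P using assms(1) by unfold_locales
  fix z assume "z \<in> carrier X"
  then show "\<alpha> z = \<beta> z"
    using assms(4,5) gen_CuD(1)[OF Cu_gen[OF assms(2)]] gen_CuD(1)[OF Cu_gen[OF assms(3)]]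
    by (intro le_antisym) auto
qed

context cu_pair
begin

lemma model_eqI:
  assumes P: "cu_semigroup P" and \<alpha>: "\<alpha> \<in> Cu completion P" and \<beta>: "\<beta> \<in> Cu completion P"
    and eq: "\<And>a b. a \<in> carrier S \<Longrightarrow> b \<in> carrier T \<Longrightarrow> \<alpha> (principal {#(a, b)#}) = \<beta> (principal {#(a, b)#})"
  shows "\<alpha> = \<beta>"
proof -
  interpret P: cu_sg P using P by unfold_locales
  have *: "\<beta> (principal {#(a, b)#}) \<in> carrier P" if "a \<in> carrier S" "b \<in> carrier T" for a b
    using gen_CuD(1)[OF Cu_gen[OF \<beta>]] completion_closed that by simp
  show ?thesis
  proof (rule Cu_le_antisym[OF P \<alpha> \<beta>])
    fix z assume z: "z \<in> carrier completion"
    show "\<alpha> z \<sqsubseteq>\<^bsub>P\<^esub> \<beta> z" by (rule model_order[OF P \<alpha> \<beta> _ z]) (simp add: eq *)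
    show "\<beta> z \<sqsubseteq>\<^bsub>P\<^esub> \<alpha> z" by (rule model_order[OF P \<beta> \<alpha> _ z]) (simp add: eq *)
  qed
qed

text \<open>At the type of sets of formal sums this is the witness that the choice in
  \<open>cu_tensor_pair\<close> needs.\<close>

lemma model_is_cu_tensor:
  "is_cu_tensor TYPE('p) S T completion (\<lambda>a b. principal {#(a, b)#})"
  unfolding is_cu_tensor_def
proof (intro conjI allI impI ballI cu_semigroup_completion principal_bimorphism)
  fix P :: "'p po_semigroup" and \<phi> assume P: "cu_semigroup P"
  interpret P: cu_sg P using P by unfold_locales
  show "\<exists>!\<alpha>. \<alpha> \<in> Cu completion P \<and> (\<forall>a\<in>carrier S. \<forall>b\<in>carrier T. \<alpha> (principal {#(a, b)#}) = \<phi> a b)"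
    if \<phi>: "cu_bimorphism S T P \<phi>"
  proof (rule ex_ex1I)
    show "\<exists>\<alpha>. \<alpha> \<in> Cu completion P \<and> (\<forall>a\<in>carrier S. \<forall>b\<in>carrier T. \<alpha> (principal {#(a, b)#}) = \<phi> a b)"
      using model_lift[OF P \<phi>] by blast
    fix \<alpha> \<beta>
    assume "\<alpha> \<in> Cu completion P \<and> (\<forall>a\<in>carrier S. \<forall>b\<in>carrier T. \<alpha> (principal {#(a, b)#}) = \<phi> a b)"
      "\<beta> \<in> Cu completion P \<and> (\<forall>a\<in>carrier S. \<forall>b\<in>carrier T. \<beta> (principal {#(a, b)#}) = \<phi> a b)"
    then show "\<alpha> = \<beta>"
      by (intro model_eqI[OF P]) auto
  qed
  fix \<alpha> \<beta> assume \<alpha>\<beta>: "\<alpha> \<in> Cu completion P" "\<beta> \<in> Cu completion P"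
  show "(\<forall>z\<in>carrier completion. \<alpha> z \<sqsubseteq>\<^bsub>P\<^esub> \<beta> z) \<longleftrightarrow>
      (\<forall>a\<in>carrier S. \<forall>b\<in>carrier T. \<alpha> (principal {#(a, b)#}) \<sqsubseteq>\<^bsub>P\<^esub> \<beta> (principal {#(a, b)#}))"
    using model_order[OF P \<alpha>\<beta>] completion_closed by auto
qed

lemma cu_tensor: "is_cu_tensor TYPE(('a \<times> 'b) multiset set) S T (cu_tensor S T) (pure_tensor S T)"
proof -
  have "case cu_tensor_pair S T of (X, t) \<Rightarrow> is_cu_tensor TYPE(('a \<times> 'b) multiset set) S T X t"
    unfolding cu_tensor_pair_def by (rule someI[where x = "(completion, \<lambda>a b. principal {#(a, b)#})"]) (simp add: model_is_cu_tensor)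
  then show ?thesis by (simp add: cu_tensor_def pure_tensor_def split_beta)
qed

lemma cu_semigroup_tensor: "cu_semigroup (cu_tensor S T)"
  and pure_tensor_bimorphism: "cu_bimorphism S T (cu_tensor S T) (pure_tensor S T)"
  using cu_tensor unfolding is_cu_tensor_def by blast+

text \<open>The model lives on the very type for which the chosen tensor product is universal, so
  \<open>\<theta>\<close> comes from the choice, \<open>\<theta>'\<close> from the model, and
  uniqueness on that type gives \<open>\<theta>' (\<theta> z) = z\<close>. This one-sided inverse
  suffices to carry lifts and comparisons over to targets on any type.\<close>

lemma tensor_model_iso:
  obtains \<theta> \<theta>' where "\<theta> \<in> Cu (cu_tensor S T) completion" "\<theta>' \<in> Cu completion (cu_tensor S T)"
    "\<And>z. z \<in> carrier (cu_tensor S T) \<Longrightarrow> \<theta>' (\<theta> z) = z"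
    "\<And>a b. a \<in> carrier S \<Longrightarrow> b \<in> carrier T \<Longrightarrow> \<theta> (pure_tensor S T a b) = principal {#(a, b)#}"
    "\<And>a b. a \<in> carrier S \<Longrightarrow> b \<in> carrier T \<Longrightarrow> \<theta>' (principal {#(a, b)#}) = pure_tensor S T a b"
proof -
  let ?X = "cu_tensor S T"
  note t = cu_tensor[unfolded is_cu_tensor_def]
  note pure = cu_bimorphismD(1)[OF pure_tensor_bimorphism]
  have "\<exists>!\<theta>. \<theta> \<in> Cu ?X completion \<and>
      (\<forall>a\<in>carrier S. \<forall>b\<in>carrier T. \<theta> (pure_tensor S T a b) = principal {#(a, b)#})"
    using t cu_semigroup_completion principal_bimorphism by blast
  then obtain \<theta> where \<theta>: "\<theta> \<in> Cu ?X completion"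
    "\<And>a b. a \<in> carrier S \<Longrightarrow> b \<in> carrier T \<Longrightarrow> \<theta> (pure_tensor S T a b) = principal {#(a, b)#}"
    by blast
  obtain \<theta>' where \<theta>': "\<theta>' \<in> Cu completion ?X"
    "\<And>a b. a \<in> carrier S \<Longrightarrow> b \<in> carrier T \<Longrightarrow> \<theta>' (principal {#(a, b)#}) = pure_tensor S T a b"
    using model_lift[OF cu_semigroup_tensor pure_tensor_bimorphism] by blast
  let ?Q = "\<lambda>\<alpha>. \<alpha> \<in> Cu ?X ?X \<and>
    (\<forall>a\<in>carrier S. \<forall>b\<in>carrier T. \<alpha> (pure_tensor S T a b) = pure_tensor S T a b)"
  have ex: "\<exists>!\<alpha>. ?Q \<alpha>"
    using t cu_semigroup_tensor pure_tensor_bimorphism by blast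
  have Q1: "?Q (\<lambda>z\<in>carrier ?X. \<theta>' (\<theta> z))"
    using Cu_comp[OF \<theta>(1) \<theta>'(1) cu_semigroup_tensor] by (simp add: pure \<theta>(2) \<theta>'(2))
  have Q2: "?Q (\<lambda>z\<in>carrier ?X. z)"
    using Cu_id[OF cu_semigroup_tensor] by (simp add: pure)
  have eq: "(\<lambda>z\<in>carrier ?X. \<theta>' (\<theta> z)) = (\<lambda>z\<in>carrier ?X. z)"
    by (rule trans[OF the1_equality[where P = ?Q, OF ex Q1, symmetric] the1_equality[where P = ?Q, OF ex Q2]])
  have "\<theta>' (\<theta> z) = z" if "z \<in> carrier ?X" for z
    using fun_cong[OF eq, of z] that by simp
  then show thesis using that \<theta> \<theta>' by blast
qed

lemma tensor_order:
  assumes P: "cu_semigroup P" and \<alpha>: "\<alpha> \<in> Cu (cu_tensor S T) P" and \<beta>: "\<beta> \<in> Cu (cu_tensor S T) P"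
    and le: "\<And>a b. a \<in> carrier S \<Longrightarrow> b \<in> carrier T \<Longrightarrow> \<alpha> (pure_tensor S T a b) \<sqsubseteq>\<^bsub>P\<^esub> \<beta> (pure_tensor S T a b)"
    and z: "z \<in> carrier (cu_tensor S T)"
  shows "\<alpha> z \<sqsubseteq>\<^bsub>P\<^esub> \<beta> z"
proof -
  obtain \<theta> \<theta>' where \<theta>: "\<theta> \<in> Cu (cu_tensor S T) completion" "\<theta>' \<in> Cu completion (cu_tensor S T)"
    "\<And>z. z \<in> carrier (cu_tensor S T) \<Longrightarrow> \<theta>' (\<theta> z) = z"
    "\<And>a b. a \<in> carrier S \<Longrightarrow> b \<in> carrier T \<Longrightarrow> \<theta>' (principal {#(a, b)#}) = pure_tensor S T a b"
    using tensor_model_iso by metis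
  have \<theta>z: "\<theta> z \<in> carrier completion" using gen_CuD(1)[OF Cu_gen[OF \<theta>(1)] z] .
  have "(\<lambda>I\<in>carrier completion. \<alpha> (\<theta>' I)) (\<theta> z) \<sqsubseteq>\<^bsub>P\<^esub> (\<lambda>I\<in>carrier completion. \<beta> (\<theta>' I)) (\<theta> z)"
    using \<theta>z by (rule model_order[OF P Cu_comp[OF \<theta>(2) \<alpha> cu_semigroup_completion]
        Cu_comp[OF \<theta>(2) \<beta> cu_semigroup_completion], rotated]) (simp add: round_ideal_principal \<theta>(4) le)
  then show ?thesis
    using \<theta>z by (simp only: restrict_apply' \<theta>(3)[OF z])
qed

lemma tensor_eqI:
  assumes P: "cu_semigroup P" and \<alpha>: "\<alpha> \<in> Cu (cu_tensor S T) P" and \<beta>: "\<beta> \<in> Cu (cu_tensor S T) P"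
    and eq: "\<And>a b. a \<in> carrier S \<Longrightarrow> b \<in> carrier T \<Longrightarrow> \<alpha> (pure_tensor S T a b) = \<beta> (pure_tensor S T a b)"
  shows "\<alpha> = \<beta>"
proof -
  interpret P: cu_sg P using P by unfold_locales
  have *: "\<beta> (pure_tensor S T a b) \<in> carrier P" if "a \<in> carrier S" "b \<in> carrier T" for a b
    using gen_CuD(1)[OF Cu_gen[OF \<beta>] cu_bimorphismD(1)[OF pure_tensor_bimorphism that]] .
  show ?thesis
  proof (rule Cu_le_antisym[OF P \<alpha> \<beta>])
    fix z assume z: "z \<in> carrier (cu_tensor S T)"
    show "\<alpha> z \<sqsubseteq>\<^bsub>P\<^esub> \<beta> z" by (rule tensor_order[OF P \<alpha> \<beta> _ z]) (simp add: eq *)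
    show "\<beta> z \<sqsubseteq>\<^bsub>P\<^esub> \<alpha> z" by (rule tensor_order[OF P \<beta> \<alpha> _ z]) (simp add: eq *)
  qed
qed

lemma tensor_lift:
  assumes P: "cu_semigroup P" and \<phi>: "cu_bimorphism S T P \<phi>"
  shows "tensor_lift S T P \<phi> \<in> Cu (cu_tensor S T) P"
    and "a \<in> carrier S \<Longrightarrow> b \<in> carrier T \<Longrightarrow> tensor_lift S T P \<phi> (pure_tensor S T a b) = \<phi> a b"
proof -
  obtain \<theta> where \<theta>: "\<theta> \<in> Cu (cu_tensor S T) completion"
    "\<And>a b. a \<in> carrier S \<Longrightarrow> b \<in> carrier T \<Longrightarrow> \<theta> (pure_tensor S T a b) = principal {#(a, b)#}"
    using tensor_model_iso by metis
  obtain \<alpha> where \<alpha>: "\<alpha> \<in> Cu completion P"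
    "\<And>a b. a \<in> carrier S \<Longrightarrow> b \<in> carrier T \<Longrightarrow> \<alpha> (principal {#(a, b)#}) = \<phi> a b"
    using model_lift[OF P \<phi>] by blast
  let ?Q = "\<lambda>\<alpha>. \<alpha> \<in> Cu (cu_tensor S T) P \<and> (\<forall>a\<in>carrier S. \<forall>b\<in>carrier T. \<alpha> (pure_tensor S T a b) = \<phi> a b)"
  have Q: "?Q (\<lambda>z\<in>carrier (cu_tensor S T). \<alpha> (\<theta> z))"
    using Cu_comp[OF \<theta>(1) \<alpha>(1) cu_semigroup_tensor]
    by (simp add: cu_bimorphismD(1)[OF pure_tensor_bimorphism] \<theta>(2) \<alpha>(2))
  have uniq: "\<beta> = \<gamma>" if "?Q \<beta>" "?Q \<gamma>" for \<beta> \<gamma>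
    using that by (intro tensor_eqI[OF P]) auto
  have "?Q (tensor_lift S T P \<phi>)"
    unfolding tensor_lift_def by (rule theI[where P = ?Q, OF Q]) (rule uniq[OF _ Q])
  then show "tensor_lift S T P \<phi> \<in> Cu (cu_tensor S T) P"
    "a \<in> carrier S \<Longrightarrow> b \<in> carrier T \<Longrightarrow> tensor_lift S T P \<phi> (pure_tensor S T a b) = \<phi> a b"
    by auto
qed

end

section \<open>Rational chains in dense transitive relations\<close>

text \<open>The values at the naturals are prescribed. The remaining nonnegative rationals are
  inserted one at a time, each receiving a value that interpolates between the values at its nearest
  neighbours.\<close>

lemma rational_chain_nonneg:
  fixes R :: "'a \<Rightarrow> 'a \<Rightarrow> bool"
  assumes trans: "\<And>a b c. R a b \<Longrightarrow> R b c \<Longrightarrow> R a c"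
    and dense: "\<And>a c. R a c \<Longrightarrow> \<exists>b. R a b \<and> R b c"
    and x: "\<And>n. R (x n) (x (Suc n))"
  shows "\<exists>h :: rat \<Rightarrow> 'a. (\<forall>p q. 0 \<le> p \<longrightarrow> p < q \<longrightarrow> R (h p) (h q)) \<and> (\<forall>n. h (of_nat n) = x n)"
proof -
  \<comment> \<open>The domain of stage \<open>n\<close>. All naturals belong to every stage, and a
    bounded part of a stage is finite, so nearest neighbours exist.\<close>
  define D :: "nat \<Rightarrow> rat set" where "D n = {p. 0 \<le> p \<and> (p \<in> \<nat> \<or> to_nat p < n)}" for n
  define good where "good n H \<longleftrightarrow> (\<forall>p\<in>D n. \<forall>q\<in>D n. p < q \<longrightarrow> R (H p) (H q)) \<and> (\<forall>k. H (of_nat k) = x k)"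
    for n and H :: "rat \<Rightarrow> 'a"
  have D_mono: "D m \<subseteq> D n" if "m \<le> n" for m n using that by (auto simp: D_def)
  have fin: "finite (D n \<inter> {..u})" for n u
  proof -
    have "D n \<inter> {..u} \<subseteq> of_nat ` {..nat \<lceil>u\<rceil>} \<union> to_nat -` {..<n}"
    proof
      fix p assume p: "p \<in> D n \<inter> {..u}"
      show "p \<in> of_nat ` {..nat \<lceil>u\<rceil>} \<union> to_nat -` {..<n}"
      proof (cases "to_nat p < n")
        case False
        then obtain k where k: "p = of_nat k" using p by (auto simp: D_def elim: Nats_cases)
        then have "k \<le> nat \<lceil>u\<rceil>" using p by (auto simp: nat_le_iff le_nat_iff ceiling_le_iff) linarith
        then show ?thesis using k by blast
      qed auto
    qed
    moreover have "finite (to_nat -` {..<n} :: rat set)" by (rule finite_vimageI) auto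
    ultimately show ?thesis by (meson finite_UnI finite_atMost finite_imageI finite_subset)
  qed
  have step: "\<exists>H'. good (Suc n) H' \<and> (\<forall>p\<in>D n. H' p = H p)" if H: "good n H" for n H
  proof (cases "D (Suc n) \<subseteq> D n")
    case True
    then show ?thesis using H unfolding good_def by blast
  next
    case False
    then obtain q where q: "q \<in> D (Suc n)" "q \<notin> D n" by blast
    then have qn: "to_nat q = n" "q \<notin> \<nat>" "0 \<le> q" by (auto simp: D_def)
    then have "q \<noteq> 0" by auto
    then have q0: "0 < q" using qn by simp
    have Dq: "D (Suc n) = insert q (D n)"
      using q qn by (auto simp: D_def less_Suc_eq)
    define l where "l = Max (D n \<inter> {..q})"
    \<comment> \<open>The bound by the ceiling makes the set finite without changing its minimum:
      the ceiling is a natural number, hence a point of \<open>D n\<close> to the right of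
      \<open>q\<close>.\<close>
    define u where "u = Min (D n \<inter> {..of_int \<lceil>q\<rceil>} \<inter> {q<..})"
    have zero: "0 \<in> D n \<inter> {..q}" using q0 by (simp add: D_def)
    then have l: "l \<in> D n \<inter> {..q}" unfolding l_def by (intro Max_in fin) blast
    have lq: "l < q" using l q(2) by (metis IntD1 IntD2 atMost_iff order_le_less)
    obtain k where "\<lceil>q\<rceil> = int k"
      using q0 by (metis ceiling_mono ceiling_zero order_less_imp_le zero_le_imp_eq_int)
    then have cq: "of_int \<lceil>q\<rceil> \<in> D n"
      by (simp add: D_def)
    have "q < of_int \<lceil>q\<rceil>"
      using cq q(2) le_of_int_ceiling[of q] by (metis order_le_less)
    then have ne: "D n \<inter> {..of_int \<lceil>q\<rceil>} \<inter> {q<..} \<noteq> {}" using cq by blast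
    have finu: "finite (D n \<inter> {..of_int \<lceil>q\<rceil>} \<inter> {q<..})" using fin by blast
    have u: "u \<in> D n" "q < u" using Min_in[OF finu ne] unfolding u_def by auto
    have u_le: "u \<le> p" if "p \<in> D n" "q < p" for p
    proof (cases "p \<le> of_int \<lceil>q\<rceil>")
      case True
      then show ?thesis unfolding u_def using that by (intro Min_le finu) auto
    next
      case False
      have "u \<le> of_int \<lceil>q\<rceil>" using Min_in[OF finu ne] unfolding u_def by auto
      then show ?thesis using False by simp
    qed
    have l_ge: "p \<le> l" if "p \<in> D n" "p < q" for p
      unfolding l_def using that by (intro Max_ge fin) auto
    have "R (H l) (H u)" using H l u lq unfolding good_def by auto
    then obtain y where y: "R (H l) y" "R y (H u)" using dense by blast
    have low: "R (H p) y" if "p \<in> D n" "p < q" for p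
      using l_ge[OF that] H l that y(1) trans unfolding good_def by (metis IntD1 order_le_less)
    have up: "R y (H p)" if "p \<in> D n" "q < p" for p
      using u_le[OF that] H u that y(2) trans unfolding good_def by (metis order_le_less)
    have "good (Suc n) (H(q := y))"
      unfolding good_def
    proof (intro conjI ballI allI impI)
      fix p p' assume "p \<in> D (Suc n)" "p' \<in> D (Suc n)" "p < p'"
      then show "R ((H(q := y)) p) ((H(q := y)) p')"
        unfolding Dq using low up H unfolding good_def by auto
    next
      fix k show "(H(q := y)) (of_nat k) = x k"
        using H qn(2) unfolding good_def by auto
    qed
    moreover have "\<forall>p\<in>D n. (H(q := y)) p = H p" using q(2) by auto
    ultimately show ?thesis by blast
  qed
  have chain: "R (x i) (x j)" if "i < j" for i j
    using that x trans by (induction j) (auto simp: less_Suc_eq)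
  \<comment> \<open>Stage 0 consists of the naturals alone; the floor is a default value for all
    other points.\<close>
  have "good 0 (\<lambda>p. x (nat \<lfloor>p\<rfloor>))"
    unfolding good_def by (auto simp: D_def elim!: Nats_cases intro!: chain)
  then obtain H where H: "\<And>n. good n (H n)" "\<And>n p. p \<in> D n \<Longrightarrow> H (Suc n) p = H n p"
    using dependent_nat_choice[of good "\<lambda>n H H'. \<forall>p\<in>D n. H' p = H p"] step by metis
  have stable: "H n p = H m p" if "m \<le> n" "p \<in> D m" for m n p
    using that
  proof (induction n)
    case (Suc n)
    show ?case
    proof (cases "m = Suc n")
      case False
      then have "m \<le> n" using Suc.prems by simp
      then show ?thesis using Suc H(2)[of p n] D_mono[of m n] by auto
    qed simp
  qed simp
  \<comment> \<open>At stage \<open>Suc (to_nat p)\<close> a nonnegative \<open>p\<close> has been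
    inserted, and later stages leave its value alone.\<close>
  define h where "h p = H (Suc (to_nat p)) p" for p
  have h: "h p = H n p" if "0 \<le> p" "to_nat p < n" for p n
    unfolding h_def using that stable[of "Suc (to_nat p)" n p] by (auto simp: D_def)
  have "R (h p) (h q)" if "0 \<le> p" "p < q" for p q
    using H(1)[of "Suc (to_nat p + to_nat q)"] that h[of p "Suc (to_nat p + to_nat q)"] h[of q "Suc (to_nat p + to_nat q)"]
    unfolding good_def by (auto simp: D_def)
  moreover have "h (of_nat n) = x n" for n
    using H(1) unfolding h_def good_def by blast
  ultimately show ?thesis by blast
qed

lemma rational_chain:
  fixes R :: "'a \<Rightarrow> 'a \<Rightarrow> bool"
  assumes trans: "\<And>a b c. R a b \<Longrightarrow> R b c \<Longrightarrow> R a c"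
    and dense: "\<And>a c. R a c \<Longrightarrow> \<exists>b. R a b \<and> R b c"
    and x: "\<And>n. R (x n) (x (Suc n))"
  shows "\<exists>h :: rat \<Rightarrow> 'a. (\<forall>p\<in>I_Q. \<forall>q\<in>I_Q. p < q \<longrightarrow> R (h p) (h q)) \<and>
    (\<forall>n. \<exists>q\<in>I_Q. R (x n) (h q)) \<and> (\<forall>q\<in>I_Q. \<exists>n. R (h q) (x n))"
proof -
  have "\<exists>h :: rat \<Rightarrow> 'a. (\<forall>p q. 0 \<le> p \<longrightarrow> p < q \<longrightarrow> R (h p) (h q)) \<and> (\<forall>n. h (of_nat n) = x n)"
    by (rule rational_chain_nonneg; fact assms)
  then obtain h :: "rat \<Rightarrow> 'a" where h: "\<And>p q. 0 \<le> p \<Longrightarrow> p < q \<Longrightarrow> R (h p) (h q)" "\<And>n. h (of_nat n) = x n"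
    by blast
  \<comment> \<open>An order isomorphism from the open unit interval onto the positive rationals, so
    that the prescribed values become cofinal.\<close>
  define t :: "rat \<Rightarrow> rat" where "t q = q / (1 - q)" for q
  have t_mono: "0 \<le> t p \<and> t p < t q" if "p \<in> I_Q" "q \<in> I_Q" "p < q" for p q
    using that by (auto simp: t_def divide_simps algebra_simps)
  have "\<exists>q\<in>I_Q. R (x n) (h (t q))" for n
  proof (rule bexI)
    \<comment> \<open>The preimage of \<open>n + 1\<close> under \<open>t\<close>; the shift by one
      makes the relation to \<open>x n\<close> strict.\<close>
    let ?q = "(of_nat n + 1) / (of_nat n + 2) :: rat"
    have "t ?q = of_nat n + 1" by (simp add: t_def divide_simps)
    then show "R (x n) (h (t ?q))" using h(1)[of "of_nat n" "of_nat n + 1"] h(2)[of n] by simp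
    show "?q \<in> I_Q" by (simp add: divide_simps)
  qed
  moreover have "\<exists>n. R (h (t q)) (x n)" if "q \<in> I_Q" for q
  proof -
    obtain n where "t q < of_nat n" using reals_Archimedean2 by blast
    moreover have "0 \<le> t q" using that by (simp add: t_def)
    ultimately show ?thesis using h by metis
  qed
  ultimately show ?thesis
    using t_mono h(1) by (intro exI[of _ "\<lambda>q. h (t q)"]) blast
qed

section \<open>The internal hom as a completion\<close>

locale cu_hom = S: cu_sg S + T: cu_sg T
  for S :: "('a, 'm) po_semigroup_scheme" and T :: "('b, 'n) po_semigroup_scheme"
begin

text \<open>
  The relation \<^const>\<open>hom_prec\<close> need not be dense.  Paths see only its largest dense subrelation,
  which is transitive and is the relation along which \<open>Cu[S,T]\<close> is completed.
\<close>

definition dprec :: "('a \<Rightarrow> 'b) \<Rightarrow> ('a \<Rightarrow> 'b) \<Rightarrow> bool" where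
  "dprec \<phi> \<psi> \<longleftrightarrow> (\<exists>D. D \<phi> \<psi> \<and> (\<forall>\<alpha> \<beta>. D \<alpha> \<beta> \<longrightarrow> \<alpha> \<in> gen_Cu S T \<and> \<beta> \<in> gen_Cu S T \<and>
     hom_prec S T \<alpha> \<beta> \<and> (\<exists>\<chi>. D \<alpha> \<chi> \<and> D \<chi> \<beta>)))"

definition hom_add :: "('a \<Rightarrow> 'b) \<Rightarrow> ('a \<Rightarrow> 'b) \<Rightarrow> 'a \<Rightarrow> 'b" where
  "hom_add \<phi> \<psi> = (\<lambda>a\<in>carrier S. \<phi> a \<oplus>\<^bsub>T\<^esub> \<psi> a)"

definition hom_zero :: "'a \<Rightarrow> 'b" where
  "hom_zero = (\<lambda>a\<in>carrier S. \<zero>\<^bsub>T\<^esub>)"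

text \<open>The coinduction rule for the largest interpolating part of \<open>hom_prec\<close>: any
  interpolating family \<open>D\<close> inside it is contained in \<open>dprec\<close>.\<close>

lemma dprecI:
  assumes "D \<phi> \<psi>"
    and "\<And>\<phi> \<psi>. D \<phi> \<psi> \<Longrightarrow> \<phi> \<in> gen_Cu S T \<and> \<psi> \<in> gen_Cu S T \<and> hom_prec S T \<phi> \<psi>"
    and "\<And>\<phi> \<psi>. D \<phi> \<psi> \<Longrightarrow> \<exists>\<chi>. D \<phi> \<chi> \<and> D \<chi> \<psi>"
  shows "dprec \<phi> \<psi>"
  unfolding dprec_def using assms by (intro exI[of _ D]) simp

lemma dprecD:
  assumes "dprec \<phi> \<psi>"
  shows "\<phi> \<in> gen_Cu S T" "\<psi> \<in> gen_Cu S T" "hom_prec S T \<phi> \<psi>" "\<exists>\<chi>. dprec \<phi> \<chi> \<and> dprec \<chi> \<psi>"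
proof -
  obtain D where D: "D \<phi> \<psi>" "\<And>\<alpha> \<beta>. D \<alpha> \<beta> \<Longrightarrow> \<alpha> \<in> gen_Cu S T \<and> \<beta> \<in> gen_Cu S T \<and>
     hom_prec S T \<alpha> \<beta> \<and> (\<exists>\<chi>. D \<alpha> \<chi> \<and> D \<chi> \<beta>)"
    using assms unfolding dprec_def by blast
  then show "\<phi> \<in> gen_Cu S T" "\<psi> \<in> gen_Cu S T" "hom_prec S T \<phi> \<psi>" by simp_all
  have "dprec \<alpha> \<beta>" if "D \<alpha> \<beta>" for \<alpha> \<beta>
    by (rule dprecI[of D, OF that]) (use D(2) in simp_all)
  then show "\<exists>\<chi>. dprec \<phi> \<chi> \<and> dprec \<chi> \<psi>" using D by blast
qed

lemma hom_prec_trans: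
  assumes "hom_prec S T \<phi> \<psi>" "hom_prec S T \<psi> \<chi>" shows "hom_prec S T \<phi> \<chi>"
  unfolding hom_prec_def
proof (intro allI impI)
  fix a' a assume "a' \<lless>\<^bsub>S\<^esub> a"
  then obtain b where "a' \<lless>\<^bsub>S\<^esub> b" "b \<lless>\<^bsub>S\<^esub> a" by (rule S.way_below_interp)
  then have "\<phi> a' \<lless>\<^bsub>T\<^esub> \<psi> b" "\<psi> b \<lless>\<^bsub>T\<^esub> \<chi> a" using assms unfolding hom_prec_def by blast+
  then show "\<phi> a' \<lless>\<^bsub>T\<^esub> \<chi> a" by (rule T.way_below_trans)
qed

lemma hom_prec_le:
  assumes "hom_prec S T \<phi> \<psi>" "\<phi> \<in> gen_Cu S T" "\<psi> \<in> gen_Cu S T" "a \<in> carrier S"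
  shows "\<phi> a \<sqsubseteq>\<^bsub>T\<^esub> \<psi> a"
proof -
  obtain c where c: "\<forall>n. c n \<lless>\<^bsub>S\<^esub> c (Suc n)" "has_sup S (range c) a" using S.approx_seq[OF assms(4)] by blast
  have "\<phi> (c n) \<sqsubseteq>\<^bsub>T\<^esub> \<psi> a" for n
    using assms(1) S.approx_way_below[OF c] unfolding hom_prec_def by (blast intro: T.way_below_imp_le)
  then show ?thesis
    using has_sup_least[OF gen_CuD(5)[OF assms(2) S.way_below_seq_inc[OF c(1)] c(2)] gen_CuD(1)[OF assms(3,4)]]
    by blast
qed

lemma hom_prec_le_trans:
  assumes "hom_prec S T \<phi> \<psi>" "\<And>a. a \<in> carrier S \<Longrightarrow> \<psi> a \<sqsubseteq>\<^bsub>T\<^esub> \<chi> a" "\<chi> \<in> gen_Cu S T"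
  shows "hom_prec S T \<phi> \<chi>"
  unfolding hom_prec_def
proof (intro allI impI)
  fix a' a assume a: "a' \<lless>\<^bsub>S\<^esub> a"
  note aS = way_below_closed(2)[OF a]
  have "\<phi> a' \<lless>\<^bsub>T\<^esub> \<psi> a" using assms(1) a unfolding hom_prec_def by blast
  then show "\<phi> a' \<lless>\<^bsub>T\<^esub> \<chi> a"
    by (rule T.le_trans_way_below[OF _ assms(2)[OF aS] gen_CuD(1)[OF assms(3) aS]])
qed

text \<open>Composite pairs are adjoined to \<open>dprec\<close>; each of them is interpolated by
  its own middle map.\<close>

lemma dprec_trans: "dprec \<phi> \<psi> \<Longrightarrow> dprec \<psi> \<chi> \<Longrightarrow> dprec \<phi> \<chi>"
proof -
  assume *: "dprec \<phi> \<psi>" "dprec \<psi> \<chi>"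
  let ?D = "\<lambda>\<phi> \<chi>. dprec \<phi> \<chi> \<or> (\<exists>\<psi>. dprec \<phi> \<psi> \<and> dprec \<psi> \<chi>)"
  show ?thesis
  proof (rule dprecI[of ?D])
    show "?D \<phi> \<psi> \<Longrightarrow> \<phi> \<in> gen_Cu S T \<and> \<psi> \<in> gen_Cu S T \<and> hom_prec S T \<phi> \<psi>" for \<phi> \<psi>
      using dprecD(1)[of \<phi>] dprecD(2)[of _ \<psi>] dprecD(3)[of \<phi>] dprecD(3)[of _ \<psi>] hom_prec_trans[of \<phi> _ \<psi>]
      by blast
    show "\<And>\<phi> \<psi>. ?D \<phi> \<psi> \<Longrightarrow> \<exists>\<chi>. ?D \<phi> \<chi> \<and> ?D \<chi> \<psi>"
      using dprecD(4) by blast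
  qed (use * in blast)
qed

text \<open>Interpolation of the left factor is enough: the interpolant is related to
  \<open>\<chi>\<close> by a composite of the same shape.\<close>

lemma dprec_hom_prec:
  assumes "dprec \<phi> \<psi>" "hom_prec S T \<psi> \<chi>" "\<chi> \<in> gen_Cu S T" shows "dprec \<phi> \<chi>"
proof -
  let ?D = "\<lambda>\<phi> \<chi>. dprec \<phi> \<chi> \<or> (\<exists>\<psi>. dprec \<phi> \<psi> \<and> hom_prec S T \<psi> \<chi> \<and> \<chi> \<in> gen_Cu S T)"
  show ?thesis
  proof (rule dprecI[of ?D])
    show "?D \<phi> \<psi> \<Longrightarrow> \<phi> \<in> gen_Cu S T \<and> \<psi> \<in> gen_Cu S T \<and> hom_prec S T \<phi> \<psi>" for \<phi> \<psi>
      using dprecD(1)[of \<phi>] dprecD(2)[of _ \<psi>] dprecD(3)[of \<phi>] dprecD(3)[of _ \<psi>] hom_prec_trans[of \<phi> _ \<psi>]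
      by blast
    show "\<And>\<phi> \<psi>. ?D \<phi> \<psi> \<Longrightarrow> \<exists>\<chi>. ?D \<phi> \<chi> \<and> ?D \<chi> \<psi>"
      using dprecD(4) by blast
  qed (use assms in blast)
qed

text \<open>Interpolating first sets aside a factor of \<open>hom_prec\<close> that absorbs the
  pointwise inequality. Pointwise comparisons of endpoints return to \<open>dprec\<close> through
  this.\<close>

lemma dprec_le_trans:
  assumes "dprec \<phi> \<psi>" "\<And>a. a \<in> carrier S \<Longrightarrow> \<psi> a \<sqsubseteq>\<^bsub>T\<^esub> \<chi> a" "\<chi> \<in> gen_Cu S T"
  shows "dprec \<phi> \<chi>"
proof -
  obtain \<psi>' where "dprec \<phi> \<psi>'" "dprec \<psi>' \<psi>" using dprecD(4)[OF assms(1)] by blast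
  then show ?thesis
    using dprec_hom_prec hom_prec_le_trans[OF dprecD(3) assms(2,3)] assms(3) by blast
qed

lemma hom_add_closed:
  assumes "\<phi> \<in> gen_Cu S T" "\<psi> \<in> gen_Cu S T" shows "hom_add \<phi> \<psi> \<in> gen_Cu S T"
  unfolding hom_add_def
proof (rule gen_Cu_restrictI[OF _ _ _ _ _ S.cu])
  note p = gen_CuD[OF assms(1)] and q = gen_CuD[OF assms(2)]
  fix a b assume ab: "a \<in> carrier S" "b \<in> carrier S"
  show "\<phi> (a \<oplus>\<^bsub>S\<^esub> b) \<oplus>\<^bsub>T\<^esub> \<psi> (a \<oplus>\<^bsub>S\<^esub> b) = \<phi> a \<oplus>\<^bsub>T\<^esub> \<psi> a \<oplus>\<^bsub>T\<^esub> (\<phi> b \<oplus>\<^bsub>T\<^esub> \<psi> b)"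
    by (simp add: ab p(1,3) q(1,3) T.add_assoc T.add_lcomm)
  show "a \<sqsubseteq>\<^bsub>S\<^esub> b \<Longrightarrow> \<phi> a \<oplus>\<^bsub>T\<^esub> \<psi> a \<sqsubseteq>\<^bsub>T\<^esub> \<phi> b \<oplus>\<^bsub>T\<^esub> \<psi> b"
    by (rule T.add_mono) (simp_all add: ab p(1,4) q(1,4))
next
  fix c x assume c: "inc_seq S c" "has_sup S (range c) x"
  show "has_sup T (range (\<lambda>n. \<phi> (c n) \<oplus>\<^bsub>T\<^esub> \<psi> (c n))) (\<phi> x \<oplus>\<^bsub>T\<^esub> \<psi> x)"
    by (intro T.has_sup_add gen_Cu_inc_seq[OF assms(1) c(1)] gen_Cu_inc_seq[OF assms(2) c(1)]
        gen_CuD(5)[OF assms(1) c] gen_CuD(5)[OF assms(2) c])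
qed (simp_all add: gen_CuD(1,2)[OF assms(1)] gen_CuD(1,2)[OF assms(2)])

lemma hom_zero_closed: "hom_zero \<in> gen_Cu S T"
  unfolding hom_zero_def by (rule gen_Cu_restrictI[OF _ _ _ _ _ S.cu]) (use T.has_sup_const[OF T.zero_closed] in simp_all)

text \<open>Being coinductive, \<open>dprec\<close> requires an interpolating family for each law:
  sums of related pairs for addition, and for zero the pairs whose first entry is
  \<open>hom_zero\<close>, which is its own interpolant.\<close>

sublocale H: round_monoid "gen_Cu S T" hom_add hom_zero dprec
proof
  show "dprec a c \<Longrightarrow> \<exists>b. dprec a b \<and> dprec b c" for a c by (rule dprecD(4))
  show "dprec (hom_add a' b') (hom_add a b)" if *: "dprec a' a" "dprec b' b" for a' a b' b
  proof -
    let ?D = "\<lambda>\<phi> \<psi>. \<exists>a' a b' b. \<phi> = hom_add a' b' \<and> \<psi> = hom_add a b \<and> dprec a' a \<and> dprec b' b"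
    show ?thesis
    proof (rule dprecI[of ?D])
      fix \<phi> \<psi> assume "?D \<phi> \<psi>"
      then obtain a' a b' b where ab: "\<phi> = hom_add a' b'" "\<psi> = hom_add a b" "dprec a' a" "dprec b' b" by blast
      have "hom_prec S T \<phi> \<psi>"
        unfolding hom_prec_def
      proof (intro allI impI)
        fix x' x assume x: "x' \<lless>\<^bsub>S\<^esub> x"
        have "a' x' \<oplus>\<^bsub>T\<^esub> b' x' \<lless>\<^bsub>T\<^esub> a x \<oplus>\<^bsub>T\<^esub> b x"
          using dprecD(3)[OF ab(3)] dprecD(3)[OF ab(4)] x unfolding hom_prec_def by (intro T.way_below_add) blast+
        then show "\<phi> x' \<lless>\<^bsub>T\<^esub> \<psi> x"
          by (simp add: ab(1,2) hom_add_def way_below_closed[OF x])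
      qed
      then show "\<phi> \<in> gen_Cu S T \<and> \<psi> \<in> gen_Cu S T \<and> hom_prec S T \<phi> \<psi>"
        using ab dprecD(1,2) hom_add_closed by blast
      show "\<exists>\<chi>. ?D \<phi> \<chi> \<and> ?D \<chi> \<psi>"
        using ab dprecD(4)[OF ab(3)] dprecD(4)[OF ab(4)] by metis
    qed (use * in blast)
  qed
  show "dprec hom_zero a" if a: "a \<in> gen_Cu S T" for a
  proof (rule dprecI[of "\<lambda>\<phi> \<psi>. \<phi> = hom_zero \<and> \<psi> \<in> gen_Cu S T"])
    fix \<phi> \<psi> assume *: "\<phi> = hom_zero \<and> \<psi> \<in> gen_Cu S T"
    have "hom_zero x' \<lless>\<^bsub>T\<^esub> \<psi> x" if x: "x' \<lless>\<^bsub>S\<^esub> x" for x' x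
      using T.zero_way_below[OF gen_CuD(1)[OF conjunct2[OF *] way_below_closed(2)[OF x]]]
      by (simp add: hom_zero_def way_below_closed[OF x])
    then show "\<phi> \<in> gen_Cu S T \<and> \<psi> \<in> gen_Cu S T \<and> hom_prec S T \<phi> \<psi>"
      using hom_zero_closed * unfolding hom_prec_def by simp
  qed (use a hom_zero_closed in blast)+
  fix a b c assume *: "a \<in> gen_Cu S T" "b \<in> gen_Cu S T" "c \<in> gen_Cu S T"
  note cl = *[THEN gen_CuD(1)]
  show "hom_add (hom_add a b) c = hom_add a (hom_add b c)"
    unfolding hom_add_def by (rule restrict_ext) (simp add: cl T.add_assoc)
next
  fix a b assume *: "a \<in> gen_Cu S T" "b \<in> gen_Cu S T"
  note cl = *[THEN gen_CuD(1)]
  show "hom_add a b = hom_add b a"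
    unfolding hom_add_def by (rule restrict_ext) (simp add: cl T.add_comm)
  show "hom_add a hom_zero = a"
    by (rule gen_Cu_ext[OF hom_add_closed[OF *(1) hom_zero_closed] *(1)])
      (simp add: hom_add_def hom_zero_def cl)
qed (auto intro: dprecD(1,2) dprec_trans hom_add_closed hom_zero_closed)

abbreviation completion :: "('a \<Rightarrow> 'b) set po_semigroup" where
  "completion \<equiv> H.completion"

section \<open>Paths as round ideals of generalized Cu-morphisms\<close>

definition path_ideal :: "(rat \<Rightarrow> 'a \<Rightarrow> 'b) \<Rightarrow> ('a \<Rightarrow> 'b) set" where
  "path_ideal f = {\<psi>. \<exists>\<nu>\<in>I_Q. dprec \<psi> (f \<nu>)}"

text \<open>All representatives of a class have the same ideal, so the union avoids choosing
  one.\<close>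

definition class_ideal :: "(rat \<Rightarrow> 'a \<Rightarrow> 'b) set \<Rightarrow> ('a \<Rightarrow> 'b) set" where
  "class_ideal x = (\<Union>f\<in>x. path_ideal f)"

lemma I_Q_greater: "\<nu> \<in> I_Q \<Longrightarrow> \<exists>\<mu>\<in>I_Q. \<nu> < (\<mu> :: rat)"
  using dense[of \<nu> 1] by auto

lemma pathsD:
  assumes "f \<in> paths S T"
  shows "\<nu> \<in> I_Q \<Longrightarrow> f \<nu> \<in> gen_Cu S T"
    and "\<kappa> \<in> I_Q \<Longrightarrow> \<nu> \<in> I_Q \<Longrightarrow> \<kappa> < \<nu> \<Longrightarrow> hom_prec S T (f \<kappa>) (f \<nu>)"
  using assms unfolding paths_def by auto

text \<open>The pairs taken from the path itself are an interpolating family, because the rationals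
  are dense.\<close>

lemma path_dprec:
  assumes f: "f \<in> paths S T" and \<nu>: "\<kappa> \<in> I_Q" "\<nu> \<in> I_Q" "\<kappa> < \<nu>"
  shows "dprec (f \<kappa>) (f \<nu>)"
proof (rule dprecI[of "\<lambda>\<phi> \<psi>. \<exists>\<kappa>\<in>I_Q. \<exists>\<nu>\<in>I_Q. \<kappa> < \<nu> \<and> \<phi> = f \<kappa> \<and> \<psi> = f \<nu>"])
  fix \<phi> \<psi> assume "\<exists>\<kappa>\<in>I_Q. \<exists>\<nu>\<in>I_Q. \<kappa> < \<nu> \<and> \<phi> = f \<kappa> \<and> \<psi> = f \<nu>"
  then obtain \<kappa> \<nu> where *: "\<kappa> \<in> I_Q" "\<nu> \<in> I_Q" "\<kappa> < \<nu>" "\<phi> = f \<kappa>" "\<psi> = f \<nu>" by blast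
  then show "\<phi> \<in> gen_Cu S T \<and> \<psi> \<in> gen_Cu S T \<and> hom_prec S T \<phi> \<psi>"
    using pathsD[OF f] by blast
  obtain \<mu> where \<mu>: "\<kappa> < \<mu>" "\<mu> < \<nu>" using dense[OF *(3)] by blast
  moreover have "\<mu> \<in> I_Q" using \<mu> * by auto
  ultimately show "\<exists>\<chi>. (\<exists>\<kappa>\<in>I_Q. \<exists>\<nu>\<in>I_Q. \<kappa> < \<nu> \<and> \<phi> = f \<kappa> \<and> \<chi> = f \<nu>) \<and>
      (\<exists>\<kappa>\<in>I_Q. \<exists>\<nu>\<in>I_Q. \<kappa> < \<nu> \<and> \<chi> = f \<kappa> \<and> \<psi> = f \<nu>)"
    using * by blast
qed (use \<nu> in blast)

lemma path_mem_ideal: "f \<in> paths S T \<Longrightarrow> \<nu> \<in> I_Q \<Longrightarrow> f \<nu> \<in> path_ideal f"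
  unfolding path_ideal_def using I_Q_greater path_dprec by blast

text \<open>A strictly increasing sequence tending to 1; the summand 2 keeps its first term
  positive. It turns a path into a generating sequence.\<close>

definition cofinal_rat :: "nat \<Rightarrow> rat" where
  "cofinal_rat k = 1 - 1 / (of_nat k + 2)"

lemma cofinal_rat: "cofinal_rat k \<in> I_Q" "cofinal_rat k < cofinal_rat (Suc k)"
  by (simp_all add: cofinal_rat_def divide_simps) (simp add: algebra_simps)

lemma cofinal_rat_cofinal:
  assumes "\<nu> \<in> I_Q" shows "\<exists>k. \<nu> < cofinal_rat k"
proof -
  obtain k where "1 / (1 - \<nu>) < of_nat k" using reals_Archimedean2 by blast
  then have "\<nu> < cofinal_rat k"
    using assms by (simp add: cofinal_rat_def divide_simps) (simp add: algebra_simps)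
  then show ?thesis ..
qed

lemma path_ideal_genseq:
  assumes f: "f \<in> paths S T"
  shows "path_ideal f = H.genseq (\<lambda>k. f (cofinal_rat k))"
  unfolding path_ideal_def H.genseq_def
  using cofinal_rat(1) cofinal_rat_cofinal path_dprec[OF f] dprec_trans by blast

lemma path_chain: "f \<in> paths S T \<Longrightarrow> \<forall>k. dprec (f (cofinal_rat k)) (f (cofinal_rat (Suc k)))"
  using path_dprec cofinal_rat by blast

lemma round_path_ideal: "f \<in> paths S T \<Longrightarrow> H.round_ideal (path_ideal f)"
  unfolding path_ideal_genseq using path_chain by (intro H.round_ideal_genseq)

text \<open>\<open>path_le\<close> asks only for \<open>hom_prec\<close>, but a member of the ideal
  is already \<open>dprec\<close>-below the path, and \<open>dprec_hom_prec\<close> absorbs the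
  weaker step. Conversely, a path lies in its own ideal.\<close>

lemma path_le_iff:
  assumes f: "f \<in> paths S T" and g: "g \<in> paths S T"
  shows "path_le S T f g \<longleftrightarrow> path_ideal f \<subseteq> path_ideal g"
proof
  assume le: "path_le S T f g"
  show "path_ideal f \<subseteq> path_ideal g"
  proof
    fix \<psi> assume "\<psi> \<in> path_ideal f"
    then obtain \<nu> where \<nu>: "\<nu> \<in> I_Q" "dprec \<psi> (f \<nu>)" unfolding path_ideal_def by blast
    then obtain \<mu> where \<mu>: "\<mu> \<in> I_Q" "hom_prec S T (f \<nu>) (g \<mu>)" using le unfolding path_le_def by blast
    then have "dprec \<psi> (g \<mu>)" using dprec_hom_prec[OF \<nu>(2)] pathsD(1)[OF g] by blast
    then show "\<psi> \<in> path_ideal g" unfolding path_ideal_def using \<mu>(1) by blast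
  qed
next
  assume "path_ideal f \<subseteq> path_ideal g"
  then show "path_le S T f g"
    unfolding path_le_def using path_mem_ideal[OF f] dprecD(3) unfolding path_ideal_def by blast
qed

lemma path_equiv_iff: "(f, g) \<in> path_equiv S T \<longleftrightarrow> f \<in> paths S T \<and> g \<in> paths S T \<and> path_ideal f = path_ideal g"
  unfolding path_equiv_def using path_le_iff by auto

lemma path_class_iff: "f \<in> paths S T \<Longrightarrow> g \<in> path_class S T f \<longleftrightarrow> g \<in> paths S T \<and> path_ideal f = path_ideal g"
  unfolding path_class_def by (auto simp: path_equiv_iff)

lemma ihom_simps:
  "carrier (ihom S T) = paths S T // path_equiv S T" "eq (ihom S T) = (=)"
  "x \<sqsubseteq>\<^bsub>ihom S T\<^esub> y \<longleftrightarrow> (\<exists>f\<in>x. \<exists>g\<in>y. path_le S T f g)"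
  "x \<oplus>\<^bsub>ihom S T\<^esub> y = (\<Union>f\<in>x. \<Union>g\<in>y. path_class S T (path_add S T f g))"
  "\<zero>\<^bsub>ihom S T\<^esub> = const_class S T hom_zero"
  by (simp_all add: ihom_def hom_zero_def)

lemma ihom_carrier: "x \<in> carrier (ihom S T) \<longleftrightarrow> (\<exists>f\<in>paths S T. x = path_class S T f)"
  by (auto simp: ihom_simps quotient_def path_class_def)

lemma class_ideal: "f \<in> paths S T \<Longrightarrow> class_ideal (path_class S T f) = path_ideal f"
  unfolding class_ideal_def by (auto simp: path_class_iff)

lemma path_class_eq: "f \<in> paths S T \<Longrightarrow> g \<in> paths S T \<Longrightarrow> path_ideal f = path_ideal g \<Longrightarrow> path_class S T f = path_class S T g"
  using path_class_iff by blast

lemma path_add_closed: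
  assumes f: "f \<in> paths S T" and g: "g \<in> paths S T"
  shows "path_add S T f g \<in> paths S T"
    and "path_ideal (path_add S T f g) = H.ideal_add (path_ideal f) (path_ideal g)"
proof -
  have eq: "path_add S T f g \<nu> = hom_add (f \<nu>) (g \<nu>)" if "\<nu> \<in> I_Q" for \<nu>
    using that by (simp add: path_add_def hom_add_def)
  have "hom_prec S T (path_add S T f g \<kappa>) (path_add S T f g \<nu>)" if "\<kappa> \<in> I_Q" "\<nu> \<in> I_Q" "\<kappa> < \<nu>" for \<kappa> \<nu>
    unfolding eq[OF that(1)] eq[OF that(2)]
    by (intro dprecD(3) H.R_ad path_dprec[OF f] path_dprec[OF g] that)
  then show p: "path_add S T f g \<in> paths S T"
    unfolding paths_def using eq hom_add_closed[OF pathsD(1)[OF f] pathsD(1)[OF g]]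
    by (auto simp: path_add_def extensional_def)
  show "path_ideal (path_add S T f g) = H.ideal_add (path_ideal f) (path_ideal g)"
    unfolding path_ideal_genseq[OF p] path_ideal_genseq[OF f] path_ideal_genseq[OF g]
      H.round_ideal_add_seq[OF path_chain[OF f] path_chain[OF g]]
    by (simp only: eq[OF cofinal_rat(1)])
qed

lemma const_path: "\<phi> \<in> gen_Cu S T \<Longrightarrow> hom_prec S T \<phi> \<phi> \<Longrightarrow> (\<lambda>\<nu>\<in>I_Q. \<phi>) \<in> paths S T"
  unfolding paths_def by auto

lemma const_path_ideal: "path_ideal (\<lambda>\<nu>\<in>I_Q. \<phi>) = {\<psi>. dprec \<psi> \<phi>}"
proof -
  have "(\<exists>\<nu>\<in>I_Q. dprec \<psi> ((\<lambda>\<nu>\<in>I_Q. \<phi>) \<nu>)) \<longleftrightarrow> dprec \<psi> \<phi>" for \<psi>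
    \<comment> \<open>The value \<open>1 / 2\<close> is an arbitrary point showing that
      \<open>I_Q\<close> is not empty.\<close>
    using bexI[of "\<lambda>\<nu>. dprec \<psi> ((\<lambda>\<nu>\<in>I_Q. \<phi>) \<nu>)" "1 / 2" I_Q] by auto
  then show ?thesis unfolding path_ideal_def by simp
qed

lemma hom_zero_path: "(\<lambda>\<nu>\<in>I_Q. hom_zero) \<in> paths S T"
  by (rule const_path[OF hom_zero_closed dprecD(3)[OF H.R_ze[OF hom_zero_closed]]])

text \<open>A generating sequence is refined to a chain indexed by the rationals. The refinement
  uses interpolation, which \<open>dprec\<close> has by construction.\<close>

lemma ideal_path:
  assumes "H.round_ideal I" shows "\<exists>f\<in>paths S T. path_ideal f = I"
proof -
  obtain c where c: "\<forall>k. dprec (c k) (c (Suc k))" "I = H.genseq c" using assms by (rule H.round_idealE)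
  have "\<exists>h :: rat \<Rightarrow> _. (\<forall>p\<in>I_Q. \<forall>q\<in>I_Q. p < q \<longrightarrow> dprec (h p) (h q)) \<and>
    (\<forall>n. \<exists>q\<in>I_Q. dprec (c n) (h q)) \<and> (\<forall>q\<in>I_Q. \<exists>n. dprec (h q) (c n))"
    by (rule rational_chain) (use c(1) dprec_trans dprecD(4) in blast)+
  then obtain h where h: "\<And>p q. p \<in> I_Q \<Longrightarrow> q \<in> I_Q \<Longrightarrow> p < q \<Longrightarrow> dprec (h p) (h q)"
    "\<And>n. \<exists>q\<in>I_Q. dprec (c n) (h q)" "\<And>q. q \<in> I_Q \<Longrightarrow> \<exists>n. dprec (h q) (c n)" by blast
  have "(\<lambda>q\<in>I_Q. h q) \<in> paths S T"
    unfolding paths_def using dprecD(1) h(3) dprecD(3)[OF h(1)] by (simp add: PiE_iff Ball_def) meson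
  moreover have "path_ideal (\<lambda>q\<in>I_Q. h q) = I"
  proof (intro Set.set_eqI iffI)
    fix \<psi> assume "\<psi> \<in> path_ideal (\<lambda>q\<in>I_Q. h q)"
    then obtain q where "q \<in> I_Q" "dprec \<psi> (h q)" unfolding path_ideal_def by auto
    then show "\<psi> \<in> I" unfolding c(2) H.genseq_def using h(3) dprec_trans by blast
  next
    fix \<psi> assume "\<psi> \<in> I"
    then obtain n where "dprec \<psi> (c n)" unfolding c(2) H.genseq_def by blast
    then obtain q where "q \<in> I_Q" "dprec \<psi> (h q)" using h(2) dprec_trans by blast
    then show "\<psi> \<in> path_ideal (\<lambda>q\<in>I_Q. h q)" unfolding path_ideal_def by auto
  qed
  ultimately show ?thesis by blast
qed

lemma ihom_le_iff:
  assumes "f \<in> paths S T" "g \<in> paths S T"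
  shows "path_class S T f \<sqsubseteq>\<^bsub>ihom S T\<^esub> path_class S T g \<longleftrightarrow> path_ideal f \<subseteq> path_ideal g"
proof -
  have "path_le S T f' g' \<longleftrightarrow> path_ideal f \<subseteq> path_ideal g"
    if "f' \<in> path_class S T f" "g' \<in> path_class S T g" for f' g'
    using that assms by (simp add: path_class_iff path_le_iff)
  moreover have "f \<in> path_class S T f" "g \<in> path_class S T g" using assms by (simp_all add: path_class_iff)
  ultimately show ?thesis unfolding ihom_simps by blast
qed

lemma ihom_add:
  assumes f: "f \<in> paths S T" and g: "g \<in> paths S T"
  shows "path_class S T f \<oplus>\<^bsub>ihom S T\<^esub> path_class S T g = path_class S T (path_add S T f g)"
proof -
  have "path_class S T (path_add S T f' g') = path_class S T (path_add S T f g)"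
    if "f' \<in> path_class S T f" "g' \<in> path_class S T g" for f' g'
    using that assms by (intro path_class_eq) (auto simp: path_class_iff path_add_closed)
  moreover have "f \<in> path_class S T f" "g \<in> path_class S T g" using assms by (simp_all add: path_class_iff)
  ultimately show ?thesis unfolding ihom_simps by blast
qed

text \<open>Injectivity restates path equivalence in terms of ideals, and surjectivity is
  \<open>ideal_path\<close>. Through this bijection \<open>ihom S T\<close> inherits the Cu axioms
  from the completion.\<close>

sublocale iso: cu_iso "ihom S T" completion class_ideal
proof
  show "cu_semigroup completion" by (rule H.cu_semigroup_completion)
  show "eq (ihom S T) = (=)" by (rule ihom_simps)
  show "\<zero>\<^bsub>ihom S T\<^esub> \<in> carrier (ihom S T)" "class_ideal \<zero>\<^bsub>ihom S T\<^esub> = \<zero>\<^bsub>completion\<^esub>"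
    using hom_zero_path by (auto simp: ihom_simps(5) const_class_def ihom_carrier class_ideal const_path_ideal)
  show "bij_betw class_ideal (carrier (ihom S T)) (carrier completion)"
    unfolding bij_betw_def
  proof
    show "inj_on class_ideal (carrier (ihom S T))"
    proof (rule inj_onI)
      fix x y assume xy: "x \<in> carrier (ihom S T)" "y \<in> carrier (ihom S T)" "class_ideal x = class_ideal y"
      obtain f g where fg: "f \<in> paths S T" "g \<in> paths S T" "x = path_class S T f" "y = path_class S T g"
        using xy(1,2) unfolding ihom_carrier by blast
      then show "x = y"
        using path_class_eq[OF fg(1,2)] xy(3) class_ideal[OF fg(1)] class_ideal[OF fg(2)] by simp
    qed
    show "class_ideal ` carrier (ihom S T) = carrier completion"
    proof (intro Set.set_eqI iffI)
      fix I assume "I \<in> carrier completion"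
      then obtain f where f: "f \<in> paths S T" "path_ideal f = I" using ideal_path by auto
      have "path_class S T f \<in> carrier (ihom S T)" using f(1) ihom_carrier by auto
      then show "I \<in> class_ideal ` carrier (ihom S T)"
        by (rule rev_image_eqI) (simp add: class_ideal f)
    qed (auto simp: ihom_carrier class_ideal round_path_ideal)
  qed
  fix x y assume "x \<in> carrier (ihom S T)" "y \<in> carrier (ihom S T)"
  then obtain f g where fg: "f \<in> paths S T" "g \<in> paths S T" "x = path_class S T f" "y = path_class S T g"
    unfolding ihom_carrier by blast
  then show "x \<sqsubseteq>\<^bsub>ihom S T\<^esub> y \<longleftrightarrow> class_ideal x \<sqsubseteq>\<^bsub>completion\<^esub> class_ideal y"
    "x \<oplus>\<^bsub>ihom S T\<^esub> y \<in> carrier (ihom S T)"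
    "class_ideal (x \<oplus>\<^bsub>ihom S T\<^esub> y) = class_ideal x \<oplus>\<^bsub>completion\<^esub> class_ideal y"
    using path_add_closed[OF fg(1,2)] by (auto simp: ihom_le_iff class_ideal ihom_add ihom_carrier)
qed

lemma cu_semigroup_ihom: "cu_semigroup (ihom S T)"
  by (rule iso.cu_semigroup_A)

end

section \<open>The endpoint map\<close>

context cu_hom
begin

lemma class_ideal_round: "x \<in> carrier (ihom S T) \<Longrightarrow> H.round_ideal (class_ideal x)"
  using iso.h_closed by simp

lemma class_ideal_gen: "x \<in> carrier (ihom S T) \<Longrightarrow> \<psi> \<in> class_ideal x \<Longrightarrow> \<psi> \<in> gen_Cu S T"
  using H.round_ideal_M[OF class_ideal_round] .

text \<open>Makes the endpoint an instance of \<open>ext\<close>. Only monotonicity in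
  \<open>\<sqsubseteq>\<close> is obtained here, because \<open>hom_prec\<close> yields way-below
  only between values at arguments that are themselves way below each other.\<close>

lemma eval_map:
  assumes "a \<in> carrier S"
  shows "round_monoid_map (gen_Cu S T) hom_add hom_zero dprec T (\<lambda>\<psi>. \<psi> a)"
  by unfold_locales
    (use assms dprecD hom_prec_le in \<open>auto simp: gen_CuD(1) hom_add_def hom_zero_def\<close>)

abbreviation eval_sup :: "'a \<Rightarrow> ('a \<Rightarrow> 'b) set \<Rightarrow> 'b" where
  "eval_sup a \<equiv> round_monoid_map.ext T (\<lambda>\<psi>. \<psi> a)"

text \<open>The values along any representative are cofinal among the values of its ideal, so the
  supremum in the definition is the same for all representatives.\<close>

lemma endpoint_eq:
  assumes x: "x \<in> carrier (ihom S T)" and a: "a \<in> carrier S"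
  shows "endpoint S T x a = eval_sup a (class_ideal x)"
proof -
  interpret E: round_monoid_map "gen_Cu S T" hom_add hom_zero dprec T "\<lambda>\<psi>. \<psi> a" by (rule eval_map[OF a])
  let ?I = "class_ideal x"
  have sup: "has_sup T ((\<lambda>\<nu>. f \<nu> a) ` I_Q) s \<longleftrightarrow> has_sup T ((\<lambda>\<psi>. \<psi> a) ` ?I) s" if f: "f \<in> x" for f s
  proof -
    obtain f0 where f0: "f0 \<in> paths S T" "x = path_class S T f0" using x unfolding ihom_carrier by blast
    have fp: "f \<in> paths S T" and I: "?I = path_ideal f"
      using f f0 by (simp_all add: path_class_iff class_ideal)
    have sub: "(\<lambda>\<nu>. f \<nu> a) ` I_Q \<subseteq> (\<lambda>\<psi>. \<psi> a) ` ?I"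
      unfolding I using path_mem_ideal[OF fp] by blast
    have cl: "(\<lambda>\<psi>. \<psi> a) ` ?I \<subseteq> carrier T"
      using gen_CuD(1)[OF class_ideal_gen[OF x] a] by blast
    have "(\<forall>z\<in>(\<lambda>\<nu>. f \<nu> a) ` I_Q. z \<sqsubseteq>\<^bsub>T\<^esub> y) \<longleftrightarrow> (\<forall>z\<in>(\<lambda>\<psi>. \<psi> a) ` ?I. z \<sqsubseteq>\<^bsub>T\<^esub> y)"
      if y: "y \<in> carrier T" for y
    proof
      assume r: "\<forall>z\<in>(\<lambda>\<nu>. f \<nu> a) ` I_Q. z \<sqsubseteq>\<^bsub>T\<^esub> y"
      show "\<forall>z\<in>(\<lambda>\<psi>. \<psi> a) ` ?I. z \<sqsubseteq>\<^bsub>T\<^esub> y"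
      proof
        fix z assume "z \<in> (\<lambda>\<psi>. \<psi> a) ` ?I"
        then obtain \<psi> \<nu> where \<psi>: "z = \<psi> a" "\<nu> \<in> I_Q" "dprec \<psi> (f \<nu>)" unfolding I path_ideal_def by blast
        have "\<psi> a \<sqsubseteq>\<^bsub>T\<^esub> f \<nu> a"
          using dprecD[OF \<psi>(3)] a by (intro hom_prec_le)
        then show "z \<sqsubseteq>\<^bsub>T\<^esub> y"
          using T.le_trans[of "\<psi> a" "f \<nu> a" y] r \<psi> y gen_CuD(1)[OF dprecD(1)[OF \<psi>(3)] a]
            gen_CuD(1)[OF dprecD(2)[OF \<psi>(3)] a] by simp
      qed
    qed (use sub in blast)
    then show ?thesis unfolding has_sup_iff using sub cl by (meson subset_trans)
  qed
  have ex: "has_sup T ((\<lambda>\<psi>. \<psi> a) ` ?I) (E.ext ?I)"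
    by (rule E.has_sup_ext[OF class_ideal_round[OF x]])
  obtain f where f: "f \<in> x"
    using x path_class_iff unfolding ihom_carrier by blast
  have "(THE s. \<exists>f\<in>x. has_sup T ((\<lambda>\<nu>. f \<nu> a) ` I_Q) s) = E.ext ?I"
    by (rule the_equality) (use sup ex f T.has_sup_unique in blast)+
  then show ?thesis by (simp add: endpoint_def a)
qed

lemma endpoint_has_sup:
  assumes "x \<in> carrier (ihom S T)" "a \<in> carrier S"
  shows "has_sup T ((\<lambda>\<psi>. \<psi> a) ` class_ideal x) (endpoint S T x a)"
proof -
  interpret E: round_monoid_map "gen_Cu S T" hom_add hom_zero dprec T "\<lambda>\<psi>. \<psi> a" by (rule eval_map[OF assms(2)])
  show ?thesis unfolding endpoint_eq[OF assms] by (rule E.has_sup_ext[OF class_ideal_round[OF assms(1)]])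
qed

lemma endpoint_closed: "x \<in> carrier (ihom S T) \<Longrightarrow> a \<in> carrier S \<Longrightarrow> endpoint S T x a \<in> carrier T"
  by (rule has_sup_closed[OF endpoint_has_sup])

lemma endpoint_upper:
  "x \<in> carrier (ihom S T) \<Longrightarrow> a \<in> carrier S \<Longrightarrow> \<psi> \<in> class_ideal x \<Longrightarrow> \<psi> a \<sqsubseteq>\<^bsub>T\<^esub> endpoint S T x a"
  by (rule has_sup_upper[OF endpoint_has_sup]) auto

lemma endpoint_least:
  assumes "x \<in> carrier (ihom S T)" "a \<in> carrier S" "y \<in> carrier T" "\<And>\<psi>. \<psi> \<in> class_ideal x \<Longrightarrow> \<psi> a \<sqsubseteq>\<^bsub>T\<^esub> y"
  shows "endpoint S T x a \<sqsubseteq>\<^bsub>T\<^esub> y"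
  by (rule has_sup_least[OF endpoint_has_sup[OF assms(1,2)] assms(3)]) (use assms(4) in auto)

lemma class_ideal_sup:
  assumes "inc_seq (ihom S T) xs" "has_sup (ihom S T) (range xs) x"
  shows "class_ideal x = (\<Union>n. class_ideal (xs n))"
proof -
  have xs: "\<forall>n. xs n \<in> carrier (ihom S T)" using inc_seq_closed[OF assms(1)] by blast
  have "inc_seq completion (\<lambda>n. class_ideal (xs n))"
    using iso.inc_seq_h[of xs] xs assms(1) by blast
  then have *: "\<And>n. H.round_ideal (class_ideal (xs n))" "\<And>n. class_ideal (xs n) \<subseteq> class_ideal (xs (Suc n))"
    by (simp_all add: H.inc_seq_completion)
  have "has_sup completion (range (\<lambda>n. class_ideal (xs n))) (class_ideal x)"
    using iso.has_sup_seq_h[of xs x] xs has_sup_closed[OF assms(2)] assms(2) by blast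
  then show ?thesis
    using H.has_sup_completion_iff[of "\<lambda>n. class_ideal (xs n)", OF *] by blast
qed

lemma ihom_way_belowE:
  assumes "x \<lless>\<^bsub>ihom S T\<^esub> y"
  obtains \<chi> where "\<chi> \<in> class_ideal y" "\<And>\<psi>. \<psi> \<in> class_ideal x \<Longrightarrow> dprec \<psi> \<chi>"
  using assms iso.way_below_h[OF way_below_closed[OF assms]] by (auto simp: H.way_below_completion)

lemma endpoint_bimorphism: "cu_bimorphism (ihom S T) S T (endpoint S T)"
proof (rule cu_bimorphismI)
  interpret I: cu_sg "ihom S T" using cu_semigroup_ihom by unfold_locales
  show "x \<in> carrier (ihom S T) \<Longrightarrow> a \<in> carrier S \<Longrightarrow> endpoint S T x a \<in> carrier T" for x a
    by (rule endpoint_closed)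
  show "endpoint S T \<zero>\<^bsub>ihom S T\<^esub> a = \<zero>\<^bsub>T\<^esub>" if a: "a \<in> carrier S" for a
  proof -
    interpret E: round_monoid_map "gen_Cu S T" hom_add hom_zero dprec T "\<lambda>\<psi>. \<psi> a" by (rule eval_map[OF a])
    show ?thesis using E.ext_zero by (simp add: endpoint_eq[OF _ a] iso.h_zero)
  qed
  show "endpoint S T x \<zero>\<^bsub>S\<^esub> = \<zero>\<^bsub>T\<^esub>" if x: "x \<in> carrier (ihom S T)" for x
    by (rule T.le_zero) (auto simp: x endpoint_closed gen_CuD(2)[OF class_ideal_gen[OF x]] intro!: endpoint_least)
  show "endpoint S T (x \<oplus>\<^bsub>ihom S T\<^esub> y) a = endpoint S T x a \<oplus>\<^bsub>T\<^esub> endpoint S T y a"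
    if xy: "x \<in> carrier (ihom S T)" "y \<in> carrier (ihom S T)" and a: "a \<in> carrier S" for x y a
  proof -
    interpret E: round_monoid_map "gen_Cu S T" hom_add hom_zero dprec T "\<lambda>\<psi>. \<psi> a" by (rule eval_map[OF a])
    show ?thesis by (simp add: endpoint_eq[OF _ a] xy iso.h_add E.ext_add class_ideal_round)
  qed
  show "endpoint S T x (a \<oplus>\<^bsub>S\<^esub> b) = endpoint S T x a \<oplus>\<^bsub>T\<^esub> endpoint S T x b"
    if x: "x \<in> carrier (ihom S T)" and ab: "a \<in> carrier S" "b \<in> carrier S" for x a b
  proof -
    \<comment> \<open>(O4) speaks of sequences, so the supremum over the ideal is replaced by one
      along generators.\<close>
    obtain c where c: "\<forall>k. dprec (c k) (c (Suc k))" "class_ideal x = H.genseq c"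
      using class_ideal_round[OF x] by (rule H.round_idealE)
    note cM = gen_CuD[OF H.R_M1[OF c(1)[rule_format]]]
    have sup: "has_sup T (range (\<lambda>k. c k a)) (endpoint S T x a)" "inc_seq T (\<lambda>k. c k a)"
      if a: "a \<in> carrier S" for a
    proof -
      interpret E: round_monoid_map "gen_Cu S T" hom_add hom_zero dprec T "\<lambda>\<psi>. \<psi> a" by (rule eval_map[OF a])
      show "has_sup T (range (\<lambda>k. c k a)) (endpoint S T x a)"
        using endpoint_has_sup[OF x a] unfolding c(2) E.has_sup_genseq[OF c(1)] .
      show "inc_seq T (\<lambda>k. c k a)" by (rule E.inc_seq_g[OF c(1)])
    qed
    have "has_sup T (range (\<lambda>k. c k a \<oplus>\<^bsub>T\<^esub> c k b)) (endpoint S T x a \<oplus>\<^bsub>T\<^esub> endpoint S T x b)"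
      by (intro T.has_sup_add sup ab)
    then have "has_sup T (range (\<lambda>k. c k (a \<oplus>\<^bsub>S\<^esub> b))) (endpoint S T x a \<oplus>\<^bsub>T\<^esub> endpoint S T x b)"
      by (simp only: cM(3)[OF ab])
    then show ?thesis
      by (rule T.has_sup_unique[OF sup(1)[OF S.add_closed[OF ab]]])
  qed
  show mono1: "endpoint S T x a \<sqsubseteq>\<^bsub>T\<^esub> endpoint S T y a"
    if "x \<in> carrier (ihom S T)" "y \<in> carrier (ihom S T)" "a \<in> carrier S" "x \<sqsubseteq>\<^bsub>ihom S T\<^esub> y" for x y a
  proof (rule endpoint_least)
    fix \<psi> assume "\<psi> \<in> class_ideal x"
    then have "\<psi> \<in> class_ideal y" using that iso.le_iff by auto
    then show "\<psi> a \<sqsubseteq>\<^bsub>T\<^esub> endpoint S T y a" using that endpoint_upper by blast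
  qed (use that endpoint_closed in auto)
  show mono2: "endpoint S T x a \<sqsubseteq>\<^bsub>T\<^esub> endpoint S T x b"
    if "x \<in> carrier (ihom S T)" "a \<in> carrier S" "b \<in> carrier S" "a \<sqsubseteq>\<^bsub>S\<^esub> b" for x a b
  proof (rule endpoint_least)
    fix \<psi> assume \<psi>: "\<psi> \<in> class_ideal x"
    note g = class_ideal_gen[OF that(1) \<psi>]
    show "\<psi> a \<sqsubseteq>\<^bsub>T\<^esub> endpoint S T x b"
      by (rule T.le_trans[OF gen_CuD(4)[OF g that(2-4)] endpoint_upper[OF that(1,3) \<psi>]])
        (simp_all add: that endpoint_closed gen_CuD(1)[OF g])
  qed (use that endpoint_closed in auto)
  show "has_sup T (range (\<lambda>k. endpoint S T (xs k) (as k))) (endpoint S T x a)"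
    if xs: "inc_seq (ihom S T) xs" "inc_seq S as" "has_sup (ihom S T) (range xs) x" "has_sup S (range as) a"
    for xs as x a
  proof (rule has_supI)
    have cl: "xs n \<in> carrier (ihom S T)" "as n \<in> carrier S" for n
      by (rule inc_seq_closed[OF xs(1)] inc_seq_closed[OF xs(2)])+
    have xa: "x \<in> carrier (ihom S T)" "a \<in> carrier S"
      by (rule has_sup_closed[OF xs(3)] has_sup_closed[OF xs(4)])+
    show "endpoint S T x a \<in> carrier T" by (rule endpoint_closed[OF xa])
    fix z assume "z \<in> range (\<lambda>k. endpoint S T (xs k) (as k))"
    then obtain k where z: "z = endpoint S T (xs k) (as k)" by blast
    show "z \<in> carrier T" unfolding z by (rule endpoint_closed[OF cl])
    have "endpoint S T (xs k) (as k) \<sqsubseteq>\<^bsub>T\<^esub> endpoint S T x (as k)"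
      by (rule mono1[OF cl(1) xa(1) cl(2) has_sup_upper[OF xs(3)]]) simp
    moreover have "endpoint S T x (as k) \<sqsubseteq>\<^bsub>T\<^esub> endpoint S T x a"
      by (rule mono2[OF xa(1) cl(2) xa(2) has_sup_upper[OF xs(4)]]) simp
    ultimately show "z \<sqsubseteq>\<^bsub>T\<^esub> endpoint S T x a"
      unfolding z by (rule T.le_trans) (simp_all add: cl xa endpoint_closed)
  next
    have cl: "xs n \<in> carrier (ihom S T)" "as n \<in> carrier S" for n
      by (rule inc_seq_closed[OF xs(1)] inc_seq_closed[OF xs(2)])+
    have xa: "x \<in> carrier (ihom S T)" "a \<in> carrier S"
      by (rule has_sup_closed[OF xs(3)] has_sup_closed[OF xs(4)])+
    fix y assume y: "y \<in> carrier T" "\<And>z. z \<in> range (\<lambda>k. endpoint S T (xs k) (as k)) \<Longrightarrow> z \<sqsubseteq>\<^bsub>T\<^esub> y"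
    show "endpoint S T x a \<sqsubseteq>\<^bsub>T\<^esub> y"
    proof (rule endpoint_least[OF xa y(1)])
      fix \<psi> assume "\<psi> \<in> class_ideal x"
      then obtain n where n: "\<psi> \<in> class_ideal (xs n)" using class_ideal_sup[OF xs(1,3)] by blast
      note g = class_ideal_gen[OF cl(1) n]
      show "\<psi> a \<sqsubseteq>\<^bsub>T\<^esub> y"
      proof (rule has_sup_least[OF gen_CuD(5)[OF g xs(2,4)] y(1)])
        fix z assume "z \<in> range (\<lambda>n. \<psi> (as n))"
        then obtain k where z: "z = \<psi> (as k)" by blast
        \<comment> \<open>At this index the ideal contains \<open>\<psi>\<close> and the argument
          dominates \<open>as k\<close>, so the diagonal bound by \<open>y\<close> applies.\<close>
        let ?m = "max n k"
        have "\<psi> \<in> class_ideal (xs ?m)"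
          using n I.inc_seqD[OF xs(1), of n ?m] iso.le_iff[OF cl(1) cl(1)] by auto
        then have "\<psi> (as ?m) \<sqsubseteq>\<^bsub>T\<^esub> endpoint S T (xs ?m) (as ?m)" by (rule endpoint_upper[OF cl])
        then have "\<psi> (as ?m) \<sqsubseteq>\<^bsub>T\<^esub> y"
          by (rule T.le_trans) (use y cl endpoint_closed gen_CuD(1)[OF g] in auto)
        moreover have "\<psi> (as k) \<sqsubseteq>\<^bsub>T\<^esub> \<psi> (as ?m)"
          by (rule gen_CuD(4)[OF g cl(2) cl(2) S.inc_seqD[OF xs(2)]]) simp
        ultimately show "z \<sqsubseteq>\<^bsub>T\<^esub> y"
          unfolding z using T.le_trans[of "\<psi> (as k)" "\<psi> (as ?m)" y] y(1) gen_CuD(1)[OF g cl(2)] by simp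
      qed
    qed
  qed
  show "endpoint S T x' a' \<lless>\<^bsub>T\<^esub> endpoint S T x a" if x: "x' \<lless>\<^bsub>ihom S T\<^esub> x" and a: "a' \<lless>\<^bsub>S\<^esub> a" for x' x a' a
  proof -
    note cl = way_below_closed[OF x] way_below_closed[OF a]
    obtain \<chi> where \<chi>: "\<chi> \<in> class_ideal x" "\<And>\<psi>. \<psi> \<in> class_ideal x' \<Longrightarrow> dprec \<psi> \<chi>"
      using ihom_way_belowE[OF x] by metis
    \<comment> \<open>The bound \<open>\<chi>\<close> controls the endpoint of \<open>x'\<close> at
      the argument \<open>a'\<close>. A second member above it is needed to pass from
      \<open>a'\<close> to \<open>a\<close> with a way-below gap.\<close>
    obtain \<omega> where \<omega>: "\<omega> \<in> class_ideal x" "dprec \<chi> \<omega>"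
      using H.round_ideal_round[OF class_ideal_round[OF cl(2)] \<chi>(1)] by blast
    have "endpoint S T x' a' \<sqsubseteq>\<^bsub>T\<^esub> \<chi> a'"
    proof (rule endpoint_least[OF cl(1,3)])
      show "\<chi> a' \<in> carrier T" using gen_CuD(1)[OF class_ideal_gen[OF cl(2) \<chi>(1)] cl(3)] .
      show "\<psi> a' \<sqsubseteq>\<^bsub>T\<^esub> \<chi> a'" if "\<psi> \<in> class_ideal x'" for \<psi>
        using dprecD(1-3)[OF \<chi>(2)[OF that]] cl(3) by (intro hom_prec_le)
    qed
    moreover have "\<chi> a' \<lless>\<^bsub>T\<^esub> \<omega> a" using dprecD(3)[OF \<omega>(2)] a unfolding hom_prec_def by blast
    ultimately have "endpoint S T x' a' \<lless>\<^bsub>T\<^esub> \<omega> a"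
      by (rule T.way_below_trans_le) (rule endpoint_closed[OF cl(1,3)])
    then show ?thesis
      by (rule T.le_trans_way_below[OF _ endpoint_upper[OF cl(2,4) \<omega>(1)] endpoint_closed[OF cl(2,4)]])
  qed
qed

text \<open>
  The endpoint map is not injective, but an element is determined by the endpoints of the members of
  a \<open>\<lless>\<close>-increasing sequence converging to it.
\<close>

lemma ihom_le_if_endpoints_le:
  assumes xs: "\<forall>n. xs n \<lless>\<^bsub>ihom S T\<^esub> xs (Suc n)" "has_sup (ihom S T) (range xs) x"
    and ys: "\<forall>n. ys n \<lless>\<^bsub>ihom S T\<^esub> ys (Suc n)" "has_sup (ihom S T) (range ys) y"
    and le: "\<And>n a. a \<in> carrier S \<Longrightarrow> endpoint S T (xs n) a \<sqsubseteq>\<^bsub>T\<^esub> endpoint S T (ys n) a"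
  shows "x \<sqsubseteq>\<^bsub>ihom S T\<^esub> y"
proof -
  interpret I: cu_sg "ihom S T" using cu_semigroup_ihom by unfold_locales
  note xs' = I.way_below_seq_inc[OF xs(1)] and ys' = I.way_below_seq_inc[OF ys(1)]
  note xc = inc_seq_closed[OF xs'] and yc = inc_seq_closed[OF ys']
  have "class_ideal x \<subseteq> class_ideal y"
  proof
    fix \<phi> assume "\<phi> \<in> class_ideal x"
    then obtain n where n: "\<phi> \<in> class_ideal (xs n)" using class_ideal_sup[OF xs' xs(2)] by blast
    \<comment> \<open>Endpoints give only a pointwise inequality, for \<open>\<phi>1\<close>; the
      step from \<open>\<phi>\<close> to \<open>\<phi>1\<close> is kept in reserve for
      \<open>dprec_le_trans\<close>.\<close>
    obtain \<phi>1 where \<phi>1: "\<phi>1 \<in> class_ideal (xs n)" "dprec \<phi> \<phi>1"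
      using H.round_ideal_round[OF class_ideal_round[OF xc] n] by blast
    \<comment> \<open>One index later there is a single map above the whole ideal of
      \<open>ys n\<close>, hence above its endpoint.\<close>
    obtain \<chi> where \<chi>: "\<chi> \<in> class_ideal (ys (Suc n))" "\<And>\<psi>. \<psi> \<in> class_ideal (ys n) \<Longrightarrow> dprec \<psi> \<chi>"
      using ihom_way_belowE[OF ys(1)[rule_format, of n]] by metis
    note \<chi>g = class_ideal_gen[OF yc \<chi>(1)]
    have "\<phi>1 a \<sqsubseteq>\<^bsub>T\<^esub> \<chi> a" if a: "a \<in> carrier S" for a
    proof -
      note cl = endpoint_closed[OF xc a, of n] endpoint_closed[OF yc a, of n] gen_CuD(1)[OF \<chi>g a]
        gen_CuD(1)[OF class_ideal_gen[OF xc \<phi>1(1)] a]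
      have "endpoint S T (ys n) a \<sqsubseteq>\<^bsub>T\<^esub> \<chi> a"
      proof (rule endpoint_least[OF yc a cl(3)])
        show "\<psi> a \<sqsubseteq>\<^bsub>T\<^esub> \<chi> a" if "\<psi> \<in> class_ideal (ys n)" for \<psi>
          using dprecD(1-3)[OF \<chi>(2)[OF that]] a by (intro hom_prec_le)
      qed
      then have "endpoint S T (xs n) a \<sqsubseteq>\<^bsub>T\<^esub> \<chi> a" using T.le_trans[OF le[OF a]] cl by blast
      then show ?thesis using T.le_trans[OF endpoint_upper[OF xc a \<phi>1(1)]] cl by blast
    qed
    then have "dprec \<phi> \<chi>" using dprec_le_trans[OF \<phi>1(2)] \<chi>g by blast
    then have "\<phi> \<in> class_ideal (ys (Suc n))" by (rule H.round_ideal_down[OF class_ideal_round[OF yc] \<chi>(1)])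
    then show "\<phi> \<in> class_ideal y" using class_ideal_sup[OF ys' ys(2)] by blast
  qed
  then show ?thesis using iso.le_iff[OF has_sup_closed[OF xs(2)] has_sup_closed[OF ys(2)]] by simp
qed

lemma ihom_eq_if_endpoints_eq:
  assumes xs: "\<forall>n. xs n \<lless>\<^bsub>ihom S T\<^esub> xs (Suc n)" "has_sup (ihom S T) (range xs) x"
    and ys: "\<forall>n. ys n \<lless>\<^bsub>ihom S T\<^esub> ys (Suc n)" "has_sup (ihom S T) (range ys) y"
    and eq: "\<And>n a. a \<in> carrier S \<Longrightarrow> endpoint S T (xs n) a = endpoint S T (ys n) a"
  shows "x = y"
proof -
  interpret I: cu_sg "ihom S T" using cu_semigroup_ihom by unfold_locales
  have cl: "endpoint S T (ys n) a \<in> carrier T" if "a \<in> carrier S" for n a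
    by (rule endpoint_closed[OF way_below_closed(1)[OF ys(1)[rule_format]] that])
  show ?thesis
    by (intro I.le_antisym ihom_le_if_endpoints_le[OF xs ys] ihom_le_if_endpoints_le[OF ys xs]
        has_sup_closed[OF xs(2)] has_sup_closed[OF ys(2)]) (simp_all add: eq cl)
qed

text \<open>Bimorphisms send approximating sequences of the arguments to way-below increasing
  sequences converging to the value, and these are compared through endpoints.\<close>

lemma bimorphism_eq_if_endpoints_eq:
  assumes A: "cu_semigroup A" and B: "cu_semigroup B"
    and \<phi>: "cu_bimorphism A B (ihom S T) \<phi>" and \<psi>: "cu_bimorphism A B (ihom S T) \<psi>"
    and eq: "\<And>a b s. a \<in> carrier A \<Longrightarrow> b \<in> carrier B \<Longrightarrow> s \<in> carrier S \<Longrightarrow>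
      endpoint S T (\<phi> a b) s = endpoint S T (\<psi> a b) s"
    and ab: "a \<in> carrier A" "b \<in> carrier B"
  shows "\<phi> a b = \<psi> a b"
proof -
  interpret A: cu_sg A using A by unfold_locales
  interpret B: cu_sg B using B by unfold_locales
  obtain c where c: "\<forall>n. c n \<lless>\<^bsub>A\<^esub> c (Suc n)" "has_sup A (range c) a" using A.approx_seq[OF ab(1)] by blast
  obtain d where d: "\<forall>n. d n \<lless>\<^bsub>B\<^esub> d (Suc n)" "has_sup B (range d) b" using B.approx_seq[OF ab(2)] by blast
  note cd = A.way_below_seq_inc[OF c(1)] B.way_below_seq_inc[OF d(1)]
  show ?thesis
  proof (rule ihom_eq_if_endpoints_eq)
    show "has_sup (ihom S T) (range (\<lambda>n. \<phi> (c n) (d n))) (\<phi> a b)"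
      by (rule cu_bimorphismD(8)[OF \<phi> cd c(2) d(2)])
    show "has_sup (ihom S T) (range (\<lambda>n. \<psi> (c n) (d n))) (\<psi> a b)"
      by (rule cu_bimorphismD(8)[OF \<psi> cd c(2) d(2)])
  qed (use c(1) d(1) cu_bimorphismD(9)[OF \<phi>] cu_bimorphismD(9)[OF \<psi>] eq
      inc_seq_closed[OF cd(1)] inc_seq_closed[OF cd(2)] in auto)
qed

lemma Cu_eq_if_endpoints_eq:
  assumes A: "cu_semigroup A" and \<alpha>: "\<alpha> \<in> Cu A (ihom S T)" and \<beta>: "\<beta> \<in> Cu A (ihom S T)"
    and eq: "\<And>a s. a \<in> carrier A \<Longrightarrow> s \<in> carrier S \<Longrightarrow> endpoint S T (\<alpha> a) s = endpoint S T (\<beta> a) s"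
  shows "\<alpha> = \<beta>"
proof (rule gen_Cu_ext[OF Cu_gen[OF \<alpha>] Cu_gen[OF \<beta>]])
  interpret A: cu_sg A using A by unfold_locales
  fix a assume a: "a \<in> carrier A"
  obtain c where c: "\<forall>n. c n \<lless>\<^bsub>A\<^esub> c (Suc n)" "has_sup A (range c) a" using A.approx_seq[OF a] by blast
  note ci = A.way_below_seq_inc[OF c(1)]
  show "\<alpha> a = \<beta> a"
  proof (rule ihom_eq_if_endpoints_eq)
    show "has_sup (ihom S T) (range (\<lambda>n. \<alpha> (c n))) (\<alpha> a)" by (rule gen_CuD(5)[OF Cu_gen[OF \<alpha>] ci c(2)])
    show "has_sup (ihom S T) (range (\<lambda>n. \<beta> (c n))) (\<beta> a)" by (rule gen_CuD(5)[OF Cu_gen[OF \<beta>] ci c(2)])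
  qed (use c(1) Cu_way_below[OF \<alpha>] Cu_way_below[OF \<beta>] eq inc_seq_closed[OF ci] in auto)
qed

end

section \<open>Currying\<close>

lemma (in cu_iso) Cu_lift:
  assumes X: "cu_semigroup X" and F: "F \<in> Cu X B"
  shows "\<exists>\<alpha>\<in>Cu X A. \<forall>x\<in>carrier X. h (\<alpha> x) = F x"
proof -
  interpret X: cu_sg X using X by unfold_locales
  note Fg = gen_CuD[OF Cu_gen[OF F]]
  have "\<forall>x\<in>carrier X. \<exists>y. y \<in> carrier A \<and> h y = F x" using h_surj Fg(1) by blast
  then obtain g where g: "\<And>x. x \<in> carrier X \<Longrightarrow> g x \<in> carrier A" "\<And>x. x \<in> carrier X \<Longrightarrow> h (g x) = F x" by metis
  have "(\<lambda>x\<in>carrier X. g x) \<in> gen_Cu X A"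
  proof (rule gen_Cu_restrictI[OF _ _ _ _ _ X])
    show "g \<zero>\<^bsub>X\<^esub> = \<zero>\<^bsub>A\<^esub>" by (rule h_inj) (simp_all add: g h_zero Fg(2) A_zero_closed)
    show "g (a \<oplus>\<^bsub>X\<^esub> b) = g a \<oplus>\<^bsub>A\<^esub> g b" if "a \<in> carrier X" "b \<in> carrier X" for a b
      using that by (intro h_inj) (simp_all add: g h_add Fg(3) A_add_closed)
    show "g a \<sqsubseteq>\<^bsub>A\<^esub> g b" if "a \<in> carrier X" "b \<in> carrier X" "a \<sqsubseteq>\<^bsub>X\<^esub> b" for a b
      using that by (simp add: g le_iff Fg(4))
    fix c x assume c: "inc_seq X c" "has_sup X (range c) x"
    note cl = inc_seq_closed[OF c(1)] has_sup_closed[OF c(2)]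
    show "has_sup A (range (\<lambda>n. g (c n))) (g x)"
      using Fg(5)[OF c] by (subst has_sup_seq_h) (simp_all add: g cl)
  qed (rule g(1))
  moreover have "(\<lambda>x\<in>carrier X. g x) a' \<lless>\<^bsub>A\<^esub> (\<lambda>x\<in>carrier X. g x) a" if "a' \<lless>\<^bsub>X\<^esub> a" for a' a
    using way_below_closed[OF that] Cu_way_below[OF F that] by (simp add: way_below_h g)
  ultimately show ?thesis
    by (intro bexI[of _ "\<lambda>x\<in>carrier X. g x"] CuI) (simp_all add: g)
qed

lemma cu_bimorphism_cong:
  assumes \<phi>: "cu_bimorphism S T P \<phi>" and S: "cu_semigroup S" and T: "cu_semigroup T"
    and eq: "\<And>a b. a \<in> carrier S \<Longrightarrow> b \<in> carrier T \<Longrightarrow> \<psi> a b = \<phi> a b"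
  shows "cu_bimorphism S T P \<psi>"
proof (rule cu_bimorphismI)
  interpret S: cu_sg S using S by unfold_locales
  interpret T: cu_sg T using T by unfold_locales
  note p = cu_bimorphismD[OF \<phi>]
  show "has_sup P (range (\<lambda>k. \<psi> (c k) (d k))) (\<psi> x y)"
    if *: "inc_seq S c" "inc_seq T d" "has_sup S (range c) x" "has_sup T (range d) y" for c d x y
    using p(8)[OF *] inc_seq_closed[OF *(1)] inc_seq_closed[OF *(2)] has_sup_closed[OF *(3)] has_sup_closed[OF *(4)]
    by (simp add: eq)
  show "\<psi> a' b' \<lless>\<^bsub>P\<^esub> \<psi> a b" if *: "a' \<lless>\<^bsub>S\<^esub> a" "b' \<lless>\<^bsub>T\<^esub> b" for a' a b' b
    using p(9)[OF *] way_below_closed[OF *(1)] way_below_closed[OF *(2)] by (simp add: eq)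
  show "b \<in> carrier T \<Longrightarrow> \<psi> \<zero>\<^bsub>S\<^esub> b = \<zero>\<^bsub>P\<^esub>" for b by (simp add: eq p(2))
  show "a \<in> carrier S \<Longrightarrow> \<psi> a \<zero>\<^bsub>T\<^esub> = \<zero>\<^bsub>P\<^esub>" for a by (simp add: eq p(3))
  show "a \<in> carrier S \<Longrightarrow> a' \<in> carrier S \<Longrightarrow> b \<in> carrier T \<Longrightarrow> \<psi> (a \<oplus>\<^bsub>S\<^esub> a') b = \<psi> a b \<oplus>\<^bsub>P\<^esub> \<psi> a' b" for a a' b
    by (simp add: eq p(4))
  show "a \<in> carrier S \<Longrightarrow> b \<in> carrier T \<Longrightarrow> b' \<in> carrier T \<Longrightarrow> \<psi> a (b \<oplus>\<^bsub>T\<^esub> b') = \<psi> a b \<oplus>\<^bsub>P\<^esub> \<psi> a b'" for a b b'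
    by (simp add: eq p(5))
qed (simp_all add: eq cu_bimorphismD(1,6,7)[OF \<phi>])

text \<open>The inverse of \<open>class_ideal\<close> as a Cu-morphism; it converts ideal-valued
  maps into maps to \<open>ihom S T\<close>.\<close>

lemma (in cu_hom) completion_section:
  obtains \<kappa> where "\<kappa> \<in> Cu completion (ihom S T)" "\<And>I. H.round_ideal I \<Longrightarrow> class_ideal (\<kappa> I) = I"
  using iso.Cu_lift[OF H.cu_semigroup_completion Cu_id[OF H.cu_semigroup_completion]] by auto

text \<open>The common core of currying one argument and of currying two at once: \<open>W\<close>
  is way-below on the curried arguments, taken coordinatewise for pairs. \<open>W_approx\<close>
  supplies the sequences that generate the slice ideals.\<close>

locale cu_slices = cu_hom S T
  for S :: "('a, 'm) po_semigroup_scheme" and T :: "('b, 'n) po_semigroup_scheme" +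
  fixes Idx :: "'i set" and W :: "'i \<Rightarrow> 'i \<Rightarrow> bool" and slice :: "'i \<Rightarrow> 'a \<Rightarrow> 'b"
  assumes slice_gen_Cu: "i \<in> Idx \<Longrightarrow> slice i \<in> gen_Cu S T"
    and W_closed: "W j i \<Longrightarrow> j \<in> Idx \<and> i \<in> Idx"
    and W_trans: "W k j \<Longrightarrow> W j i \<Longrightarrow> W k i"
    and W_approx: "i \<in> Idx \<Longrightarrow> \<exists>c. (\<forall>n. W (c n) (c (Suc n))) \<and> (\<forall>n. W (c n) i) \<and> (\<forall>j. W j i \<longrightarrow> (\<exists>k. W j (c (k::nat))))"
    and W_hom_prec: "W j i \<Longrightarrow> hom_prec S T (slice j) (slice i)"
begin

text \<open>Only slices at indices \<open>W\<close>-below \<open>i\<close> enter, since a slice need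
  not be \<open>dprec\<close>-related to itself: way-below is preserved when all arguments move
  together.\<close>

definition slice_ideal :: "'i \<Rightarrow> ('a \<Rightarrow> 'b) set" where
  "slice_ideal i = {\<psi>. \<exists>j. W j i \<and> dprec \<psi> (slice j)}"

lemma W_interp: "W j i \<Longrightarrow> \<exists>k. W j k \<and> W k i"
  using W_approx[of i] W_closed[of j i] by blast

lemma slice_dprec: "W j i \<Longrightarrow> dprec (slice j) (slice i)"
proof (rule dprecI[of "\<lambda>\<phi> \<psi>. \<exists>j i. \<phi> = slice j \<and> \<psi> = slice i \<and> W j i"])
  fix \<phi> \<psi> assume "\<exists>j i. \<phi> = slice j \<and> \<psi> = slice i \<and> W j i"
  then obtain j i where *: "\<phi> = slice j" "\<psi> = slice i" "W j i" by blast
  then show "\<phi> \<in> gen_Cu S T \<and> \<psi> \<in> gen_Cu S T \<and> hom_prec S T \<phi> \<psi>"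
    using W_closed slice_gen_Cu W_hom_prec by simp
  show "\<exists>\<chi>. (\<exists>j i. \<phi> = slice j \<and> \<chi> = slice i \<and> W j i) \<and> (\<exists>j i. \<chi> = slice j \<and> \<psi> = slice i \<and> W j i)"
    using W_interp[OF *(3)] *(1,2) by blast
qed blast

lemma slice_mem: "W j i \<Longrightarrow> slice j \<in> slice_ideal i"
  unfolding slice_ideal_def using W_interp slice_dprec by (metis (mono_tags, lifting) mem_Collect_eq)

lemma slice_ideal_round:
  assumes "i \<in> Idx" shows "H.round_ideal (slice_ideal i)"
proof -
  obtain c where c: "\<forall>n. W (c n) (c (Suc n))" "\<forall>n. W (c n) i" "\<forall>j. W j i \<longrightarrow> (\<exists>k. W j (c (k::nat)))"
    using W_approx[OF assms] by blast
  have "slice_ideal i = H.genseq (\<lambda>k. slice (c k))"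
  proof (intro Set.set_eqI iffI)
    fix \<psi> assume "\<psi> \<in> slice_ideal i"
    then obtain j where j: "W j i" "dprec \<psi> (slice j)" unfolding slice_ideal_def by blast
    then obtain k where "W j (c k)" using c(3) by blast
    then show "\<psi> \<in> H.genseq (\<lambda>k. slice (c k))"
      unfolding H.genseq_def using dprec_trans[OF j(2) slice_dprec] by blast
  next
    fix \<psi> assume "\<psi> \<in> H.genseq (\<lambda>k. slice (c k))"
    then show "\<psi> \<in> slice_ideal i"
      unfolding H.genseq_def slice_ideal_def using c(2) by blast
  qed
  then show ?thesis using H.round_ideal_genseq[of "\<lambda>k. slice (c k)"] slice_dprec c(1) by simp
qed

lemma slice_ideal_way_below:
  assumes "W j i" shows "slice_ideal j \<lless>\<^bsub>completion\<^esub> slice_ideal i"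
proof -
  obtain k where k: "W j k" "W k i" using W_interp[OF assms] by blast
  have "dprec \<psi> (slice k)" if "\<psi> \<in> slice_ideal j" for \<psi>
  proof -
    obtain l where l: "W l j" "dprec \<psi> (slice l)" using \<open>\<psi> \<in> slice_ideal j\<close> unfolding slice_ideal_def by blast
    show ?thesis by (rule dprec_trans[OF l(2) slice_dprec[OF W_trans[OF l(1) k(1)]]])
  qed
  then show ?thesis
    unfolding H.way_below_completion
    using slice_ideal_round W_closed[OF assms] slice_mem[OF k(2)] by blast
qed

text \<open>The upper bound is monotonicity along \<open>W\<close>. The lower bound uses the slices
  at \<open>c n\<close>, which belong to the ideal and converge to \<open>slice i\<close> at
  \<open>s\<close>.\<close>

lemma endpoint_slice:
  assumes x: "x \<in> carrier (ihom S T)" "class_ideal x = slice_ideal i" and i: "i \<in> Idx" and s: "s \<in> carrier S"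
    and c: "\<And>n::nat. W (c n) i" "has_sup T (range (\<lambda>n. slice (c n) s)) (slice i s)"
  shows "endpoint S T x s = slice i s"
proof (rule T.le_antisym)
  show cl: "slice i s \<in> carrier T" by (rule gen_CuD(1)[OF slice_gen_Cu[OF i] s])
  show "endpoint S T x s \<in> carrier T" by (rule endpoint_closed[OF x(1) s])
  show "endpoint S T x s \<sqsubseteq>\<^bsub>T\<^esub> slice i s"
  proof (rule endpoint_least[OF x(1) s cl])
    fix \<psi> assume "\<psi> \<in> class_ideal x"
    then obtain j where j: "W j i" "dprec \<psi> (slice j)" unfolding x(2) slice_ideal_def by blast
    note d = dprec_trans[OF j(2) slice_dprec[OF j(1)]]
    show "\<psi> s \<sqsubseteq>\<^bsub>T\<^esub> slice i s" using dprecD(1-3)[OF d] s by (intro hom_prec_le)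
  qed
  show "slice i s \<sqsubseteq>\<^bsub>T\<^esub> endpoint S T x s"
  proof (rule has_sup_least[OF c(2) endpoint_closed[OF x(1) s]])
    fix z assume "z \<in> range (\<lambda>n. slice (c n) s)"
    then obtain n where "z = slice (c n) s" by blast
    then show "z \<sqsubseteq>\<^bsub>T\<^esub> endpoint S T x s"
      using endpoint_upper[OF x(1) s] slice_mem[OF c(1)] x(2) by simp
  qed
qed

end

section \<open>Currying one variable of a bimorphism\<close>

locale cu_curry = cu_hom S T + A: cu_sg A
  for S :: "('a, 'm) po_semigroup_scheme" and T :: "('b, 'n) po_semigroup_scheme"
    and A :: "('c, 'k) po_semigroup_scheme" +
  fixes \<phi> :: "'c \<Rightarrow> 'a \<Rightarrow> 'b"
  assumes bim: "cu_bimorphism A S T \<phi>"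
begin

definition slice :: "'c \<Rightarrow> 'a \<Rightarrow> 'b" where
  "slice a = (\<lambda>s\<in>carrier S. \<phi> a s)"

sublocale cu_slices S T "carrier A" "way_below A" slice
proof
  show "slice a \<in> gen_Cu S T" if a: "a \<in> carrier A" for a
    unfolding slice_def
  proof (rule gen_Cu_restrictI[OF _ _ _ _ _ S.cu])
    show "has_sup T (range (\<lambda>n. \<phi> a (c n))) (\<phi> a x)" if "inc_seq S c" "has_sup S (range c) x" for c x
      by (rule cu_bimorphismD(8)[OF bim A.inc_seq_const[OF a] that(1) A.has_sup_const[OF a] that(2)])
  qed (simp_all add: a cu_bimorphismD(1-7)[OF bim])
  show "\<exists>c. (\<forall>n. c n \<lless>\<^bsub>A\<^esub> c (Suc n)) \<and> (\<forall>n. c n \<lless>\<^bsub>A\<^esub> a) \<and> (\<forall>b. b \<lless>\<^bsub>A\<^esub> a \<longrightarrow> (\<exists>k. b \<lless>\<^bsub>A\<^esub> c k))"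
    if a: "a \<in> carrier A" for a
  proof -
    obtain c where c: "\<forall>n. c n \<lless>\<^bsub>A\<^esub> c (Suc n)" "has_sup A (range c) a" using A.approx_seq[OF a] by blast
    show ?thesis using c(1) A.approx_way_below[OF c] A.way_below_approx[OF _ c] by blast
  qed
  show "hom_prec S T (slice a') (slice a)" if "a' \<lless>\<^bsub>A\<^esub> a" for a' a
    unfolding hom_prec_def slice_def
    using cu_bimorphismD(9)[OF bim that] way_below_closed[of S] by simp
qed (auto dest: way_below_closed intro: A.way_below_trans)

lemma slice_add:
  assumes "a \<in> carrier A" "b \<in> carrier A" shows "slice (a \<oplus>\<^bsub>A\<^esub> b) = hom_add (slice a) (slice b)"
  unfolding slice_def hom_add_def
  by (rule restrict_ext) (simp add: assms cu_bimorphismD(4)[OF bim])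

lemma slice_zero: "slice \<zero>\<^bsub>A\<^esub> = hom_zero"
  unfolding slice_def hom_zero_def by (rule restrict_ext) (simp add: cu_bimorphismD(2)[OF bim])

lemma slice_ideal_Cu: "(\<lambda>a\<in>carrier A. slice_ideal a) \<in> Cu A completion"
proof (rule CuI[OF gen_Cu_restrictI[OF _ _ _ _ _ A.cu]])
  show "a \<in> carrier A \<Longrightarrow> slice_ideal a \<in> carrier completion" for a
    by (simp add: slice_ideal_round)
  show "slice_ideal \<zero>\<^bsub>A\<^esub> = \<zero>\<^bsub>completion\<^esub>"
  proof -
    have "a' \<lless>\<^bsub>A\<^esub> \<zero>\<^bsub>A\<^esub> \<longleftrightarrow> a' = \<zero>\<^bsub>A\<^esub>" for a'
      using A.le_zero[of a'] A.way_below_imp_le[of a' "\<zero>\<^bsub>A\<^esub>"] way_below_closed(1)[of A a']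
        A.zero_way_below[OF A.zero_closed] by auto
    then show ?thesis by (simp add: slice_ideal_def slice_zero)
  qed
  show "slice_ideal (a \<oplus>\<^bsub>A\<^esub> b) = slice_ideal a \<oplus>\<^bsub>completion\<^esub> slice_ideal b"
    if ab: "a \<in> carrier A" "b \<in> carrier A" for a b
  proof -
    have "slice_ideal (a \<oplus>\<^bsub>A\<^esub> b) = H.ideal_add (slice_ideal a) (slice_ideal b)"
    proof (intro Set.set_eqI iffI)
      fix \<psi> assume "\<psi> \<in> slice_ideal (a \<oplus>\<^bsub>A\<^esub> b)"
      then obtain c where c: "c \<lless>\<^bsub>A\<^esub> a \<oplus>\<^bsub>A\<^esub> b" "dprec \<psi> (slice c)" unfolding slice_ideal_def by blast
      obtain a' b' where a': "a' \<lless>\<^bsub>A\<^esub> a" "b' \<lless>\<^bsub>A\<^esub> b" "c \<lless>\<^bsub>A\<^esub> a' \<oplus>\<^bsub>A\<^esub> b'"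
        by (rule A.way_below_add_split[OF c(1) ab])
      have "dprec \<psi> (hom_add (slice a') (slice b'))"
        using dprec_trans[OF c(2) slice_dprec[OF a'(3)]]
        by (simp add: slice_add way_below_closed(1)[OF a'(1)] way_below_closed(1)[OF a'(2)])
      then show "\<psi> \<in> H.ideal_add (slice_ideal a) (slice_ideal b)"
        unfolding H.ideal_add_def using slice_mem a' by blast
    next
      fix \<psi> assume "\<psi> \<in> H.ideal_add (slice_ideal a) (slice_ideal b)"
      then obtain \<alpha> \<beta> a' b' where *: "a' \<lless>\<^bsub>A\<^esub> a" "b' \<lless>\<^bsub>A\<^esub> b" "dprec \<alpha> (slice a')" "dprec \<beta> (slice b')"
        "dprec \<psi> (hom_add \<alpha> \<beta>)" unfolding H.ideal_add_def slice_ideal_def by blast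
      have "dprec \<psi> (slice (a' \<oplus>\<^bsub>A\<^esub> b'))"
        using dprec_trans[OF *(5) H.R_ad[OF *(3,4)]]
        by (simp add: slice_add way_below_closed(1)[OF *(1)] way_below_closed(1)[OF *(2)])
      then show "\<psi> \<in> slice_ideal (a \<oplus>\<^bsub>A\<^esub> b)"
        unfolding slice_ideal_def using A.way_below_add[OF *(1,2)] by blast
    qed
    then show ?thesis by simp
  qed
  show mono: "slice_ideal a \<sqsubseteq>\<^bsub>completion\<^esub> slice_ideal b"
    if "a \<in> carrier A" "b \<in> carrier A" "a \<sqsubseteq>\<^bsub>A\<^esub> b" for a b
    using A.le_trans_way_below[OF _ that(3,2)] unfolding slice_ideal_def by auto
  show "has_sup completion (range (\<lambda>n. slice_ideal (c n))) (slice_ideal x)"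
    if c: "inc_seq A c" "has_sup A (range c) x" for c x
  proof (subst H.has_sup_completion_iff)
    show "H.round_ideal (slice_ideal (c n))" for n by (rule slice_ideal_round[OF inc_seq_closed[OF c(1)]])
    show "slice_ideal (c n) \<subseteq> slice_ideal (c (Suc n))" for n
      using mono[OF inc_seq_closed[OF c(1)] inc_seq_closed[OF c(1)]] c(1) by (simp add: inc_seq_def)
    show "slice_ideal x = (\<Union>n. slice_ideal (c n))"
    proof (intro Set.set_eqI iffI)
      fix \<psi> assume "\<psi> \<in> slice_ideal x"
      then obtain a' where a': "a' \<lless>\<^bsub>A\<^esub> x" "dprec \<psi> (slice a')" unfolding slice_ideal_def by blast
      then show "\<psi> \<in> (\<Union>n. slice_ideal (c n))"
        unfolding slice_ideal_def using A.way_below_sup_strong[OF a'(1) c] by blast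
    next
      fix \<psi> assume "\<psi> \<in> (\<Union>n. slice_ideal (c n))"
      then obtain n where n: "\<psi> \<in> slice_ideal (c n)" by blast
      have "c n \<sqsubseteq>\<^bsub>A\<^esub> x" using has_sup_upper[OF c(2)] by blast
      then show "\<psi> \<in> slice_ideal x"
        using n mono[OF inc_seq_closed[OF c(1)] has_sup_closed[OF c(2)]] by auto
    qed
  qed
next
  fix a' a assume a: "a' \<lless>\<^bsub>A\<^esub> a"
  show "(\<lambda>a\<in>carrier A. slice_ideal a) a' \<lless>\<^bsub>completion\<^esub> (\<lambda>a\<in>carrier A. slice_ideal a) a"
    using slice_ideal_way_below[OF a] by (simp add: way_below_closed[OF a])
qed

lemma curry_exists: "\<exists>\<alpha>\<in>Cu A (ihom S T). \<forall>a\<in>carrier A. \<forall>s\<in>carrier S. endpoint S T (\<alpha> a) s = \<phi> a s"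
proof -
  obtain \<kappa> where \<kappa>: "\<kappa> \<in> Cu completion (ihom S T)" "\<And>I. H.round_ideal I \<Longrightarrow> class_ideal (\<kappa> I) = I"
    using completion_section by metis
  let ?\<alpha> = "\<lambda>a\<in>carrier A. \<kappa> ((\<lambda>a\<in>carrier A. slice_ideal a) a)"
  have \<alpha>: "?\<alpha> \<in> Cu A (ihom S T)" by (rule Cu_comp[OF slice_ideal_Cu \<kappa>(1) A.cu])
  have "endpoint S T (?\<alpha> a) s = \<phi> a s" if a: "a \<in> carrier A" and s: "s \<in> carrier S" for a s
  proof -
    obtain c where c: "\<forall>n. c n \<lless>\<^bsub>A\<^esub> c (Suc n)" "has_sup A (range c) a" using A.approx_seq[OF a] by blast
    have "has_sup T (range (\<lambda>n. \<phi> (c n) s)) (\<phi> a s)"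
      by (rule cu_bimorphismD(8)[OF bim A.way_below_seq_inc[OF c(1)] S.inc_seq_const[OF s] c(2) S.has_sup_const[OF s]])
    then have "endpoint S T (?\<alpha> a) s = slice a s"
      using s a gen_CuD(1)[OF Cu_gen[OF \<alpha>] a] A.approx_way_below[OF c]
      by (intro endpoint_slice[where c = c]) (simp_all add: slice_def \<kappa>(2) slice_ideal_round)
    then show ?thesis using s by (simp add: slice_def)
  qed
  then show ?thesis using \<alpha> by blast
qed

end

text \<open>A map of three variables that preserves way-below jointly. Fixing one of the variables
  would lose this property, so the first two are curried simultaneously into a bimorphism.\<close>

locale cu_curry2 = cu_hom S T + A: cu_sg A + B: cu_sg B
  for S :: "('a, 'm) po_semigroup_scheme" and T :: "('b, 'n) po_semigroup_scheme"
    and A :: "('c, 'k) po_semigroup_scheme" and B :: "('d, 'l) po_semigroup_scheme" +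
  fixes \<phi> :: "'c \<Rightarrow> 'd \<Rightarrow> 'a \<Rightarrow> 'b"
  assumes tri_closed: "a \<in> carrier A \<Longrightarrow> b \<in> carrier B \<Longrightarrow> s \<in> carrier S \<Longrightarrow> \<phi> a b s \<in> carrier T"
    and tri_add1: "a \<in> carrier A \<Longrightarrow> a' \<in> carrier A \<Longrightarrow> b \<in> carrier B \<Longrightarrow> s \<in> carrier S \<Longrightarrow>
      \<phi> (a \<oplus>\<^bsub>A\<^esub> a') b s = \<phi> a b s \<oplus>\<^bsub>T\<^esub> \<phi> a' b s"
    and tri_add2: "a \<in> carrier A \<Longrightarrow> b \<in> carrier B \<Longrightarrow> b' \<in> carrier B \<Longrightarrow> s \<in> carrier S \<Longrightarrow>
      \<phi> a (b \<oplus>\<^bsub>B\<^esub> b') s = \<phi> a b s \<oplus>\<^bsub>T\<^esub> \<phi> a b' s"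
    and tri_add3: "a \<in> carrier A \<Longrightarrow> b \<in> carrier B \<Longrightarrow> s \<in> carrier S \<Longrightarrow> s' \<in> carrier S \<Longrightarrow>
      \<phi> a b (s \<oplus>\<^bsub>S\<^esub> s') = \<phi> a b s \<oplus>\<^bsub>T\<^esub> \<phi> a b s'"
    and tri_zero1: "b \<in> carrier B \<Longrightarrow> s \<in> carrier S \<Longrightarrow> \<phi> \<zero>\<^bsub>A\<^esub> b s = \<zero>\<^bsub>T\<^esub>"
    and tri_zero2: "a \<in> carrier A \<Longrightarrow> s \<in> carrier S \<Longrightarrow> \<phi> a \<zero>\<^bsub>B\<^esub> s = \<zero>\<^bsub>T\<^esub>"
    and tri_zero3: "a \<in> carrier A \<Longrightarrow> b \<in> carrier B \<Longrightarrow> \<phi> a b \<zero>\<^bsub>S\<^esub> = \<zero>\<^bsub>T\<^esub>"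
    and tri_mono3: "a \<in> carrier A \<Longrightarrow> b \<in> carrier B \<Longrightarrow> s \<in> carrier S \<Longrightarrow> s' \<in> carrier S \<Longrightarrow> s \<sqsubseteq>\<^bsub>S\<^esub> s' \<Longrightarrow>
      \<phi> a b s \<sqsubseteq>\<^bsub>T\<^esub> \<phi> a b s'"
    and tri_sup: "inc_seq A as \<Longrightarrow> inc_seq B bs \<Longrightarrow> inc_seq S ss \<Longrightarrow> has_sup A (range as) a \<Longrightarrow>
      has_sup B (range bs) b \<Longrightarrow> has_sup S (range ss) s \<Longrightarrow> has_sup T (range (\<lambda>n. \<phi> (as n) (bs n) (ss n))) (\<phi> a b s)"
    and tri_way_below: "a' \<lless>\<^bsub>A\<^esub> a \<Longrightarrow> b' \<lless>\<^bsub>B\<^esub> b \<Longrightarrow> s' \<lless>\<^bsub>S\<^esub> s \<Longrightarrow> \<phi> a' b' s' \<lless>\<^bsub>T\<^esub> \<phi> a b s"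
begin

definition slice :: "'c \<times> 'd \<Rightarrow> 'a \<Rightarrow> 'b" where
  "slice i = (\<lambda>s\<in>carrier S. \<phi> (fst i) (snd i) s)"

definition W :: "'c \<times> 'd \<Rightarrow> 'c \<times> 'd \<Rightarrow> bool" where
  "W j i \<longleftrightarrow> fst j \<lless>\<^bsub>A\<^esub> fst i \<and> snd j \<lless>\<^bsub>B\<^esub> snd i"

lemma W_sup:
  assumes "a' \<lless>\<^bsub>A\<^esub> a" "b' \<lless>\<^bsub>B\<^esub> b" "inc_seq A c" "inc_seq B d" "has_sup A (range c) a" "has_sup B (range d) b"
  shows "\<exists>k. a' \<lless>\<^bsub>A\<^esub> c k \<and> b' \<lless>\<^bsub>B\<^esub> d k"
proof -
  obtain i j where "a' \<lless>\<^bsub>A\<^esub> c i" "b' \<lless>\<^bsub>B\<^esub> d j"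
    using A.way_below_sup_strong[OF assms(1,3,5)] B.way_below_sup_strong[OF assms(2,4,6)] by blast
  then have "a' \<lless>\<^bsub>A\<^esub> c (max i j)" "b' \<lless>\<^bsub>B\<^esub> d (max i j)"
    by (auto elim!: A.le_trans_way_below B.le_trans_way_below intro!: A.inc_seqD[OF assms(3)] B.inc_seqD[OF assms(4)]
        inc_seq_closed[OF assms(3)] inc_seq_closed[OF assms(4)])
  then show ?thesis by blast
qed

sublocale cu_slices S T "carrier A \<times> carrier B" W slice
proof
  show "slice i \<in> gen_Cu S T" if "i \<in> carrier A \<times> carrier B" for i
    unfolding slice_def
  proof (rule gen_Cu_restrictI[OF _ _ _ _ _ S.cu])
    have i: "fst i \<in> carrier A" "snd i \<in> carrier B" using that by auto
    show "has_sup T (range (\<lambda>n. \<phi> (fst i) (snd i) (c n))) (\<phi> (fst i) (snd i) x)"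
      if "inc_seq S c" "has_sup S (range c) x" for c x
      by (rule tri_sup[OF A.inc_seq_const[OF i(1)] B.inc_seq_const[OF i(2)] that(1)
            A.has_sup_const[OF i(1)] B.has_sup_const[OF i(2)] that(2)])
  qed (use that in \<open>auto simp: tri_closed tri_add3 tri_zero3 tri_mono3\<close>)
  show "\<exists>c. (\<forall>n. W (c n) (c (Suc n))) \<and> (\<forall>n. W (c n) i) \<and> (\<forall>j. W j i \<longrightarrow> (\<exists>k. W j (c k)))"
    if i: "i \<in> carrier A \<times> carrier B" for i
  proof -
    have i: "fst i \<in> carrier A" "snd i \<in> carrier B" using that by auto
    obtain c where c: "\<forall>n. c n \<lless>\<^bsub>A\<^esub> c (Suc n)" "has_sup A (range c) (fst i)" using A.approx_seq[OF i(1)] by blast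
    obtain d where d: "\<forall>n. d n \<lless>\<^bsub>B\<^esub> d (Suc n)" "has_sup B (range d) (snd i)" using B.approx_seq[OF i(2)] by blast
    have "\<exists>k. W j (c k, d k)" if "W j i" for j
      using W_sup[OF _ _ A.way_below_seq_inc[OF c(1)] B.way_below_seq_inc[OF d(1)] c(2) d(2)] that
      unfolding W_def by auto
    then show ?thesis
      using c(1) d(1) A.approx_way_below[OF c] B.approx_way_below[OF d]
      by (intro exI[of _ "\<lambda>n. (c n, d n)"]) (auto simp: W_def)
  qed
  show "hom_prec S T (slice j) (slice i)" if "W j i" for j i
    unfolding hom_prec_def slice_def
    using tri_way_below that way_below_closed[of S] unfolding W_def by simp
  show "W k j \<Longrightarrow> W j i \<Longrightarrow> W k i" for k j i
    unfolding W_def using A.way_below_trans B.way_below_trans by blast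
  show "W j i \<Longrightarrow> j \<in> carrier A \<times> carrier B \<and> i \<in> carrier A \<times> carrier B" for j i
    unfolding W_def by (auto simp: mem_Times_iff dest: way_below_closed)
qed

lemma slice_add1:
  assumes "a \<in> carrier A" "a' \<in> carrier A" "b \<in> carrier B"
  shows "slice (a \<oplus>\<^bsub>A\<^esub> a', b) = hom_add (slice (a, b)) (slice (a', b))"
  unfolding slice_def hom_add_def by (rule restrict_ext) (simp add: assms tri_add1)

lemma slice_ideal_pair: "slice_ideal (a, b) = {\<psi>. \<exists>a' b'. a' \<lless>\<^bsub>A\<^esub> a \<and> b' \<lless>\<^bsub>B\<^esub> b \<and> dprec \<psi> (slice (a', b'))}"
  unfolding slice_ideal_def W_def by force

lemma slice_ideal_add1:
  assumes "a \<in> carrier A" "a' \<in> carrier A" "b \<in> carrier B"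
  shows "slice_ideal (a \<oplus>\<^bsub>A\<^esub> a', b) = H.ideal_add (slice_ideal (a, b)) (slice_ideal (a', b))"
proof (intro Set.set_eqI iffI)
  fix \<psi> assume "\<psi> \<in> slice_ideal (a \<oplus>\<^bsub>A\<^esub> a', b)"
  then obtain c d where c: "c \<lless>\<^bsub>A\<^esub> a \<oplus>\<^bsub>A\<^esub> a'" "d \<lless>\<^bsub>B\<^esub> b" "dprec \<psi> (slice (c, d))" unfolding slice_ideal_pair by blast
  \<comment> \<open>Both coordinates have to move for \<open>W\<close> to apply, so \<open>d\<close>
    is raised to an interpolant while \<open>c\<close> is split.\<close>
  obtain e where e: "d \<lless>\<^bsub>B\<^esub> e" "e \<lless>\<^bsub>B\<^esub> b" using c(2) by (rule B.way_below_interp)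
  obtain f f' where f: "f \<lless>\<^bsub>A\<^esub> a" "f' \<lless>\<^bsub>A\<^esub> a'" "c \<lless>\<^bsub>A\<^esub> f \<oplus>\<^bsub>A\<^esub> f'"
    by (rule A.way_below_add_split[OF c(1) assms(1,2)])
  have w: "W (c, d) (f \<oplus>\<^bsub>A\<^esub> f', e)" using f e by (simp add: W_def)
  have "dprec \<psi> (hom_add (slice (f, e)) (slice (f', e)))"
    using dprec_trans[OF c(3) slice_dprec[OF w]]
    by (simp add: slice_add1 way_below_closed(1)[OF f(1)] way_below_closed(1)[OF f(2)] way_below_closed(1)[OF e(2)])
  moreover have "slice (f, e) \<in> slice_ideal (a, b)" "slice (f', e) \<in> slice_ideal (a', b)"
    using f e by (auto intro!: slice_mem simp: W_def)
  ultimately show "\<psi> \<in> H.ideal_add (slice_ideal (a, b)) (slice_ideal (a', b))"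
    unfolding H.ideal_add_def by blast
next
  fix \<psi> assume "\<psi> \<in> H.ideal_add (slice_ideal (a, b)) (slice_ideal (a', b))"
  then obtain \<alpha> \<beta> c d c' d' where *: "c \<lless>\<^bsub>A\<^esub> a" "d \<lless>\<^bsub>B\<^esub> b" "dprec \<alpha> (slice (c, d))"
    "c' \<lless>\<^bsub>A\<^esub> a'" "d' \<lless>\<^bsub>B\<^esub> b" "dprec \<beta> (slice (c', d'))" "dprec \<psi> (hom_add \<alpha> \<beta>)"
    unfolding H.ideal_add_def slice_ideal_pair by blast
  \<comment> \<open>The summands arrive with different second coordinates; a common \<open>e\<close>
    above both makes \<open>slice_add1\<close> applicable.\<close>
  obtain e where e: "d \<lless>\<^bsub>B\<^esub> e" "d' \<lless>\<^bsub>B\<^esub> e" "e \<lless>\<^bsub>B\<^esub> b" by (rule B.way_below_directed[OF *(2,5)])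
  obtain f where f: "c \<lless>\<^bsub>A\<^esub> f" "f \<lless>\<^bsub>A\<^esub> a" using *(1) by (rule A.way_below_interp)
  obtain f' where f': "c' \<lless>\<^bsub>A\<^esub> f'" "f' \<lless>\<^bsub>A\<^esub> a'" using *(4) by (rule A.way_below_interp)
  have "dprec \<alpha> (slice (f, e))" "dprec \<beta> (slice (f', e))"
    using dprec_trans[OF *(3) slice_dprec] dprec_trans[OF *(6) slice_dprec] e f f' by (simp_all add: W_def)
  then have "dprec \<psi> (slice (f \<oplus>\<^bsub>A\<^esub> f', e))"
    using dprec_trans[OF *(7) H.R_ad]
    by (simp add: slice_add1 way_below_closed(1)[OF f(2)] way_below_closed(1)[OF f'(2)] way_below_closed(1)[OF e(3)])
  then show "\<psi> \<in> slice_ideal (a \<oplus>\<^bsub>A\<^esub> a', b)"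
    unfolding slice_ideal_pair using A.way_below_add[OF f(2) f'(2)] e(3) by blast
qed

lemma slice_ideal_zero1:
  assumes b: "b \<in> carrier B" shows "slice_ideal (\<zero>\<^bsub>A\<^esub>, b) = \<zero>\<^bsub>completion\<^esub>"
proof -
  have "a' \<lless>\<^bsub>A\<^esub> \<zero>\<^bsub>A\<^esub> \<longleftrightarrow> a' = \<zero>\<^bsub>A\<^esub>" for a'
    using A.le_zero[of a'] A.way_below_imp_le[of a' "\<zero>\<^bsub>A\<^esub>"] way_below_closed(1)[of A a']
      A.zero_way_below[OF A.zero_closed] by auto
  moreover have "slice (\<zero>\<^bsub>A\<^esub>, b') = hom_zero" if "b' \<lless>\<^bsub>B\<^esub> b" for b'
    unfolding slice_def hom_zero_def
    by (rule restrict_ext) (simp add: tri_zero1 way_below_closed[OF that])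
  ultimately show ?thesis using B.zero_way_below[OF b] by (auto simp: slice_ideal_pair)
qed

text \<open>By symmetry of the hypotheses, the laws in the second variable are those of the first
  variable for the swapped map.\<close>

lemma cu_curry2_swap: "cu_curry2 S T B A (\<lambda>b a. \<phi> a b)"
  by unfold_locales
    (simp_all add: tri_closed tri_add1 tri_add2 tri_add3 tri_zero1 tri_zero2 tri_zero3 tri_mono3 tri_sup tri_way_below)

lemma slice_ideal_swap:
  "slice_ideal (a, b) = cu_slices.slice_ideal S T (cu_curry2.W B A) (cu_curry2.slice S (\<lambda>b a. \<phi> a b)) (b, a)"
proof -
  interpret swap: cu_curry2 S T B A "\<lambda>b a. \<phi> a b" by (rule cu_curry2_swap)
  show ?thesis
    unfolding slice_ideal_pair swap.slice_ideal_pair by (auto simp: slice_def swap.slice_def)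
qed

lemma slice_ideal_mono:
  assumes "a \<sqsubseteq>\<^bsub>A\<^esub> a'" "b \<sqsubseteq>\<^bsub>B\<^esub> b'" "a' \<in> carrier A" "b' \<in> carrier B"
  shows "slice_ideal (a, b) \<subseteq> slice_ideal (a', b')"
  unfolding slice_ideal_pair
  using A.le_trans_way_below[OF _ assms(1,3)] B.le_trans_way_below[OF _ assms(2,4)] by blast

lemma slice_ideal_bimorphism: "cu_bimorphism A B completion (\<lambda>a b. slice_ideal (a, b))"
proof (rule cu_bimorphismI)
  interpret swap: cu_curry2 S T B A "\<lambda>b a. \<phi> a b" by (rule cu_curry2_swap)
  show "slice_ideal (a, \<zero>\<^bsub>B\<^esub>) = \<zero>\<^bsub>completion\<^esub>" if "a \<in> carrier A" for a
    unfolding slice_ideal_swap by (rule swap.slice_ideal_zero1[OF that])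
  show "slice_ideal (a, b \<oplus>\<^bsub>B\<^esub> b') = slice_ideal (a, b) \<oplus>\<^bsub>completion\<^esub> slice_ideal (a, b')"
    if "a \<in> carrier A" "b \<in> carrier B" "b' \<in> carrier B" for a b b'
    unfolding slice_ideal_swap using swap.slice_ideal_add1[OF that(2,3,1)] by simp
  show "has_sup completion (range (\<lambda>k. slice_ideal (c k, d k))) (slice_ideal (x, y))"
    if *: "inc_seq A c" "inc_seq B d" "has_sup A (range c) x" "has_sup B (range d) y" for c d x y
  proof (subst H.has_sup_completion_iff)
    note cl = inc_seq_closed[OF *(1)] inc_seq_closed[OF *(2)]
    show "H.round_ideal (slice_ideal (c n, d n))" for n by (rule slice_ideal_round) (simp add: cl)
    show "slice_ideal (c n, d n) \<subseteq> slice_ideal (c (Suc n), d (Suc n))" for n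
      using *(1,2) by (intro slice_ideal_mono cl) (simp_all add: inc_seq_def)
    show "slice_ideal (x, y) = (\<Union>n. slice_ideal (c n, d n))"
    proof (intro Set.set_eqI iffI)
      fix \<psi> assume "\<psi> \<in> slice_ideal (x, y)"
      then obtain a' b' where a': "a' \<lless>\<^bsub>A\<^esub> x" "b' \<lless>\<^bsub>B\<^esub> y" "dprec \<psi> (slice (a', b'))" unfolding slice_ideal_pair by blast
      then show "\<psi> \<in> (\<Union>n. slice_ideal (c n, d n))"
        unfolding slice_ideal_pair using W_sup[OF a'(1,2) *] by blast
    next
      fix \<psi> assume "\<psi> \<in> (\<Union>n. slice_ideal (c n, d n))"
      then obtain n where n: "\<psi> \<in> slice_ideal (c n, d n)" by blast
      have "c n \<sqsubseteq>\<^bsub>A\<^esub> x" "d n \<sqsubseteq>\<^bsub>B\<^esub> y" using has_sup_upper[OF *(3)] has_sup_upper[OF *(4)] by blast+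
      then show "\<psi> \<in> slice_ideal (x, y)"
        using slice_ideal_mono[OF _ _ has_sup_closed[OF *(3)] has_sup_closed[OF *(4)]] n by blast
    qed
  qed
  show "slice_ideal (a', b') \<lless>\<^bsub>completion\<^esub> slice_ideal (a, b)" if "a' \<lless>\<^bsub>A\<^esub> a" "b' \<lless>\<^bsub>B\<^esub> b" for a' a b' b
    by (rule slice_ideal_way_below) (simp add: W_def that)
qed (simp_all add: slice_ideal_round slice_ideal_zero1 slice_ideal_add1 slice_ideal_mono)

lemma curry2_exists:
  "\<exists>\<beta>. cu_bimorphism A B (ihom S T) \<beta> \<and>
    (\<forall>a\<in>carrier A. \<forall>b\<in>carrier B. \<forall>s\<in>carrier S. endpoint S T (\<beta> a b) s = \<phi> a b s)"
proof -
  obtain \<kappa> where \<kappa>: "\<kappa> \<in> Cu completion (ihom S T)" "\<And>I. H.round_ideal I \<Longrightarrow> class_ideal (\<kappa> I) = I"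
    using completion_section by metis
  let ?\<beta> = "\<lambda>a b. \<kappa> (slice_ideal (a, b))"
  have \<beta>: "cu_bimorphism A B (ihom S T) ?\<beta>"
    by (rule cu_bimorphism_cong[OF cu_bimorphism_comp[OF H.cu_semigroup_completion slice_ideal_bimorphism
            Cu_id[OF A.cu] Cu_id[OF B.cu] \<kappa>(1)] A.cu B.cu]) simp
  have "endpoint S T (?\<beta> a b) s = \<phi> a b s"
    if a: "a \<in> carrier A" and b: "b \<in> carrier B" and s: "s \<in> carrier S" for a b s
  proof -
    obtain c where c: "\<forall>n. c n \<lless>\<^bsub>A\<^esub> c (Suc n)" "has_sup A (range c) a" using A.approx_seq[OF a] by blast
    obtain d where d: "\<forall>n. d n \<lless>\<^bsub>B\<^esub> d (Suc n)" "has_sup B (range d) b" using B.approx_seq[OF b] by blast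
    have "has_sup T (range (\<lambda>n. \<phi> (c n) (d n) s)) (\<phi> a b s)"
      by (rule tri_sup[OF A.way_below_seq_inc[OF c(1)] B.way_below_seq_inc[OF d(1)] S.inc_seq_const[OF s]
            c(2) d(2) S.has_sup_const[OF s]])
    then have "endpoint S T (?\<beta> a b) s = slice (a, b) s"
      using s a b cu_bimorphismD(1)[OF \<beta> a b] A.approx_way_below[OF c] B.approx_way_below[OF d]
      by (intro endpoint_slice[where c = "\<lambda>n. (c n, d n)"]) (simp_all add: slice_def W_def \<kappa>(2) slice_ideal_round)
    then show ?thesis using s by (simp add: slice_def)
  qed
  then show ?thesis using \<beta> by blast
qed

end

section \<open>The adjunction, evaluation and associator for the chosen tensor product\<close>

lemma cu_pairI: "cu_semigroup S \<Longrightarrow> cu_semigroup T \<Longrightarrow> cu_pair S T"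
  by (simp add: cu_pair_def cu_sg_def)

lemma cu_homI: "cu_semigroup S \<Longrightarrow> cu_semigroup T \<Longrightarrow> cu_hom S T"
  by (simp add: cu_hom_def cu_sg_def)

lemmas cu_tensor_cu = cu_pair.cu_semigroup_tensor[OF cu_pairI]
lemmas cu_ihom_cu = cu_hom.cu_semigroup_ihom[OF cu_homI]
lemmas pure_bim = cu_pair.pure_tensor_bimorphism[OF cu_pairI]
lemmas pure_closed = cu_bimorphismD(1)[OF pure_bim]
lemmas tensor_lift_Cu = cu_pair.tensor_lift(1)[OF cu_pairI]
lemmas tensor_lift_pure = cu_pair.tensor_lift(2)[OF cu_pairI]
lemmas tensor_ext = cu_pair.tensor_eqI[OF cu_pairI]
lemmas endpoint_bim = cu_hom.endpoint_bimorphism[OF cu_homI]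

lemma bimorphism_precomp:
  assumes "cu_semigroup A" "cu_semigroup S" "cu_semigroup S'" "cu_semigroup T"
    and "cu_bimorphism S' S T \<phi>" "\<alpha> \<in> Cu A S'"
  shows "cu_bimorphism A S T (\<lambda>a s. \<phi> (\<alpha> a) s)"
  by (rule cu_bimorphism_cong[OF cu_bimorphism_comp[OF assms(4,5,6) Cu_id[OF assms(2)] Cu_id[OF assms(4)]] assms(1,2)])
    (simp add: cu_bimorphismD(1)[OF assms(5)] gen_CuD(1)[OF Cu_gen[OF assms(6)]])

lemma bimorphism_postcomp:
  assumes "cu_semigroup S" "cu_semigroup T" "cu_semigroup P"
    and "cu_bimorphism S T P \<phi>" "\<gamma> \<in> Cu P P'"
  shows "cu_bimorphism S T P' (\<lambda>a b. \<gamma> (\<phi> a b))"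
  by (rule cu_bimorphism_cong[OF cu_bimorphism_comp[OF assms(3,4) Cu_id[OF assms(1)] Cu_id[OF assms(2)] assms(5)] assms(1,2)])
    simp

context
  fixes A :: "('c, 'k) po_semigroup_scheme" and S :: "('a, 'm) po_semigroup_scheme"
    and T :: "('b, 'n) po_semigroup_scheme"
  assumes A: "cu_semigroup A" and S: "cu_semigroup S" and T: "cu_semigroup T"
begin

lemma uncurry_bim:
  "\<alpha> \<in> Cu A (ihom S T) \<Longrightarrow> cu_bimorphism A S T (\<lambda>a s. endpoint S T (\<alpha> a) s)"
  by (rule bimorphism_precomp[OF A S cu_ihom_cu[OF S T] T endpoint_bim[OF S T]])

lemma ihom_uncurry:
  assumes "\<alpha> \<in> Cu A (ihom S T)"
  shows "ihom_uncurry A S T \<alpha> \<in> Cu (cu_tensor A S) T"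
    and "a \<in> carrier A \<Longrightarrow> s \<in> carrier S \<Longrightarrow> ihom_uncurry A S T \<alpha> (pure_tensor A S a s) = endpoint S T (\<alpha> a) s"
  unfolding ihom_uncurry_def
  using tensor_lift_Cu[OF A S T uncurry_bim[OF assms]] tensor_lift_pure[OF A S T uncurry_bim[OF assms]] by auto

lemma ihom_uncurry_inj: "inj_on (ihom_uncurry A S T) (Cu A (ihom S T))"
proof (rule inj_onI)
  fix \<alpha> \<beta> assume *: "\<alpha> \<in> Cu A (ihom S T)" "\<beta> \<in> Cu A (ihom S T)" "ihom_uncurry A S T \<alpha> = ihom_uncurry A S T \<beta>"
  show "\<alpha> = \<beta>"
    by (rule cu_hom.Cu_eq_if_endpoints_eq[OF cu_homI[OF S T] A *(1,2)])
      (simp add: *(3) ihom_uncurry(2)[OF *(1), symmetric] ihom_uncurry(2)[OF *(2), symmetric])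
qed

text \<open>The inverse is computed by exhibiting a preimage: currying \<open>a\<close> and
  \<open>s\<close> sent to \<open>G\<close> of their pure tensor gives a morphism whose uncurried
  form agrees with \<open>G\<close> on pure tensors. Injectivity of uncurrying then identifies
  it.\<close>

lemma ihom_curry:
  assumes G: "G \<in> Cu (cu_tensor A S) T"
  shows "ihom_curry A S T G \<in> Cu A (ihom S T)"
    and "a \<in> carrier A \<Longrightarrow> s \<in> carrier S \<Longrightarrow> endpoint S T (ihom_curry A S T G a) s = G (pure_tensor A S a s)"
proof -
  have bim: "cu_bimorphism A S T (\<lambda>a s. G (pure_tensor A S a s))"
    by (rule bimorphism_postcomp[OF A S cu_tensor_cu[OF A S] pure_bim[OF A S] G])
  have "cu_curry S T A (\<lambda>a s. G (pure_tensor A S a s))"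
    by (simp add: cu_curry_def cu_curry_axioms_def cu_homI S T A bim cu_sg_def)
  then obtain \<alpha> where \<alpha>: "\<alpha> \<in> Cu A (ihom S T)"
    "\<And>a s. a \<in> carrier A \<Longrightarrow> s \<in> carrier S \<Longrightarrow> endpoint S T (\<alpha> a) s = G (pure_tensor A S a s)"
    using cu_curry.curry_exists by blast
  have "ihom_uncurry A S T \<alpha> = G"
    by (rule tensor_ext[OF A S T ihom_uncurry(1)[OF \<alpha>(1)] G]) (simp add: ihom_uncurry(2)[OF \<alpha>(1)] \<alpha>(2))
  then have "ihom_curry A S T G = \<alpha>"
    unfolding ihom_curry_def using the_inv_into_f_f[OF ihom_uncurry_inj \<alpha>(1)] by simp
  then show "ihom_curry A S T G \<in> Cu A (ihom S T)"
    "a \<in> carrier A \<Longrightarrow> s \<in> carrier S \<Longrightarrow> endpoint S T (ihom_curry A S T G a) s = G (pure_tensor A S a s)"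
    using \<alpha> by simp_all
qed

end

lemma evaluation:
  assumes S: "cu_semigroup S" and T: "cu_semigroup T"
  shows "evaluation S T \<in> Cu (cu_tensor (ihom S T) S) T"
    and "x \<in> carrier (ihom S T) \<Longrightarrow> s \<in> carrier S \<Longrightarrow>
      evaluation S T (pure_tensor (ihom S T) S x s) = endpoint S T x s"
  unfolding evaluation_def
  using ihom_uncurry[OF cu_ihom_cu[OF S T] S T Cu_id[OF cu_ihom_cu[OF S T]]] by simp_all

lemma tensor_map:
  assumes S: "cu_semigroup S" and T: "cu_semigroup T" and S': "cu_semigroup S'" and T': "cu_semigroup T'"
    and \<alpha>: "\<alpha> \<in> Cu S S'" and \<beta>: "\<beta> \<in> Cu T T'"
  shows "tensor_map S T S' T' \<alpha> \<beta> \<in> Cu (cu_tensor S T) (cu_tensor S' T')"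
    and "a \<in> carrier S \<Longrightarrow> b \<in> carrier T \<Longrightarrow>
      tensor_map S T S' T' \<alpha> \<beta> (pure_tensor S T a b) = pure_tensor S' T' (\<alpha> a) (\<beta> b)"
proof -
  note X = cu_tensor_cu[OF S' T']
  have bim: "cu_bimorphism S T (cu_tensor S' T') (\<lambda>a b. pure_tensor S' T' (\<alpha> a) (\<beta> b))"
    by (rule cu_bimorphism_cong[OF cu_bimorphism_comp[OF X pure_bim[OF S' T'] \<alpha> \<beta> Cu_id[OF X]] S T])
      (simp add: pure_closed[OF S' T'] gen_CuD(1)[OF Cu_gen[OF \<alpha>]] gen_CuD(1)[OF Cu_gen[OF \<beta>]])
  then show "tensor_map S T S' T' \<alpha> \<beta> \<in> Cu (cu_tensor S T) (cu_tensor S' T')"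
    "a \<in> carrier S \<Longrightarrow> b \<in> carrier T \<Longrightarrow>
      tensor_map S T S' T' \<alpha> \<beta> (pure_tensor S T a b) = pure_tensor S' T' (\<alpha> a) (\<beta> b)"
    unfolding tensor_map_def
    using tensor_lift_Cu[OF S T X bim] tensor_lift_pure[OF S T X bim] by auto
qed

text \<open>
  For fixed \<open>c\<close> the map \<open>(a, b) \<mapsto> a \<otimes> (b \<otimes> c)\<close> need not preserve \<open>\<lless>\<close>, so the associator is not obtained
  by lifting in two variables at a time; it is obtained by currying the third variable into an internal hom.
\<close>

lemma tensor_assoc:
  assumes S: "cu_semigroup S" and T: "cu_semigroup T" and P: "cu_semigroup P"
  shows "tensor_assoc S T P \<in> Cu (cu_tensor (cu_tensor S T) P) (cu_tensor S (cu_tensor T P))" (is "_ \<in> ?C")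
    and "a \<in> carrier S \<Longrightarrow> b \<in> carrier T \<Longrightarrow> c \<in> carrier P \<Longrightarrow>
      tensor_assoc S T P (pure_tensor (cu_tensor S T) P (pure_tensor S T a b) c) =
      pure_tensor S (cu_tensor T P) a (pure_tensor T P b c)"
proof -
  note ST = cu_tensor_cu[OF S T] and TP = cu_tensor_cu[OF T P]
  note X = cu_tensor_cu[OF S TP]
  let ?X = "cu_tensor S (cu_tensor T P)" and ?ST = "cu_tensor S T"
  let ?\<phi> = "\<lambda>a b c. pure_tensor S (cu_tensor T P) a (pure_tensor T P b c)"
  let ?Q = "\<lambda>\<gamma>. \<gamma> \<in> ?C \<and> (\<forall>a\<in>carrier S. \<forall>b\<in>carrier T. \<forall>c\<in>carrier P.
      \<gamma> (pure_tensor ?ST P (pure_tensor S T a b) c) = ?\<phi> a b c)"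
  note pTP = cu_bimorphismD[OF pure_bim[OF T P]] and pX = cu_bimorphismD[OF pure_bim[OF S TP]]
  interpret cu_curry2 P ?X S T ?\<phi>
  proof unfold_locales
    show "has_sup ?X (range (\<lambda>n. ?\<phi> (as n) (bs n) (ss n))) (?\<phi> a b s)"
      if *: "inc_seq S as" "inc_seq T bs" "inc_seq P ss" "has_sup S (range as) a"
        "has_sup T (range bs) b" "has_sup P (range ss) s" for as bs ss a b s
      by (rule pX(8)[OF *(1) cu_bimorphism_inc_seq[OF pure_bim[OF T P] TP *(2,3)] *(4) pTP(8)[OF *(2,3,5,6)]])
  qed (use S T P X in \<open>simp_all add: pTP(1-7) pX(1-7) pTP(9) pX(9)\<close>)
  obtain \<beta> where \<beta>: "cu_bimorphism S T (ihom P ?X) \<beta>"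
    "\<And>a b c. a \<in> carrier S \<Longrightarrow> b \<in> carrier T \<Longrightarrow> c \<in> carrier P \<Longrightarrow> endpoint P ?X (\<beta> a b) c = ?\<phi> a b c"
    using curry2_exists by blast
  note L = tensor_lift_Cu[OF S T cu_ihom_cu[OF P X] \<beta>(1)]
  \<comment> \<open>The bimorphism into the internal hom is lifted over the first tensor product,
    and the third variable is then uncurried.\<close>
  have ex: "?Q (ihom_uncurry ?ST P ?X (tensor_lift S T (ihom P ?X) \<beta>))"
    using ihom_uncurry(1)[OF ST P X L]
    by (simp add: ihom_uncurry(2)[OF ST P X L] pure_closed[OF S T] tensor_lift_pure[OF S T cu_ihom_cu[OF P X] \<beta>(1)] \<beta>(2))
  have uniq: "\<gamma> = \<gamma>'" if "?Q \<gamma>" "?Q \<gamma>'" for \<gamma> \<gamma>'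
  proof -
    have g: "\<gamma> \<in> ?C" "\<gamma>' \<in> ?C" using that by blast+
    note c = ihom_curry[OF ST P X g(1)] and c' = ihom_curry[OF ST P X g(2)]
    \<comment> \<open>After currying, agreement on triple pure tensors is agreement of endpoints
      only. Equality on the pure tensors of \<open>S\<close> and \<open>T\<close> follows because
      both sides are bimorphisms in \<open>a\<close> and \<open>b\<close>.\<close>
    have "ihom_curry ?ST P ?X \<gamma> = ihom_curry ?ST P ?X \<gamma>'"
    proof (rule tensor_ext[OF S T cu_ihom_cu[OF P X] c(1) c'(1)])
      fix a b assume ab: "a \<in> carrier S" "b \<in> carrier T"
      show "ihom_curry ?ST P ?X \<gamma> (pure_tensor S T a b) = ihom_curry ?ST P ?X \<gamma>' (pure_tensor S T a b)"
        by (rule bimorphism_eq_if_endpoints_eq[OF S T bimorphism_postcomp[OF S T ST pure_bim[OF S T] c(1)]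
              bimorphism_postcomp[OF S T ST pure_bim[OF S T] c'(1)] _ ab])
          (use that in \<open>simp add: c(2) c'(2) pure_closed[OF S T]\<close>)
    qed
    then show ?thesis
      by (intro tensor_ext[OF ST P X g]) (metis c(2) c'(2))
  qed
  have "?Q (tensor_assoc S T P)"
    unfolding tensor_assoc_def by (rule theI[where P = ?Q, OF ex]) (rule uniq[OF _ ex])
  then show "tensor_assoc S T P \<in> ?C" "a \<in> carrier S \<Longrightarrow> b \<in> carrier T \<Longrightarrow> c \<in> carrier P \<Longrightarrow>
      tensor_assoc S T P (pure_tensor (cu_tensor S T) P (pure_tensor S T a b) c) = ?\<phi> a b c"
    by blast+
qed

section \<open>The composition product\<close>

context
  fixes S :: "('a, 'm) po_semigroup_scheme" and T :: "('b, 'n) po_semigroup_scheme"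
    and P :: "('c, 'k) po_semigroup_scheme"
  assumes S: "cu_semigroup S" and T: "cu_semigroup T" and P: "cu_semigroup P"
begin

lemma composition:
  shows composition_Cu: "composition S T P \<in> Cu (cu_tensor (ihom T P) (ihom S T)) (ihom S P)"
    and endpoint_composition: "y \<in> carrier (ihom T P) \<Longrightarrow> x \<in> carrier (ihom S T) \<Longrightarrow> s \<in> carrier S \<Longrightarrow>
      endpoint S P (composition S T P (pure_tensor (ihom T P) (ihom S T) y x)) s =
      endpoint T P y (endpoint S T x s)"
proof -
  let ?Y = "ihom T P" and ?X = "ihom S T"
  note Y = cu_ihom_cu[OF T P] and X = cu_ihom_cu[OF S T]
  note YX = cu_tensor_cu[OF Y X] and XS = cu_tensor_cu[OF X S]
  note YX_S = cu_tensor_cu[OF YX S] and Y_XS = cu_tensor_cu[OF Y XS] and YT = cu_tensor_cu[OF Y T]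
  note ass = tensor_assoc[OF Y X S] and ev = evaluation[OF S T] and ev' = evaluation[OF T P]
  note tm = tensor_map[OF Y XS Y T Cu_id[OF Y] ev(1)]
  let ?tm = "tensor_map ?Y (cu_tensor ?X S) ?Y T (\<lambda>y\<in>carrier ?Y. y) (evaluation S T)"
  let ?G = "\<lambda>z\<in>carrier (cu_tensor (cu_tensor ?Y ?X) S). evaluation T P (?tm (tensor_assoc ?Y ?X S z))"
  have "(\<lambda>z\<in>carrier (cu_tensor (cu_tensor ?Y ?X) S).
      evaluation T P ((\<lambda>w\<in>carrier (cu_tensor (cu_tensor ?Y ?X) S). ?tm (tensor_assoc ?Y ?X S w)) z))
      \<in> Cu (cu_tensor (cu_tensor ?Y ?X) S) P"
    by (rule Cu_comp[OF Cu_comp[OF ass(1) tm(1) YX_S] ev'(1) YX_S])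
  \<comment> \<open>\<open>Cu_comp\<close> leaves a restricted map inside another restriction to the
    same carrier; congruence removes the inner one and recovers the form used in
    \<open>composition\<close>.\<close>
  then have G: "?G \<in> Cu (cu_tensor (cu_tensor ?Y ?X) S) P"
    by (simp cong: restrict_cong)
  note c = ihom_curry[OF YX S P G, folded composition_def]
  show "composition S T P \<in> Cu (cu_tensor ?Y ?X) (ihom S P)" by (rule c(1))
  show "endpoint S P (composition S T P (pure_tensor ?Y ?X y x)) s = endpoint T P y (endpoint S T x s)"
    if "y \<in> carrier ?Y" "x \<in> carrier ?X" "s \<in> carrier S"
    using that by (simp add: c(2) pure_closed[OF Y X] pure_closed[OF YX S] pure_closed[OF X S]
        ass(2) tm(2) ev(2) ev'(2) cu_bimorphismD(1)[OF endpoint_bim[OF S T]])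
qed

end

section \<open>The semiring of endomorphisms\<close>

lemma ihom_semiring_simps:
  "carrier (ihom_semiring S) = carrier (ihom S S)" "le (ihom_semiring S) = le (ihom S S)"
  "eq (ihom_semiring S) = eq (ihom S S)"
  "add (ihom_semiring S) = add (ihom S S)" "\<zero>\<^bsub>ihom_semiring S\<^esub> = \<zero>\<^bsub>ihom S S\<^esub>"
  "rmult (ihom_semiring S) = (\<lambda>y x. composition S S S (pure_tensor (ihom S S) (ihom S S) y x))"
  "runit (ihom_semiring S) = const_class S S (\<lambda>a\<in>carrier S. a)"
  by (simp_all add: ihom_semiring_def po_semigroup.extend_def po_semiring.fields_def ihom_def)

text \<open>The semiring record adds only multiplication and unit, while \<open>Cu\<close> looks at
  order, addition and zero.\<close>

lemma Cu_ihom_semiring: "Cu R (ihom_semiring S) = Cu R (ihom S S)"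
proof -
  have sup: "has_sup (ihom_semiring S) A x \<longleftrightarrow> has_sup (ihom S S) A x" for A x
    by (simp add: has_sup_iff ihom_semiring_simps)
  have "x \<lless>\<^bsub>ihom_semiring S\<^esub> y \<longleftrightarrow> x \<lless>\<^bsub>ihom S S\<^esub> y" for x y
    by (simp add: way_below_def inc_seq_def sup ihom_semiring_simps)
  then show ?thesis
    by (simp add: Cu_def gen_Cu_def po_hom_def sup ihom_semiring_simps)
qed

text \<open>Supplies the requirement on the order of the codomain that is part of
  \<open>order_emb\<close>.\<close>

lemma weak_partial_order_ihom_semiring:
  assumes "cu_semigroup S" shows "weak_partial_order (ihom_semiring S)"
proof -
  interpret I: cu_sg "ihom S S" by unfold_locales (rule cu_ihom_cu[OF assms assms])
  show ?thesis
  proof (unfold_locales, unfold ihom_semiring_simps I.eq_is_equal)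
    show "x \<sqsubseteq>\<^bsub>ihom S S\<^esub> z"
      if "x \<sqsubseteq>\<^bsub>ihom S S\<^esub> y" "y \<sqsubseteq>\<^bsub>ihom S S\<^esub> z" "x \<in> carrier (ihom S S)" "y \<in> carrier (ihom S S)"
        "z \<in> carrier (ihom S S)" for x y z
      by (rule I.le_trans[OF that])
  qed (simp_all add: I.le_antisym)
qed

text \<open>For a Cu-morphism, \<open>hom_prec S T \<phi> \<phi>\<close> holds and the single pair
  of \<open>\<phi>\<close> with itself is an interpolating family. Hence \<open>\<phi>\<close> lies
  in the ideal of its constant path and bounds it, which gives compactness and the value of the
  endpoint.\<close>

context cu_hom
begin

lemma const_class:
  assumes \<phi>: "\<phi> \<in> Cu S T"
  shows "const_class S T \<phi> \<in> carrier (ihom S T)"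
    and "class_ideal (const_class S T \<phi>) = {\<psi>. dprec \<psi> \<phi>}"
    and "const_class S T \<phi> \<lless>\<^bsub>ihom S T\<^esub> const_class S T \<phi>"
    and "a \<in> carrier S \<Longrightarrow> endpoint S T (const_class S T \<phi>) a = \<phi> a"
proof -
  have hp: "hom_prec S T \<phi> \<phi>" unfolding hom_prec_def using Cu_way_below[OF \<phi>] by blast
  note p = const_path[OF Cu_gen[OF \<phi>] hp]
  have d: "dprec \<phi> \<phi>"
    by (rule dprecI[of "\<lambda>\<alpha> \<beta>. \<alpha> = \<phi> \<and> \<beta> = \<phi>"]) (use Cu_gen[OF \<phi>] hp in auto)
  show c: "const_class S T \<phi> \<in> carrier (ihom S T)"
    unfolding const_class_def ihom_carrier using p by blast
  show I: "class_ideal (const_class S T \<phi>) = {\<psi>. dprec \<psi> \<phi>}"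
    unfolding const_class_def class_ideal[OF p] by (rule const_path_ideal)
  show "const_class S T \<phi> \<lless>\<^bsub>ihom S T\<^esub> const_class S T \<phi>"
    unfolding iso.way_below_h[OF c c] H.way_below_completion
    using class_ideal_round[OF c] d by (auto simp: I)
  show "endpoint S T (const_class S T \<phi>) a = \<phi> a" if a: "a \<in> carrier S"
  proof (rule T.le_antisym)
    note fa = gen_CuD(1)[OF Cu_gen[OF \<phi>] a]
    show "endpoint S T (const_class S T \<phi>) a \<sqsubseteq>\<^bsub>T\<^esub> \<phi> a"
      by (rule endpoint_least[OF c a fa]) (use I dprecD(1-3) a in \<open>auto intro: hom_prec_le\<close>)
    show "\<phi> a \<sqsubseteq>\<^bsub>T\<^esub> endpoint S T (const_class S T \<phi>) a"
      by (rule endpoint_upper[OF c a]) (simp add: I d)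
  qed (use a c endpoint_closed gen_CuD(1)[OF Cu_gen[OF \<phi>]] in auto)
qed

end

theorem proposition5p15:
  fixes R :: "'a po_semiring"
  assumes "cu_semiring R"
  shows "pi_map R \<in> Cu R (ihom_semiring R)
    \<and> order_emb R (ihom_semiring R) (pi_map R)
    \<and> (\<forall>r\<in>carrier R. \<forall>s\<in>carrier R.
         pi_map R (rmult R r s) = rmult (ihom_semiring R) (pi_map R r) (pi_map R s))
    \<and> subsemiring (pi_map R ` carrier R) (ihom_semiring R)
    \<and> (compact_elt R (runit R) \<longrightarrow>
         pi_map R (runit R) = runit (ihom_semiring R)
         \<and> unital_subsemiring (pi_map R ` carrier R) (ihom_semiring R))"
proof -
  let ?H = "ihom R R" and ?p = "pi_map R" and ?m = "rmult R" and ?e = "runit R"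
  let ?comp = "\<lambda>y x. composition R R R (pure_tensor ?H ?H y x)"
  have R: "cu_semigroup R" and bim: "cu_bimorphism R R R ?m"
    and mon: "monoid \<lparr>carrier = carrier R, mult = ?m, one = ?e\<rparr>"
    using assms unfolding cu_semiring_def by blast+
  interpret cu_hom R R by (rule cu_homI[OF R R])
  interpret I: cu_sg ?H using cu_ihom_cu[OF R R] by unfold_locales
  have m_closed: "?m r s \<in> carrier R" if "r \<in> carrier R" "s \<in> carrier R" for r s
    using cu_bimorphismD(1)[OF bim that] .
  have m_assoc: "?m (?m r s) t = ?m r (?m s t)" if "r \<in> carrier R" "s \<in> carrier R" "t \<in> carrier R" for r s t
    using monoid.m_assoc[OF mon, of r s t] that by simp
  have e: "?e \<in> carrier R" "\<And>r. r \<in> carrier R \<Longrightarrow> ?m r ?e = r" "\<And>r. r \<in> carrier R \<Longrightarrow> ?m ?e r = r"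
    using monoid.one_closed[OF mon] monoid.r_one[OF mon] monoid.l_one[OF mon] by simp_all
  note mu = tensor_lift_Cu[OF R R R bim, folded mult_map_def] tensor_lift_pure[OF R R R bim, folded mult_map_def]
  note pc = ihom_curry[OF R R R mu(1), folded pi_map_def]
  have p_Cu: "?p \<in> Cu R ?H" by (rule pc(1))
  note p = gen_CuD[OF Cu_gen[OF p_Cu]]
  have p_endpoint: "endpoint R R (?p r) s = ?m r s" if "r \<in> carrier R" "s \<in> carrier R" for r s
    using that by (simp add: pc(2) mu(2))
  have emb: "?p r \<sqsubseteq>\<^bsub>?H\<^esub> ?p s \<longleftrightarrow> r \<sqsubseteq>\<^bsub>R\<^esub> s" if rs: "r \<in> carrier R" "s \<in> carrier R" for r s
  proof
    assume "?p r \<sqsubseteq>\<^bsub>?H\<^esub> ?p s"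
    then have "endpoint R R (?p r) ?e \<sqsubseteq>\<^bsub>R\<^esub> endpoint R R (?p s) ?e"
      by (rule cu_bimorphismD(6)[OF endpoint_bimorphism p(1)[OF rs(1)] p(1)[OF rs(2)] e(1)])
    then show "r \<sqsubseteq>\<^bsub>R\<^esub> s" by (simp add: p_endpoint rs e)
  qed (rule p(4)[OF rs])
  have mult: "?p (?m r s) = ?comp (?p r) (?p s)" if rs: "r \<in> carrier R" "s \<in> carrier R" for r s
  proof (rule bimorphism_eq_if_endpoints_eq[OF R R _ _ _ rs])
    show "cu_bimorphism R R ?H (\<lambda>r s. ?p (?m r s))"
      by (rule bimorphism_postcomp[OF R R R bim p_Cu])
    show "cu_bimorphism R R ?H (\<lambda>r s. ?comp (?p r) (?p s))"
      by (rule cu_bimorphism_comp[OF cu_tensor_cu[OF I.cu I.cu] pure_bim[OF I.cu I.cu] p_Cu p_Cu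
            composition_Cu[OF R R R]])
    show "endpoint R R (?p (?m r s)) t = endpoint R R (?comp (?p r) (?p s)) t"
      if "r \<in> carrier R" "s \<in> carrier R" "t \<in> carrier R" for r s t
      using that by (simp add: p_endpoint m_closed m_assoc p(1) endpoint_composition[OF R R R])
  qed
  have sub: "subsemiring (?p ` carrier R) (ihom_semiring R)"
    unfolding subsemiring_def ihom_semiring_simps
  proof (intro conjI ballI)
    show "\<zero>\<^bsub>?H\<^esub> \<in> ?p ` carrier R" using p(2) by force
    fix x y assume "x \<in> ?p ` carrier R" "y \<in> ?p ` carrier R"
    then obtain r s where rs: "r \<in> carrier R" "s \<in> carrier R" "x = ?p r" "y = ?p s" by blast
    show "x \<oplus>\<^bsub>?H\<^esub> y \<in> ?p ` carrier R"
      unfolding rs(3,4) p(3)[OF rs(1,2), symmetric] by (rule imageI) (simp add: rs)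
    show "?comp x y \<in> ?p ` carrier R"
      unfolding rs(3,4) mult[OF rs(1,2), symmetric] by (rule imageI) (simp add: rs m_closed)
  qed (use p(1) in blast)
  have unit: "?p ?e = runit (ihom_semiring R)" if "compact_elt R ?e"
  proof -
    let ?i = "const_class R R (\<lambda>a\<in>carrier R. a)"
    note i = const_class[OF Cu_id[OF R]]
    have pe: "?p ?e \<lless>\<^bsub>?H\<^esub> ?p ?e" using Cu_way_below[OF p_Cu] that unfolding compact_elt_def by blast
    have "?p ?e = ?i"
      \<comment> \<open>Compactness of both elements is what makes the constant sequences way-below
        increasing.\<close>
      by (rule ihom_eq_if_endpoints_eq[where xs = "\<lambda>_. ?p ?e" and ys = "\<lambda>_. ?i"])
        (simp_all add: pe i I.has_sup_const[simplified] p(1) e p_endpoint)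
    then show ?thesis by (simp add: ihom_semiring_simps)
  qed
  have "?p ?e \<in> ?p ` carrier R" using e(1) by blast
  then have "compact_elt R ?e \<longrightarrow> ?p ?e = runit (ihom_semiring R) \<and>
      unital_subsemiring (?p ` carrier R) (ihom_semiring R)"
    using unit sub unfolding unital_subsemiring_def by metis
  moreover have "order_emb R (ihom_semiring R) ?p"
    unfolding order_emb_def
    using S.weak_po weak_partial_order_ihom_semiring[OF R] emb by (simp add: ihom_semiring_simps)
  moreover have "\<forall>r\<in>carrier R. \<forall>s\<in>carrier R.
      ?p (?m r s) = rmult (ihom_semiring R) (?p r) (?p s)"
    using mult by (simp add: ihom_semiring_simps)
  ultimately show ?thesis
    using p_Cu sub unfolding Cu_ihom_semiring by blast
qed

end
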